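(* Let $n\ge 3$ be an integer and let $2<k<n$. Let $u_0\in PM^k$ and let $V\in PM^{n-2}$ satisfy $\|V\|_{PM^{n-2}}<1/C_{n-2,k}$, where $C_{n-2,k}=\frac{K(2,n-k,n)}{4\pi^2}$. Let $u$ be the unique solution in $X_k$ of the functional equation $u(t)=G(t)u_0+L_V(u)(t)$. (i) (Self-similarity) If $u_0$ and $V$ are homogeneous of degree $-(n-k)$ and $-2$, respectively, then $u$ is self-similar, i.e. for every $\lambda>0$ $$u(x,t)=u_\lambda(x,t):=\lambda^{n-k}u(\lambda x,\lambda^2t)\quad\text{for all }x\in\mathbb{R}^n,\ t>0$$ (as an equality of tempered distributions in $x$ for each $t>0$). (ii) (Positivity) If $V\ge 0$, $u_0\ge 0$ (resp. $V\ge 0$, $u_0\le 0$) and $u_0\not\equiv 0$, then $u(\cdot,t)$ is positive (resp. negative) for every $t>0$. (iii) (Radial symmetry) Let $V$ be radially symmetric. Then $u(\cdot,t)$ is radially symmetric for each $t>0$ if and only if $u_0$ is radially symmetric.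
   Context: The Fourier transform is $\hat f(\xi)=\int_{\mathbb{R}^n}f(x)e^{-2\pi i\xi\cdot x}\,dx$ on $\mathcal{S}(\mathbb{R}^n)$, extended to $\mathcal{S}'(\mathbb{R}^n)$. For $k\ge 0$, $PM^k$ is the Banach space of $u\in\mathcal{S}'(\mathbb{R}^n)$ such that $\hat u\in L^1_{loc}(\mathbb{R}^n)$ and $\|u\|_{PM^k}:=\operatorname{ess\,sup}_{\xi\in\mathbb{R}^n}|\xi|^k|\hat u(\xi)|<\infty$. $X_k=BC_w([0,\infty);PM^k)$ is the space of bounded functions $u:[0,\infty)\to PM^k$ which are continuous in time, at each $t\ge 0$, in the weak sense of $\mathcal{S}'(\mathbb{R}^n)$, with norm $\|u\|_{X_k}=\sup_{t>0}\|u(\cdot,t)\|_{PM^k}$. The operators $G(t)$ and $L_V$ are defined via the Fourier transform by $$\widehat{G(t)u_0}(\xi)=e^{-4\pi^2|\xi|^2t}\,\hat u_0(\xi),\qquad \widehat{L_V(u)}(\xi,t)=\int_0^t e^{-4\pi^2|\xi|^2(t-s)}\big(\hat V\ast\hat u(\cdot,s)\big)(\xi)\,ds,$$ where $\ast$ is convolution in $\mathbb{R}^n$ and the time integral is understood weakly (tested against functions of $\mathcal{S}(\mathbb{R}^n)$). The functional equation $u(t)=G(t)u_0+L_V(u)(t)$ is the integral formulation of $u_t-\Delta u-V(x)u=0$, $u(x,0)=u_0(x)$; under the stated smallness condition on $V$ it has a unique solution in $X_k$. $K(\theta_1,\theta_2,n)=\dfrac{\nu_{\theta_1}\nu_{\theta_2}\nu_{n-\theta_1-\theta_2}}{\nu_{\theta_1+\theta_2}\nu_{n-\theta_1}\nu_{n-\theta_2}}$,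 where $\nu_\theta=\pi^{-\theta/2}\Gamma(\theta/2)$ and $\Gamma$ is the Gamma function. Homogeneity and radial symmetry are understood in the sense of tempered distributions. A distribution $F\in\mathcal{S}'(\mathbb{R}^n)$ is nonnegative, $F\ge 0$ (resp. nonpositive, $F\le 0$) if $\langle F,\varphi\rangle\ge 0$ (resp. $\le 0$) for all $\varphi\in\mathcal{S}(\mathbb{R}^n)$ with $\varphi\ge 0$. It is positive (resp. negative) if $\langle F,\varphi\rangle>0$ (resp. $<0$) for all $\varphi\in\mathcal{S}(\mathbb{R}^n)$ with $\varphi>0$ everywhere. *)

theory Defs
  imports
    "HOL-Probability.Essential_Supremum"
    "HOL-Analysis.Analysis"
    "HOL-Library.Complex_Order"
begin

text \<open>
  The space is \<open>real ^ 'n\<close>, of dimension \<open>n = CARD('n)\<close>. The theory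
  Complex_Order provides the usual partial order on complex numbers, for which
  \<open>0 \<le> z\<close> (\<open>0 < z\<close>) means that \<open>z\<close> is real and nonnegative (positive).
\<close>

subsection \<open>Schwartz functions and tempered distributions\<close>

text \<open>\<open>iterated_partial [i\<^sub>1, \<dots>, i\<^sub>m] \<phi>\<close> is the partial derivative of \<open>\<phi>\<close> of order \<open>m\<close>
  in the coordinate directions \<open>i\<^sub>m, \<dots>, i\<^sub>1\<close>; such lists play the role of multi-indices.\<close>

primrec iterated_partial :: "'n::finite list \<Rightarrow> (real ^ 'n \<Rightarrow> complex) \<Rightarrow> real ^ 'n \<Rightarrow> complex" where
  "iterated_partial [] \<phi> = \<phi>"
| "iterated_partial (i # is) \<phi> =
     (\<lambda>x. frechet_derivative (iterated_partial is \<phi>) (at x) (axis i 1))"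

definition schwartz :: "(real ^ 'n::finite \<Rightarrow> complex) set" where
  "schwartz = {\<phi>. (\<forall>is x. iterated_partial is \<phi> differentiable (at x)) \<and>
     (\<forall>is N. bounded (range (\<lambda>x. (1 + norm x) ^ N *\<^sub>R iterated_partial is \<phi> x)))}"

definition schwartz_tendsto ::
    "(nat \<Rightarrow> real ^ 'n::finite \<Rightarrow> complex) \<Rightarrow> (real ^ 'n \<Rightarrow> complex) \<Rightarrow> bool" where
  "schwartz_tendsto \<Phi> \<phi> \<longleftrightarrow>
     (\<forall>is N. uniform_limit UNIV
        (\<lambda>j x. (1 + norm x) ^ N *\<^sub>R iterated_partial is (\<Phi> j) x)
        (\<lambda>x. (1 + norm x) ^ N *\<^sub>R iterated_partial is \<phi> x) sequentially)"

text \<open>A distribution is a functional of which only the values on \<^const>\<open>schwartz\<close> matter;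
  equality of distributions therefore means agreement on \<^const>\<open>schwartz\<close>, and is written
  out in that way throughout. The Schwartz space is metrizable, so continuity is
  sequential continuity.\<close>

type_synonym 'n tdist = "(real ^ 'n \<Rightarrow> complex) \<Rightarrow> complex"

definition tempered :: "'n::finite tdist \<Rightarrow> bool" where
  "tempered T \<longleftrightarrow>
     (\<forall>\<phi>\<in>schwartz. \<forall>\<psi>\<in>schwartz. T (\<lambda>x. \<phi> x + \<psi> x) = T \<phi> + T \<psi>) \<and>
     (\<forall>c. \<forall>\<phi>\<in>schwartz. T (\<lambda>x. c * \<phi> x) = c * T \<phi>) \<and>
     (\<forall>\<Phi>. \<forall>\<phi>\<in>schwartz. (\<forall>j. \<Phi> j \<in> schwartz) \<longrightarrow> schwartz_tendsto \<Phi> \<phi> \<longrightarrow>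
        (\<lambda>j. T (\<Phi> j)) \<longlonglongrightarrow> T \<phi>)"

definition dist_nonneg :: "'n::finite tdist \<Rightarrow> bool" where
  "dist_nonneg T \<longleftrightarrow> (\<forall>\<phi>\<in>schwartz. (\<forall>x. 0 \<le> \<phi> x) \<longrightarrow> 0 \<le> T \<phi>)"

definition dist_nonpos :: "'n::finite tdist \<Rightarrow> bool" where
  "dist_nonpos T \<longleftrightarrow> (\<forall>\<phi>\<in>schwartz. (\<forall>x. 0 \<le> \<phi> x) \<longrightarrow> T \<phi> \<le> 0)"

definition dist_pos :: "'n::finite tdist \<Rightarrow> bool" where
  "dist_pos T \<longleftrightarrow> (\<forall>\<phi>\<in>schwartz. (\<forall>x. 0 < \<phi> x) \<longrightarrow> 0 < T \<phi>)"

definition dist_neg :: "'n::finite tdist \<Rightarrow> bool" where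
  "dist_neg T \<longleftrightarrow> (\<forall>\<phi>\<in>schwartz. (\<forall>x. 0 < \<phi> x) \<longrightarrow> T \<phi> < 0)"

text \<open>\<open>dilate r T\<close> is the distribution \<open>x \<mapsto> T(r x)\<close>.\<close>

definition dilate :: "real \<Rightarrow> 'n::finite tdist \<Rightarrow> 'n tdist" where
  "dilate r T = (\<lambda>\<phi>. complex_of_real (r powr (- real CARD('n))) * T (\<lambda>x. \<phi> (x /\<^sub>R r)))"

definition homogeneous :: "real \<Rightarrow> 'n::finite tdist \<Rightarrow> bool" where
  "homogeneous d T \<longleftrightarrow>
     (\<forall>r>0. \<forall>\<phi>\<in>schwartz. dilate r T \<phi> = complex_of_real (r powr d) * T \<phi>)"

definition radially_symmetric :: "'n::finite tdist \<Rightarrow> bool" where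
  "radially_symmetric T \<longleftrightarrow>
     (\<forall>R. orthogonal_transformation R \<longrightarrow> (\<forall>\<phi>\<in>schwartz. T (\<phi> \<circ> R) = T \<phi>))"

subsection \<open>Fourier transform\<close>

definition fourier :: "(real ^ 'n::finite \<Rightarrow> complex) \<Rightarrow> real ^ 'n \<Rightarrow> complex" where
  "fourier \<phi> \<xi> = (LINT x|lborel. \<phi> x * exp (- 2 * pi * \<i> * complex_of_real (\<xi> \<bullet> x)))"

definition inv_fourier :: "(real ^ 'n::finite \<Rightarrow> complex) \<Rightarrow> real ^ 'n \<Rightarrow> complex" where
  "inv_fourier \<phi> x = (LINT \<xi>|lborel. \<phi> \<xi> * exp (2 * pi * \<i> * complex_of_real (\<xi> \<bullet> x)))"

definition fourier_dist :: "'n::finite tdist \<Rightarrow> 'n tdist" where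
  "fourier_dist T = (\<lambda>\<phi>. T (fourier \<phi>))"

definition inv_fourier_dist :: "'n::finite tdist \<Rightarrow> 'n tdist" where
  "inv_fourier_dist T = (\<lambda>\<phi>. T (inv_fourier \<phi>))"

subsection \<open>The spaces \<open>PM\<^sup>k\<close> and \<open>X\<^sub>k\<close>\<close>

definition locally_integrable :: "(real ^ 'n::finite \<Rightarrow> complex) \<Rightarrow> bool" where
  "locally_integrable f \<longleftrightarrow> (\<forall>A. compact A \<longrightarrow> set_integrable lborel A f)"

text \<open>The integrability requirement is automatic for locally integrable \<open>f\<close> with
  \<open>|\<xi>|\<^sup>k f(\<xi>)\<close> essentially bounded, \<open>k \<ge> 0\<close>.\<close>

definition represented_by :: "'n::finite tdist \<Rightarrow> (real ^ 'n \<Rightarrow> complex) \<Rightarrow> bool" where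
  "represented_by T f \<longleftrightarrow> locally_integrable f \<and>
     (\<forall>\<phi>\<in>schwartz. integrable lborel (\<lambda>\<xi>. f \<xi> * \<phi> \<xi>) \<and> T \<phi> = (LINT \<xi>|lborel. f \<xi> * \<phi> \<xi>))"

text \<open>The Fourier transform of \<open>T\<close> as a function; it is determined almost everywhere.\<close>

definition fourier_fun :: "'n::finite tdist \<Rightarrow> real ^ 'n \<Rightarrow> complex" where
  "fourier_fun T = (SOME f. represented_by (fourier_dist T) f)"

definition PM_norm :: "real \<Rightarrow> 'n::finite tdist \<Rightarrow> ennreal" where
  "PM_norm k T = esssup lborel (\<lambda>\<xi>. ennreal (norm \<xi> powr k * norm (fourier_fun T \<xi>)))"

definition PM :: "real \<Rightarrow> 'n::finite tdist set" where
  "PM k = {T. tempered T \<and> (\<exists>f. represented_by (fourier_dist T) f) \<and> PM_norm k T < \<infinity>}"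

text \<open>Only the values at times \<open>t \<ge> 0\<close> matter.\<close>

definition X_space :: "real \<Rightarrow> (real \<Rightarrow> 'n::finite tdist) set" where
  "X_space k = {u. (\<forall>t\<ge>0. u t \<in> PM k) \<and> (SUP t\<in>{0..}. PM_norm k (u t)) < \<infinity> \<and>
     (\<forall>\<phi>\<in>schwartz. continuous_on {0..} (\<lambda>t. u t \<phi>))}"

subsection \<open>The operators \<open>G(t)\<close> and \<open>L\<^sub>V\<close>\<close>

definition heat_symbol :: "real \<Rightarrow> real ^ 'n::finite \<Rightarrow> complex" where
  "heat_symbol t \<xi> = complex_of_real (exp (- 4 * pi\<^sup>2 * (norm \<xi>)\<^sup>2 * t))"

definition heat_op :: "real \<Rightarrow> 'n::finite tdist \<Rightarrow> 'n tdist" where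
  "heat_op t T = inv_fourier_dist (\<lambda>\<psi>. fourier_dist T (\<lambda>\<xi>. heat_symbol t \<xi> * \<psi> \<xi>))"

definition convolution ::
    "(real ^ 'n::finite \<Rightarrow> complex) \<Rightarrow> (real ^ 'n \<Rightarrow> complex) \<Rightarrow> real ^ 'n \<Rightarrow> complex" where
  "convolution f g \<xi> = (LINT \<eta>|lborel. f (\<xi> - \<eta>) * g \<eta>)"

text \<open>The time integral is weak: the integrand is paired with a test function before
  integrating in \<open>s\<close>.\<close>

definition L_op :: "'n::finite tdist \<Rightarrow> (real \<Rightarrow> 'n tdist) \<Rightarrow> real \<Rightarrow> 'n tdist" where
  "L_op V u t = inv_fourier_dist (\<lambda>\<psi>.
     (LINT s:{0..t}|lborel.
       (LINT \<xi>|lborel. heat_symbol (t - s) \<xi> *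
          convolution (fourier_fun V) (fourier_fun (u s)) \<xi> * \<psi> \<xi>)))"

definition is_solution ::
    "'n::finite tdist \<Rightarrow> 'n tdist \<Rightarrow> (real \<Rightarrow> 'n tdist) \<Rightarrow> bool" where
  "is_solution V u\<^sub>0 u \<longleftrightarrow>
     (\<forall>t\<ge>0. \<forall>\<phi>\<in>schwartz. u t \<phi> = heat_op t u\<^sub>0 \<phi> + L_op V u t \<phi>)"

subsection \<open>Constants\<close>

definition nu :: "real \<Rightarrow> real" where
  "nu \<theta> = pi powr (- \<theta> / 2) * Gamma (\<theta> / 2)"

definition K_const :: "real \<Rightarrow> real \<Rightarrow> real \<Rightarrow> real" where
  "K_const \<theta>\<^sub>1 \<theta>\<^sub>2 n =
     (nu \<theta>\<^sub>1 * nu \<theta>\<^sub>2 * nu (n - \<theta>\<^sub>1 - \<theta>\<^sub>2)) / (nu (\<theta>\<^sub>1 + \<theta>\<^sub>2) * nu (n - \<theta>\<^sub>1) * nu (n - \<theta>\<^sub>2))"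

text \<open>This is \<open>C\<^bsub>n-2,k\<^esub>\<close>.\<close>

definition C_const :: "real \<Rightarrow> real \<Rightarrow> real" where
  "C_const n k = K_const 2 (n - k) n / (4 * pi\<^sup>2)"

end

theory Submission
  imports Defs "HOL-Probability.Probability"
begin

text \<open>
  Everything happens on the Fourier side, where the data are functions \<open>a\<close> (for \<open>V\<close>) and \<open>b\<close>
  (for \<open>u\<^sub>0\<close>) with \<open>|a(\<xi>)| \<le> v |\<xi>|\<^bsup>2-n\<^esup>\<close> and \<open>|b(\<xi>)| \<le> M |\<xi>|\<^bsup>-k\<^esup>\<close>. The composition formula for Riesz
  kernels and \<open>\<integral>\<^sub>0\<^sup>t e\<^bsup>-4\<pi>\<^sup>2|\<xi>|\<^sup>2(t-s)\<^esup> ds \<le> 1/(4\<pi>\<^sup>2|\<xi>|\<^sup>2)\<close> make the integral equation a contraction with constant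
  \<open>v C\<^bsub>n-2,k\<^esub> < 1\<close>, so every solution is the limit of the Picard iterates started at \<open>0\<close>. The iterates are
  explicit, and each property of the solution is proved for them by induction: homogeneity and
  rotation invariance by changes of variables, and nonnegativity by testing with modulated
  Gaussians, a property that is stable under convolution with \<open>a\<close>. Strict positivity comes from the first
  iterate: \<open>G(t)u\<^sub>0\<close> is a nonnegative function that does not vanish almost everywhere.
\<close>

text \<open>The solution enters only through its pairings with Schwartz functions: its Fourier
  transform is chosen anew at each time, so nothing is known about joint measurability in time and
  frequency, and its distance to an iterate cannot be estimated pointwise in \<xi> under the time
  integral. The error is therefore measured by duality, against the integral \<open>W \<psi>\<close>
  of |\<xi>|^(-k) |\<psi>|. To iterate such a bound, convolution with \<open>a\<close> has to be
  transposed onto the test function, but the transposed function need not be Schwartz. Damping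
  \<open>a\<close> by Gaussians gives Schwartz functions \<open>chi j \<phi>\<close> whose
  \<open>W\<close> is bounded uniformly in \<open>j\<close> and whose pairings converge to the
  convolution term. The same approximation shows that the time integrand is measurable, without
  which the Bochner integral in the equation would take the default value 0. The iterates themselves
  are jointly measurable, so Fubini applies to them. The sharp constant comes from writing negative
  powers of the norm as superpositions of Gaussians, for which convolution is explicit.\<close>

hide_const (open) Convolution.convolution
hide_fact (open) Convolution.convolution_def

section \<open>Lebesgue measure on Euclidean space\<close>

text \<open>\<open>lborel_affine\<close> writes \<open>lborel\<close> as a density over the image
  measure; multiplying by the reciprocal density solves for the image measure, the form that the
  transformation rules need.\<close>

lemma distr_lborel_affine:
  fixes t :: "'a::euclidean_space"
  assumes "c \<noteq> 0"
  shows "distr lborel borel (\<lambda>x. t + c *\<^sub>R x) = density lborel (\<lambda>_. ennreal (1 / \<bar>c\<bar> ^ DIM('a)))"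
proof -
  let ?T = "\<lambda>x::'a. t + c *\<^sub>R x" let ?D = "distr lborel borel ?T"
  have "density lborel (\<lambda>_. ennreal (1 / \<bar>c\<bar> ^ DIM('a)))
      = density (density ?D (\<lambda>_. ennreal (\<bar>c\<bar> ^ DIM('a)))) (\<lambda>_. ennreal (1 / \<bar>c\<bar> ^ DIM('a)))"
    using lborel_affine[OF assms, of t] by (simp add: ennreal_power)
  also have "\<dots> = density ?D (\<lambda>_. ennreal (\<bar>c\<bar> ^ DIM('a)) * ennreal (1 / \<bar>c\<bar> ^ DIM('a)))"
    by (subst density_density_eq) auto
  also have "(\<lambda>_. ennreal (\<bar>c\<bar> ^ DIM('a)) * ennreal (1 / \<bar>c\<bar> ^ DIM('a))) = (\<lambda>_::'a. 1::ennreal)"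
    using assms by (subst ennreal_mult[symmetric]) auto
  finally show ?thesis by (simp add: density_1)
qed

lemma nn_integral_affine:
  fixes t :: "'a::euclidean_space"
  assumes "c \<noteq> 0" and [measurable]: "f \<in> borel_measurable borel"
  shows "(\<integral>\<^sup>+x. f (t + c *\<^sub>R x) \<partial>lborel) = ennreal (1 / \<bar>c\<bar> ^ DIM('a)) * (\<integral>\<^sup>+x. f x \<partial>lborel)"
proof -
  have "(\<integral>\<^sup>+x. f (t + c *\<^sub>R x) \<partial>lborel) = (\<integral>\<^sup>+x. f x \<partial>distr lborel borel (\<lambda>x. t + c *\<^sub>R x))"
    by (simp add: nn_integral_distr)
  then show ?thesis
    by (simp add: distr_lborel_affine[OF assms(1)] nn_integral_density nn_integral_cmult)
qed

lemma integrable_affine_iff: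
  fixes t :: "'a::euclidean_space" and f :: "'a \<Rightarrow> 'b::{banach, second_countable_topology}"
  assumes "c \<noteq> 0" and [measurable]: "f \<in> borel_measurable borel"
  shows "integrable lborel (\<lambda>x. f (t + c *\<^sub>R x)) \<longleftrightarrow> integrable lborel f"
  using assms(1)
  by (simp add: integrable_iff_bounded nn_integral_affine[where f = "\<lambda>x. ennreal (norm (f x))"]
      ennreal_mult_less_top ennreal_zero_less_mult_iff)
     (auto simp: ennreal_mult_less_top ennreal_eq_0_iff)

lemma integral_affine:
  fixes t :: "'a::euclidean_space" and f :: "'a \<Rightarrow> 'b::{banach, second_countable_topology}"
  assumes "c \<noteq> 0" and [measurable]: "f \<in> borel_measurable borel"
  shows "(LBINT x. f (t + c *\<^sub>R x)) = (1 / \<bar>c\<bar> ^ DIM('a)) *\<^sub>R (LBINT x. f x)"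
proof -
  have "(LBINT x. f (t + c *\<^sub>R x)) = (LINT x|distr lborel borel (\<lambda>x. t + c *\<^sub>R x). f x)"
    by (simp add: integral_distr)
  then show ?thesis
    by (simp add: distr_lborel_affine[OF assms(1)] integral_density)
qed

text \<open>The exceptional set need not be measurable, so a null set containing it is pulled back
  instead.\<close>

lemma AE_affine:
  fixes t :: "'a::euclidean_space"
  assumes "c \<noteq> 0" "AE x in lborel. P x"
  shows "AE x in lborel. P (t + c *\<^sub>R x)"
proof -
  obtain N where N: "N \<in> null_sets lborel" "{x. \<not> P x} \<subseteq> N"
    using assms(2) by (auto elim!: AE_E simp: null_sets_def)
  have [measurable]: "N \<in> sets borel" using N by auto
  have "AE x in lborel. x \<notin> N" using N(1) by (rule AE_not_in)
  then have "AE x in density lborel (\<lambda>_. ennreal (1 / \<bar>c\<bar> ^ DIM('a))). x \<notin> N"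
    by (subst AE_density) auto
  then have "AE x in distr lborel borel (\<lambda>x. t + c *\<^sub>R x). x \<notin> N"
    by (subst distr_lborel_affine[OF assms(1)])
  then have "AE x in lborel. t + c *\<^sub>R x \<notin> N"
    by (subst (asm) AE_distr_iff) auto
  then show ?thesis using N(2) by (auto elim!: eventually_mono)
qed

lemmas nn_integral_translate = nn_integral_affine[of 1, simplified]
lemmas integrable_translate_iff = integrable_affine_iff[of 1, simplified]
lemmas lebesgue_integral_translate = integral_affine[of 1, simplified]
lemmas nn_integral_reflect = nn_integral_affine[of "-1", simplified]
lemmas AE_reflect = AE_affine[of "-1", simplified]

section \<open>Gaussian integrals and their oscillating versions\<close>

lemma gaussian_1d:
  assumes "c > 0"
  shows "integrable lborel (\<lambda>x::real. exp (- c * x\<^sup>2))"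
    and "(LBINT x. complex_of_real (exp (- c * x\<^sup>2)) * cis (x * b))
           = complex_of_real (sqrt (pi / c) * exp (- b\<^sup>2 / (4 * c)))"
proof -
  \<comment> \<open>Rescaling by \<open>s\<close> turns the standard normal density into a multiple
    of exp(-c x^2), so the known characteristic function, taken at \<open>b / s\<close>, gives the
    integral.\<close>
  define s where "s = sqrt (2 * c)"
  have s: "s > 0" "s\<^sup>2 = 2 * c" using assms by (auto simp: s_def)
  have "integrable lborel (\<lambda>x::real. std_normal_density (0 + s * x))"
    by (subst lborel_integrable_real_affine_iff) (use s in auto)
  then have "integrable lborel (\<lambda>x::real. sqrt (2*pi) * std_normal_density (0 + s * x))"
    by (rule integrable_mult_right)
  also have "(\<lambda>x::real. sqrt (2*pi) * std_normal_density (0 + s * x)) = (\<lambda>x. exp (- c * x\<^sup>2))"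
    using s by (auto simp: std_normal_density_def power_mult_distrib)
  finally show "integrable lborel (\<lambda>x::real. exp (- c * x\<^sup>2))" .
  define t where "t = b / s"
  have "complex_of_real (exp (- t\<^sup>2 / 2)) = char std_normal_distribution t"
    by (simp add: char_std_normal_distribution)
  also have "\<dots> = (LBINT x. std_normal_density x *\<^sub>R iexp (t * x))"
    unfolding char_def by (subst integral_density) (auto simp: normal_density_nonneg)
  also have "\<dots> = s *\<^sub>R (LBINT x. std_normal_density (0 + s * x) *\<^sub>R iexp (t * (0 + s * x)))"
    using s by (subst lborel_integral_real_affine[of s _ 0]) auto
  also have "(\<lambda>x. std_normal_density (0 + s * x) *\<^sub>R iexp (t * (0 + s * x)))
     = (\<lambda>x. (1 / sqrt (2*pi)) *\<^sub>R (complex_of_real (exp (- c * x\<^sup>2)) * cis (x * b)))"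
    using s unfolding std_normal_density_def cis_conv_exp t_def
    by (auto simp: power_mult_distrib scaleR_conv_of_real mult_ac)
  also have "s *\<^sub>R (LBINT x. (1 / sqrt (2*pi)) *\<^sub>R (complex_of_real (exp (- c * x\<^sup>2)) * cis (x * b)))
    = (s / sqrt (2 * pi)) *\<^sub>R (LBINT x. (complex_of_real (exp (- c * x\<^sup>2)) * cis (x * b)))"
    by simp
  finally have *: "complex_of_real (exp (- t\<^sup>2 / 2)) =
     (s / sqrt (2 * pi)) *\<^sub>R (LBINT x. (complex_of_real (exp (- c * x\<^sup>2)) * cis (x * b)))" .
  have "(LBINT x. (complex_of_real (exp (- c * x\<^sup>2)) * cis (x * b)))
     = (sqrt (2 * pi) / s) *\<^sub>R complex_of_real (exp (- t\<^sup>2 / 2))"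
    unfolding * using s by simp
  moreover have "sqrt (2 * pi) / s = sqrt (pi / c)" "t\<^sup>2 / 2 = b\<^sup>2 / (4 * c)"
    using s assms by (auto simp: s_def real_sqrt_divide[symmetric] t_def power_divide)
  ultimately show "(LBINT x. complex_of_real (exp (- c * x\<^sup>2)) * cis (x * b))
           = complex_of_real (sqrt (pi / c) * exp (- b\<^sup>2 / (4 * c)))"
    by (simp add: scaleR_conv_of_real)
qed

text \<open>\<open>lborel\<close> is the image of a product of one-dimensional copies under the
  coordinate expansion, so a product over coordinates integrates factor by factor.\<close>

lemma
  fixes f :: "'a::euclidean_space \<Rightarrow> real \<Rightarrow> 'b::{real_normed_field,banach,second_countable_topology}"
  assumes int: "\<And>b. b \<in> Basis \<Longrightarrow> integrable lborel (f b)"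
  shows integrable_lborel_prod_Basis: "integrable lborel (\<lambda>x. \<Prod>b\<in>Basis. f b (x \<bullet> b))"
    and integral_lborel_prod_Basis:
      "(LBINT x. (\<Prod>b\<in>Basis. f b (x \<bullet> b))) = (\<Prod>b\<in>Basis. LBINT x. f b x)"
proof -
  interpret product_sigma_finite "\<lambda>_::'a. lborel :: real measure" ..
  have [measurable]: "f b \<in> borel_measurable borel" if "b \<in> Basis" for b
    using int[OF that] by (simp add: borel_measurable_integrable)
  have *: "(\<Prod>b\<in>Basis. f b ((\<Sum>i\<in>Basis. y i *\<^sub>R i) \<bullet> b)) = (\<Prod>b\<in>Basis. f b (y b))" for y
    by (intro prod.cong) (simp_all add: inner_sum_left inner_Basis if_distrib cong: if_cong)
  show "integrable lborel (\<lambda>x. \<Prod>b\<in>Basis. f b (x \<bullet> b))"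
    by (subst lborel_eq, subst integrable_distr_eq) (auto simp: * intro!: product_integrable_prod int)
  show "(LBINT x. (\<Prod>b\<in>Basis. f b (x \<bullet> b))) = (\<Prod>b\<in>Basis. LBINT x. f b x)"
    by (subst lborel_eq, subst integral_distr) (auto simp: * intro!: product_integral_prod int)
qed

lemma cis_sum: "finite A \<Longrightarrow> cis (\<Sum>i\<in>A. f i) = (\<Prod>i\<in>A. cis (f i))"
  by (induction A rule: finite_induct) (auto simp: cis_mult[symmetric])

text \<open>Both |x|^2 and the inner product with \<open>b\<close> are sums over coordinates, so the
  integrand is a product of one-dimensional ones.\<close>

lemma
  fixes b :: "'a::euclidean_space"
  assumes "c > 0"
  shows integrable_gaussian: "integrable lborel (\<lambda>x::'a. exp (- c * (norm x)\<^sup>2))"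
    and integral_gaussian_cis: "(LBINT x. complex_of_real (exp (- c * (norm x)\<^sup>2)) * cis (x \<bullet> b))
           = complex_of_real ((pi / c) powr (DIM('a) / 2) * exp (- (norm b)\<^sup>2 / (4 * c)))"
proof -
  have nrm: "(norm y)\<^sup>2 = (\<Sum>i\<in>Basis. (y \<bullet> i)\<^sup>2)" for y :: 'a
    by (subst power2_norm_eq_inner, subst euclidean_inner) (simp add: power2_eq_square)
  have ex: "exp (- c * (norm x)\<^sup>2) = (\<Prod>i\<in>Basis. exp (- c * (x \<bullet> i)\<^sup>2))" for x :: 'a
    by (simp add: nrm exp_sum[symmetric] sum_distrib_left sum_negf)
  show "integrable lborel (\<lambda>x::'a. exp (- c * (norm x)\<^sup>2))"
    unfolding ex by (intro integrable_lborel_prod_Basis gaussian_1d assms)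
  have ci: "cis (x \<bullet> b) = (\<Prod>i\<in>Basis. cis ((x \<bullet> i) * (b \<bullet> i)))" for x
    by (subst euclidean_inner) (simp add: cis_sum)
  have "(LBINT x. complex_of_real (exp (- c * (norm x)\<^sup>2)) * cis (x \<bullet> b))
     = (LBINT x. (\<Prod>i\<in>Basis. complex_of_real (exp (- c * (x \<bullet> i)\<^sup>2)) * cis ((x \<bullet> i) * (b \<bullet> i))))"
    unfolding ex ci prod.distrib by simp
  also have "\<dots> = (\<Prod>i\<in>Basis. LBINT x. complex_of_real (exp (- c * x\<^sup>2)) * cis (x * (b \<bullet> i)))"
  proof (rule integral_lborel_prod_Basis)
    fix i :: 'a
    show "integrable lborel (\<lambda>x. complex_of_real (exp (- c * x\<^sup>2)) * cis (x * (b \<bullet> i)))"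
      by (rule Bochner_Integration.integrable_bound[OF gaussian_1d(1)[OF assms]])
         (auto simp: norm_mult cis_conv_exp)
  qed
  also have "\<dots> = (\<Prod>i\<in>Basis. complex_of_real (sqrt (pi / c) * exp (- (b \<bullet> i)\<^sup>2 / (4 * c))))"
    by (simp only: gaussian_1d(2)[OF assms])
  also have "\<dots> = complex_of_real (sqrt (pi / c) ^ DIM('a) * exp (- (norm b)\<^sup>2 / (4 * c)))"
    by (simp only: of_real_prod[symmetric] prod.distrib prod_constant exp_sum[symmetric] nrm
        sum_divide_distrib minus_divide_left[symmetric] sum_negf[symmetric] finite_Basis)
  also have "sqrt (pi / c) ^ DIM('a) = (pi / c) powr (DIM('a) / 2)"
  proof -
    have "sqrt (pi / c) ^ DIM('a) = sqrt (pi / c) powr real DIM('a)"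
      using assms by (subst powr_realpow) auto
    then show ?thesis using assms by (simp add: powr_half_sqrt[symmetric] powr_powr)
  qed
  finally show "(LBINT x. complex_of_real (exp (- c * (norm x)\<^sup>2)) * cis (x \<bullet> b))
           = complex_of_real ((pi / c) powr (DIM('a) / 2) * exp (- (norm b)\<^sup>2 / (4 * c)))" .
qed

lemma
  assumes "c > 0"
  shows integral_gaussian: "(LBINT (x::'a::euclidean_space). exp (- c * (norm x)\<^sup>2)) = (pi / c) powr (DIM('a) / 2)"
    and nn_integral_gaussian: "(\<integral>\<^sup>+(x::'a). ennreal (exp (- c * (norm x)\<^sup>2)) \<partial>lborel) = ennreal ((pi / c) powr (DIM('a) / 2))"
proof -
  have "complex_of_real (LBINT (x::'a). exp (- c * (norm x)\<^sup>2)) = complex_of_real ((pi / c) powr (DIM('a) / 2))"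
    using integral_gaussian_cis[OF assms, of "0::'a"]
    by (simp only: inner_zero_right cis_zero mult_1_right integral_complex_of_real norm_zero zero_power2 minus_zero div_0 exp_zero)
  then show *: "(LBINT (x::'a). exp (- c * (norm x)\<^sup>2)) = (pi / c) powr (DIM('a) / 2)"
    by (simp only: of_real_eq_iff)
  show "(\<integral>\<^sup>+(x::'a). ennreal (exp (- c * (norm x)\<^sup>2)) \<partial>lborel) = ennreal ((pi / c) powr (DIM('a) / 2))"
    unfolding *[symmetric] by (rule nn_integral_eq_integral[OF integrable_gaussian[OF assms]]) simp
qed

text \<open>The integral of \<open>f (R x) g (y + R x)\<close> over \<open>(x, y)\<close> with a Gaussian \<open>g\<close> is computed in
  both orders; this avoids determinants.\<close>

lemma distr_lborel_orthogonal:
  fixes R :: "'a::euclidean_space \<Rightarrow> 'a"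
  assumes R: "orthogonal_transformation R"
  shows "distr lborel borel R = lborel"
proof (rule measure_eqI)
  have lin: "linear R" and nR: "norm (R x) = norm x" for x
    using R by (auto simp: orthogonal_transformation)
  define S where "S = inv R"
  have S: "linear S" and RS: "R (S y) = y" for y
    using orthogonal_transformation_inv[OF R] orthogonal_transformation_surj[OF R]
    by (auto simp: S_def orthogonal_transformation surj_f_inv_f)
  have [measurable]: "R \<in> borel_measurable borel" "S \<in> borel_measurable borel"
    using lin S by (auto intro!: borel_measurable_continuous_onI linear_continuous_on linear_conv_bounded_linear[THEN iffD1])
  show "sets (distr lborel borel R) = sets lborel" by simp
  fix A assume "A \<in> sets (distr lborel borel R)"
  then have [measurable]: "A \<in> sets borel" by simp
  define g where "g x = ennreal (exp (- 1 * (norm x)\<^sup>2))" for x :: 'a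
  define f where "f x = (indicator A x :: ennreal)" for x
  have [measurable]: "f \<in> borel_measurable borel" "g \<in> borel_measurable borel" unfolding f_def g_def by measurable
  \<comment> \<open>The Gaussian mass is finite and nonzero, so it can be cancelled once the two
    orders of integration have been compared.\<close>
  define G where "G = (\<integral>\<^sup>+x. g x \<partial>lborel)"
  have G: "G \<noteq> 0" "G \<noteq> top"
    by (auto simp: G_def g_def nn_integral_gaussian[of 1, simplified])
  have "(\<integral>\<^sup>+x. f (R x) \<partial>lborel) * G = (\<integral>\<^sup>+x. f (R x) * G \<partial>lborel)"
    by (simp add: nn_integral_multc)
  also have "\<dots> = (\<integral>\<^sup>+x. (\<integral>\<^sup>+y. f (R x) * g (R x + y) \<partial>lborel) \<partial>lborel)"
    by (simp add: nn_integral_cmult nn_integral_translate G_def)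
  also have "\<dots> = (\<integral>\<^sup>+y. (\<integral>\<^sup>+x. f (R x) * g (R x + y) \<partial>lborel) \<partial>lborel)"
    by (rule lborel_pair.Fubini') measurable
  also have "\<dots> = (\<integral>\<^sup>+y. (\<integral>\<^sup>+x. f (R x - y) * g (R x) \<partial>lborel) \<partial>lborel)"
  proof (rule nn_integral_cong)
    fix y
    \<comment> \<open>Shifting \<open>x\<close> by \<open>- S y\<close> moves \<open>y\<close> from
      the argument of \<open>g\<close> to that of \<open>f\<close>, because
      \<open>R (S y) = y\<close>.\<close>
    have "(\<integral>\<^sup>+x. f (R x) * g (R x + y) \<partial>lborel) = (\<integral>\<^sup>+x. f (R (- S y + x)) * g (R (- S y + x) + y) \<partial>lborel)"
      by (rule nn_integral_translate[symmetric]) measurable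
    also have "\<dots> = (\<integral>\<^sup>+x. f (R x - y) * g (R x) \<partial>lborel)"
      using lin by (intro nn_integral_cong) (simp add: linear_diff RS)
    finally show "(\<integral>\<^sup>+x. f (R x) * g (R x + y) \<partial>lborel) = (\<integral>\<^sup>+x. f (R x - y) * g (R x) \<partial>lborel)" .
  qed
  also have "\<dots> = (\<integral>\<^sup>+x. (\<integral>\<^sup>+y. f (R x - y) * g (R x) \<partial>lborel) \<partial>lborel)"
    by (rule lborel_pair.Fubini') measurable
  \<comment> \<open>Norm preservation enters here: the Gaussian is radial, so
    \<open>g (R x) = g x\<close>.\<close>
  also have "\<dots> = (\<integral>\<^sup>+x. (\<integral>\<^sup>+y. f y \<partial>lborel) * g x \<partial>lborel)"
    using nn_integral_reflect[of f]
    by (simp add: nn_integral_multc) (simp add: g_def nR)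
  also have "\<dots> = (\<integral>\<^sup>+y. f y \<partial>lborel) * G"
    by (simp add: nn_integral_cmult G_def)
  finally have "(\<integral>\<^sup>+x. f (R x) \<partial>lborel) * G = (\<integral>\<^sup>+y. f y \<partial>lborel) * G" .
  then have "(\<integral>\<^sup>+x. f (R x) \<partial>lborel) = (\<integral>\<^sup>+y. f y \<partial>lborel)"
    using G by (metis ennreal_mult_cancel_left mult.commute)
  then have "(\<integral>\<^sup>+x. indicator (R -` A) x \<partial>lborel) = (\<integral>\<^sup>+y. indicator A y \<partial>lborel)"
    by (simp add: f_def indicator_def)
  then show "emeasure (distr lborel borel R) A = emeasure lborel A"
    by (subst emeasure_distr) (auto simp: measurable_sets_borel[of R borel])
qed

lemma orthogonal_transformation_measurable:
  fixes R :: "'a::euclidean_space \<Rightarrow> 'a"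
  assumes "orthogonal_transformation R"
  shows "R \<in> borel_measurable borel"
  using orthogonal_transformation_linear[OF assms]
  by (auto intro!: borel_measurable_continuous_onI linear_continuous_on linear_conv_bounded_linear[THEN iffD1])

lemma integral_orthogonal:
  fixes R :: "'a::euclidean_space \<Rightarrow> 'a" and f :: "'a \<Rightarrow> 'b::{banach, second_countable_topology}"
  assumes R: "orthogonal_transformation R" and [measurable]: "f \<in> borel_measurable borel"
  shows "(LBINT x. f (R x)) = (LBINT x. f x)"
proof -
  note [measurable] = orthogonal_transformation_measurable[OF R]
  have "(LBINT x. f (R x)) = (LINT x|distr lborel borel R. f x)" by (simp add: integral_distr)
  then show ?thesis by (simp add: distr_lborel_orthogonal[OF R])
qed

lemma integrable_orthogonal_iff:
  fixes R :: "'a::euclidean_space \<Rightarrow> 'a" and f :: "'a \<Rightarrow> 'b::{banach, second_countable_topology}"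
  assumes R: "orthogonal_transformation R" and [measurable]: "f \<in> borel_measurable borel"
  shows "integrable lborel (\<lambda>x. f (R x)) \<longleftrightarrow> integrable lborel f"
proof -
  note [measurable] = orthogonal_transformation_measurable[OF R]
  have "integrable lborel (\<lambda>x. f (R x)) \<longleftrightarrow> integrable (distr lborel borel R) f" by (simp add: integrable_distr_eq)
  then show ?thesis by (simp add: distr_lborel_orthogonal[OF R])
qed

section \<open>Riesz kernels\<close>

text \<open>Euler's integral after the substitution t = z y. Read from right to left it turns a
  negative power of \<open>z\<close> into a superposition of exponentials, hence of Gaussians when z
  is |x|^2; the estimates of this section rest on that.\<close>

lemma nn_integral_Gamma_scaled:
  fixes s z :: real
  assumes s: "s > 0" and z: "z > 0"
  shows "(\<integral>\<^sup>+y. ennreal (indicator {0<..} y * (y powr (s - 1) * exp (- z * y))) \<partial>lborel)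
       = ennreal (Gamma s * z powr (- s))"
proof -
  have "ennreal (Gamma s) = (\<integral>\<^sup>+t. ennreal (indicator {0..} t * t powr (s - 1) / exp t) \<partial>lborel)"
    by (rule Gamma_conv_nn_integral_real[OF s])
  also have "\<dots> = ennreal z * (\<integral>\<^sup>+t. ennreal (indicator {0..} (0 + z * t) * (0 + z * t) powr (s - 1) / exp (0 + z * t)) \<partial>lborel)"
    using z by (subst nn_integral_real_affine[of _ z 0]) auto
  also have "\<dots> = ennreal z * (\<integral>\<^sup>+t. ennreal (z powr (s - 1)) * ennreal (indicator {0<..} t * (t powr (s - 1) * exp (- z * t))) \<partial>lborel)"
    using z by (intro arg_cong2[of _ _ _ _ "(*)"] refl nn_integral_cong_AE eventually_mono[OF AE_lborel_singleton[of 0]])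
      (auto simp: indicator_def powr_mult exp_minus field_simps zero_le_mult_iff ennreal_mult'[symmetric])
  also have "\<dots> = ennreal (z powr s) * (\<integral>\<^sup>+t. ennreal (indicator {0<..} t * (t powr (s - 1) * exp (- z * t))) \<partial>lborel)"
    using z by (subst nn_integral_cmult) (auto simp: mult.assoc[symmetric] ennreal_mult'[symmetric] powr_mult_base)
  finally have "ennreal (z powr (- s)) * ennreal (Gamma s) = ennreal (z powr (- s) * z powr s) * (\<integral>\<^sup>+t. ennreal (indicator {0<..} t * (t powr (s - 1) * exp (- z * t))) \<partial>lborel)"
    by (simp add: ennreal_mult' mult.assoc)
  then show ?thesis
    using z s by (simp add: powr_minus ennreal_mult'[symmetric] mult.commute[of "Gamma s"] Gamma_real_pos less_imp_le)
qed

text \<open>The power of 1 + m is replaced by its Gamma integral; in the other order of integration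
  two Gamma integrals remain.\<close>

lemma nn_integral_Beta_prime:
  fixes p q :: real
  assumes p: "p > 0" and q: "q > 0"
  shows "(\<integral>\<^sup>+m. ennreal (indicator {0<..} m * (m powr (p - 1) * (1 + m) powr (- (p + q)))) \<partial>lborel)
       = ennreal (Gamma p * Gamma q / Gamma (p + q))"
proof -
  let ?I = "\<lambda>y::real. indicator {0<..} y :: real"
  have G: "Gamma p > 0" "Gamma q > 0" "Gamma (p + q) > 0" using p q by (auto intro: Gamma_real_pos)
  have "ennreal (Gamma (p+q)) * (\<integral>\<^sup>+m. ennreal (?I m * (m powr (p - 1) * (1 + m) powr (- (p + q)))) \<partial>lborel)
    = (\<integral>\<^sup>+m. ennreal (?I m * m powr (p - 1)) * ennreal (Gamma (p+q) * (1 + m) powr (- (p + q))) \<partial>lborel)"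
    using G by (subst nn_integral_cmult[symmetric]) (auto simp: ennreal_mult'[symmetric] mult_ac)
  also have "\<dots> = (\<integral>\<^sup>+m. ennreal (?I m * m powr (p - 1)) *
      (\<integral>\<^sup>+y. ennreal (?I y * (y powr (p + q - 1) * exp (- (1 + m) * y))) \<partial>lborel) \<partial>lborel)"
  proof (rule nn_integral_cong)
    fix m :: real
    show "ennreal (?I m * m powr (p - 1)) * ennreal (Gamma (p+q) * (1 + m) powr (- (p + q))) =
       ennreal (?I m * m powr (p - 1)) *
      (\<integral>\<^sup>+y. ennreal (?I y * (y powr (p + q - 1) * exp (- (1 + m) * y))) \<partial>lborel)"
    proof (cases "m > 0")
      case True then show ?thesis using p q by (subst nn_integral_Gamma_scaled) auto
    qed auto
  qed
  also have "\<dots> = (\<integral>\<^sup>+m. (\<integral>\<^sup>+y. ennreal (?I m * m powr (p - 1)) *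
       ennreal (?I y * (y powr (p + q - 1) * exp (- (1 + m) * y))) \<partial>lborel) \<partial>lborel)"
    by (subst nn_integral_cmult) auto
  also have "\<dots> = (\<integral>\<^sup>+y. (\<integral>\<^sup>+m. ennreal (?I m * m powr (p - 1)) *
       ennreal (?I y * (y powr (p + q - 1) * exp (- (1 + m) * y))) \<partial>lborel) \<partial>lborel)"
    by (rule lborel_pair.Fubini') measurable
  also have "\<dots> = (\<integral>\<^sup>+y. ennreal (?I y * (y powr (p + q - 1) * exp (- y))) *
     (\<integral>\<^sup>+m. ennreal (?I m * (m powr (p - 1) * exp (- y * m))) \<partial>lborel) \<partial>lborel)"
    by (subst nn_integral_cmult[symmetric])
       (auto intro!: nn_integral_cong simp: ennreal_mult'[symmetric] algebra_simps exp_add[symmetric] exp_diff[symmetric])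
  also have "\<dots> = (\<integral>\<^sup>+y. ennreal (Gamma p) * ennreal (?I y * (y powr (q - 1) * exp (- 1 * y))) \<partial>lborel)"
  proof (rule nn_integral_cong)
    fix y :: real
    show "ennreal (?I y * (y powr (p + q - 1) * exp (- y))) *
     (\<integral>\<^sup>+m. ennreal (?I m * (m powr (p - 1) * exp (- y * m))) \<partial>lborel)
     = ennreal (Gamma p) * ennreal (?I y * (y powr (q - 1) * exp (- 1 * y)))"
    proof (cases "y > 0")
      case True
      have "y powr (p + q - 1) * y powr (- p) = y powr (q - 1)" by (simp add: powr_add[symmetric])
      then show ?thesis using True p q G
        by (subst nn_integral_Gamma_scaled) (auto simp: ennreal_mult'[symmetric] mult_ac)
    qed auto
  qed
  also have "\<dots> = ennreal (Gamma p) * ennreal (Gamma q)"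
    using nn_integral_Gamma_scaled[OF q, of 1] by (subst nn_integral_cmult) auto
  finally have "ennreal (1 / Gamma (p+q)) * (ennreal (Gamma (p+q)) * (\<integral>\<^sup>+m. ennreal (?I m * (m powr (p - 1) * (1 + m) powr (- (p + q)))) \<partial>lborel))
    = ennreal (1 / Gamma (p+q)) * (ennreal (Gamma p) * ennreal (Gamma q))" by simp
  then show ?thesis using G by (simp add: mult.assoc[symmetric] ennreal_mult'[symmetric])
qed

lemma powr_norm_eq_nn_integral:
  fixes x :: "'a::real_normed_vector"
  assumes "a > 0" "x \<noteq> 0"
  shows "ennreal (Gamma (a / 2)) * ennreal (norm x powr (- a))
    = (\<integral>\<^sup>+s. ennreal (indicator {0<..} s * (s powr (a / 2 - 1) * exp (- s * (norm x)\<^sup>2))) \<partial>lborel)"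
proof -
  have "(norm x)\<^sup>2 powr (- (a / 2)) = norm x powr (- a)"
    using assms by (simp add: powr_powr powr_realpow[symmetric] del: powr_numeral)
  then show ?thesis
    using nn_integral_Gamma_scaled[of "a / 2" "(norm x)\<^sup>2"] assms
    by (simp add: mult.commute[of "(norm x)\<^sup>2"] ennreal_mult'[symmetric] Gamma_real_pos less_imp_le)
qed

text \<open>Completing the square: s |x - y|^2 + r |y|^2 is minimal at y = s x / (s + r), with
  minimum s r |x|^2 / (s + r), and a centred Gaussian in \<open>y\<close> is left to
  integrate.\<close>

lemma nn_integral_gaussian_mult:
  fixes x :: "'a::euclidean_space"
  assumes "s > 0" "r > 0"
  shows "(\<integral>\<^sup>+y. ennreal (exp (- s * (norm (x - y))\<^sup>2) * exp (- r * (norm y)\<^sup>2)) \<partial>lborel)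
    = ennreal ((pi / (s + r)) powr (DIM('a) / 2) * exp (- (s * r / (s + r)) * (norm x)\<^sup>2))"
proof -
  define t where "t = (s / (s + r)) *\<^sub>R x"
  have eq: "s * (norm (x - y))\<^sup>2 + r * (norm y)\<^sup>2 = (s + r) * (norm (- t + y))\<^sup>2 + (s * r / (s + r)) * (norm x)\<^sup>2" for y
  proof -
    define w where "w = s / (s + r)"
    have w: "(s + r) * w = s" "s * r / (s + r) = r * w" using assms by (auto simp: w_def field_simps)
    have *: "s * (A - 2 * B + D) + r * D
       = (s + r) * (D - 2 * (w * B) + w\<^sup>2 * A) + r * w * A" for A B D :: real
    proof -
      have "(s + r) * (D - 2 * (w * B) + w\<^sup>2 * A) + r * w * A
        = (s + r) * D - 2 * ((s + r) * w) * B + ((s + r) * w) * w * A + r * w * A"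
        by (simp add: algebra_simps power2_eq_square)
      also have "\<dots> = (s + r) * D - 2 * s * B + (s * w + r * w) * A"
        unfolding w(1) by (simp add: algebra_simps)
      also have "\<dots> = s * (A - 2 * B + D) + r * D"
      proof -
        have e: "s * w + r * w = s" using w(1) by (simp add: algebra_simps)
        show ?thesis unfolding e by (simp add: algebra_simps)
      qed
      finally show ?thesis by simp
    qed
    from *[of "x \<bullet> x" "x \<bullet> y" "y \<bullet> y"] show ?thesis
      unfolding power2_norm_eq_inner t_def w(2) w_def[symmetric]
      by (simp add: inner_diff_left inner_diff_right inner_add_left inner_add_right power2_eq_square inner_commute algebra_simps)
  qed
  have "(\<integral>\<^sup>+y. ennreal (exp (- s * (norm (x - y))\<^sup>2) * exp (- r * (norm y)\<^sup>2)) \<partial>lborel)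
    = (\<integral>\<^sup>+y. ennreal (exp (- (s * r / (s + r)) * (norm x)\<^sup>2)) * ennreal (exp (- (s + r) * (norm (- t + y))\<^sup>2)) \<partial>lborel)"
    using eq by (intro nn_integral_cong) (simp add: ennreal_mult'[symmetric] exp_add[symmetric] algebra_simps)
  also have "\<dots> = ennreal (exp (- (s * r / (s + r)) * (norm x)\<^sup>2)) * (\<integral>\<^sup>+(y::'a). ennreal (exp (- (s + r) * (norm y)\<^sup>2)) \<partial>lborel)"
    by (subst nn_integral_cmult, simp, subst nn_integral_translate[of "\<lambda>y. ennreal (exp (- (s + r) * (norm y)\<^sup>2))"]) auto
  finally show ?thesis using assms
    by (subst (asm) nn_integral_gaussian) (auto simp: ennreal_mult'[symmetric] mult_ac)
qed

text \<open>With both kernels written as superpositions of Gaussians with parameters s and r, the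
  integral over \<open>y\<close> is explicit. In terms of s and the ratio m = r / s the remaining
  double integral separates: s contributes a Gamma integral of order \<open>c\<close>, positive
  because \<open>a + b > n\<close>, and m contributes the beta integral with parameters
  \<open>p\<close> and \<open>q\<close>, positive because \<open>a\<close> and \<open>b\<close> are
  below \<open>n\<close>.\<close>

theorem nn_integral_Riesz_composition:
  fixes x :: "'a::euclidean_space" and a b :: real
  defines "n \<equiv> real DIM('a)"
  assumes a: "0 < a" "a < n" and b: "0 < b" "b < n" and ab: "a + b > n" and x: "x \<noteq> 0"
  shows "(\<integral>\<^sup>+y. ennreal (norm (x - y) powr (- a) * norm y powr (- b)) \<partial>lborel)
       = ennreal (K_const (n - a) (n - b) n * norm x powr (n - a - b))"
proof -
  let ?I = "\<lambda>y::real. indicator {0<..} y :: real"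
  define c where "c = (a + b - n) / 2"
  define p where "p = (n - a) / 2"
  define q where "q = (n - b) / 2"
  have cpq: "c > 0" "p > 0" "q > 0" using a b ab by (auto simp: c_def p_def q_def)
  define Ga where "Ga = Gamma (a / 2)"
  define Gb where "Gb = Gamma (b / 2)"
  have G: "Ga > 0" "Gb > 0" "Gamma c > 0" "Gamma p > 0" "Gamma q > 0" "Gamma (p + q) > 0"
    using a b cpq by (auto simp: Ga_def Gb_def intro!: Gamma_real_pos)
  define X where "X = (norm x)\<^sup>2"
  have X: "X > 0" using x by (simp add: X_def)
  define E where "E s r = (pi / (s + r)) powr (n / 2) * exp (- (s * r / (s + r)) * X)" for s r :: real
  have [measurable]: "(\<lambda>(s, r). E s r) \<in> borel_measurable borel" "\<And>s. E s \<in> borel_measurable borel"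
    unfolding E_def by (simp_all add: borel_prod[symmetric])
  have ne: "AE y in lborel. y \<noteq> 0 \<and> x - y \<noteq> 0"
    using AE_lborel_singleton[of 0] AE_lborel_singleton[of x] by eventually_elim auto
  have "ennreal (Ga * Gb) * (\<integral>\<^sup>+y. ennreal (norm (x - y) powr (- a) * norm y powr (- b)) \<partial>lborel)
     = (\<integral>\<^sup>+y. (ennreal Ga * ennreal (norm (x - y) powr (- a))) * (ennreal Gb * ennreal (norm y powr (- b))) \<partial>lborel)"
    using G by (subst nn_integral_cmult[symmetric]) (auto simp: ennreal_mult'[symmetric] mult_ac)
  also have "\<dots> = (\<integral>\<^sup>+y. (\<integral>\<^sup>+s. ennreal (?I s * (s powr (a / 2 - 1) * exp (- s * (norm (x - y))\<^sup>2))) \<partial>lborel) *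
       (\<integral>\<^sup>+r. ennreal (?I r * (r powr (b / 2 - 1) * exp (- r * (norm y)\<^sup>2))) \<partial>lborel) \<partial>lborel)"
    unfolding Ga_def Gb_def using ne
    by (intro nn_integral_cong_AE eventually_mono[OF ne], elim conjE)
       (intro arg_cong2[where f = "(*)"] powr_norm_eq_nn_integral a b)
  also have "\<dots> = (\<integral>\<^sup>+y. (\<integral>\<^sup>+s. (\<integral>\<^sup>+r. ennreal (?I s * (s powr (a / 2 - 1) * exp (- s * (norm (x - y))\<^sup>2))) *
        ennreal (?I r * (r powr (b / 2 - 1) * exp (- r * (norm y)\<^sup>2))) \<partial>lborel) \<partial>lborel) \<partial>lborel)"
    by (simp add: nn_integral_cmult nn_integral_multc)
  also have "\<dots> = (\<integral>\<^sup>+s. (\<integral>\<^sup>+y. (\<integral>\<^sup>+r. ennreal (?I s * (s powr (a / 2 - 1) * exp (- s * (norm (x - y))\<^sup>2))) *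
        ennreal (?I r * (r powr (b / 2 - 1) * exp (- r * (norm y)\<^sup>2))) \<partial>lborel) \<partial>lborel) \<partial>lborel)"
    by (rule lborel_pair.Fubini') measurable
  also have "\<dots> = (\<integral>\<^sup>+s. (\<integral>\<^sup>+r. (\<integral>\<^sup>+y. ennreal (?I s * (s powr (a / 2 - 1) * exp (- s * (norm (x - y))\<^sup>2))) *
        ennreal (?I r * (r powr (b / 2 - 1) * exp (- r * (norm y)\<^sup>2))) \<partial>lborel) \<partial>lborel) \<partial>lborel)"
    by (intro nn_integral_cong lborel_pair.Fubini') measurable
  also have "\<dots> = (\<integral>\<^sup>+s. (\<integral>\<^sup>+r. ennreal (?I s * s powr (a / 2 - 1) * (?I r * r powr (b / 2 - 1)) * E s r) \<partial>lborel) \<partial>lborel)"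
  proof (intro nn_integral_cong)
    fix s r :: real
    show "(\<integral>\<^sup>+y. ennreal (?I s * (s powr (a / 2 - 1) * exp (- s * (norm (x - y))\<^sup>2))) *
        ennreal (?I r * (r powr (b / 2 - 1) * exp (- r * (norm y)\<^sup>2))) \<partial>lborel)
       = ennreal (?I s * s powr (a / 2 - 1) * (?I r * r powr (b / 2 - 1)) * E s r)"
    proof (cases "s > 0 \<and> r > 0")
      case True
      then have "(\<integral>\<^sup>+y. ennreal (?I s * (s powr (a / 2 - 1) * exp (- s * (norm (x - y))\<^sup>2))) *
        ennreal (?I r * (r powr (b / 2 - 1) * exp (- r * (norm y)\<^sup>2))) \<partial>lborel)
        = (\<integral>\<^sup>+y. ennreal (s powr (a / 2 - 1) * r powr (b / 2 - 1)) *
           ennreal (exp (- s * (norm (x - y))\<^sup>2) * exp (- r * (norm y)\<^sup>2)) \<partial>lborel)"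
        by (intro nn_integral_cong) (auto simp: ennreal_mult'[symmetric] mult_ac)
      also have "\<dots> = ennreal (s powr (a / 2 - 1) * r powr (b / 2 - 1)) * ennreal (E s r)"
        using True by (subst nn_integral_cmult, simp, subst nn_integral_gaussian_mult) (auto simp: E_def X_def n_def)
      finally show ?thesis using True by (simp add: ennreal_mult'[symmetric])
    qed auto
  qed
  \<comment> \<open>Substitution r = s m for fixed s; the extra factor s is the Jacobian.\<close>
  also have "\<dots> = (\<integral>\<^sup>+s. (\<integral>\<^sup>+m. ennreal (?I s * s powr (a / 2 - 1) * (?I m * (s * m) powr (b / 2 - 1)) * (s * E s (s * m))) \<partial>lborel) \<partial>lborel)"
  proof (rule nn_integral_cong)
    fix s :: real
    show "(\<integral>\<^sup>+r. ennreal (?I s * s powr (a / 2 - 1) * (?I r * r powr (b / 2 - 1)) * E s r) \<partial>lborel)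
      = (\<integral>\<^sup>+m. ennreal (?I s * s powr (a / 2 - 1) * (?I m * (s * m) powr (b / 2 - 1)) * (s * E s (s * m))) \<partial>lborel)"
    proof (cases "s > 0")
      case True
      have "(\<integral>\<^sup>+r. ennreal (?I s * s powr (a / 2 - 1) * (?I r * r powr (b / 2 - 1)) * E s r) \<partial>lborel)
        = ennreal \<bar>s\<bar> * (\<integral>\<^sup>+m. ennreal (?I s * s powr (a / 2 - 1) * (?I (0 + s * m) * (0 + s * m) powr (b / 2 - 1)) * E s (0 + s * m)) \<partial>lborel)"
        using True by (intro nn_integral_real_affine) auto
      also have "\<dots> = (\<integral>\<^sup>+m. ennreal s * ennreal (?I s * s powr (a / 2 - 1) * (?I (0 + s * m) * (0 + s * m) powr (b / 2 - 1)) * E s (0 + s * m)) \<partial>lborel)"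
        using True by (subst nn_integral_cmult) auto
      also have "\<dots> = (\<integral>\<^sup>+m. ennreal (?I s * s powr (a / 2 - 1) * (?I m * (s * m) powr (b / 2 - 1)) * (s * E s (s * m))) \<partial>lborel)"
        using True by (intro nn_integral_cong) (auto simp: indicator_def ennreal_mult'[symmetric] zero_less_mult_iff mult_ac)
      finally show ?thesis .
    qed auto
  qed
  also have "\<dots> = (\<integral>\<^sup>+m. (\<integral>\<^sup>+s. ennreal (?I s * s powr (a / 2 - 1) * (?I m * (s * m) powr (b / 2 - 1)) * (s * E s (s * m))) \<partial>lborel) \<partial>lborel)"
    unfolding E_def by (rule lborel_pair.Fubini') measurable
  also have "\<dots> = (\<integral>\<^sup>+m. ennreal (pi powr (n / 2) * Gamma c * X powr (- c)) *
      ennreal (?I m * (m powr (p - 1) * (1 + m) powr (- (p + q)))) \<partial>lborel)"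
  proof (rule nn_integral_cong)
    fix m :: real
    show "(\<integral>\<^sup>+s. ennreal (?I s * s powr (a / 2 - 1) * (?I m * (s * m) powr (b / 2 - 1)) * (s * E s (s * m))) \<partial>lborel)
      = ennreal (pi powr (n / 2) * Gamma c * X powr (- c)) *
      ennreal (?I m * (m powr (p - 1) * (1 + m) powr (- (p + q))))"
    proof (cases "m > 0")
      case True
      \<comment> \<open>For r = s m the exponent s r / (s + r) becomes s m / (1 + m), linear in s;
        \<open>z\<close> is the resulting rate of the Gamma integral.\<close>
      define z where "z = m / (1 + m) * X"
      have z: "z > 0" using True X by (simp add: z_def)
      have *: "s powr (a / 2 - 1) * (s * m) powr (b / 2 - 1) * (s * E s (s * m)) =
        pi powr (n / 2) * m powr (b / 2 - 1) * (1 + m) powr (- (n / 2)) * (s powr (c - 1) * exp (- z * s))"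
        if s: "s > 0" for s
      proof -
        have "s * (s * m) / (s + s * m) * X = z * s"
        proof -
          have "s + s * m = s * (1 + m)" by (simp add: algebra_simps)
          then show ?thesis using s True by (simp add: z_def)
        qed
        moreover have "(pi / (s + s * m)) powr (n / 2) = pi powr (n / 2) * s powr (- (n / 2)) * (1 + m) powr (- (n / 2))"
        proof -
          have "pi / (s + s * m) = pi * (s * (1 + m)) powr (- 1)" using s True by (simp add: field_simps powr_minus)
          then show ?thesis using s True by (simp only: powr_mult powr_powr) simp
        qed
        moreover have "s powr (a / 2 - 1) * s powr (b / 2 - 1) * s * s powr (- (n / 2)) = s powr (c - 1)"
        proof -
          have "s powr (a / 2 - 1) * s powr (b / 2 - 1) * s powr 1 * s powr (- (n / 2)) = s powr (c - 1)"
            unfolding powr_add[symmetric]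
            by (rule arg_cong[where f = "\<lambda>e. s powr e"]) (simp add: c_def field_simps)
          then show ?thesis using s by simp
        qed
        ultimately show ?thesis using s True unfolding E_def powr_mult
          by (simp add: powr_mult mult_ac)
      qed
      have "(\<integral>\<^sup>+s. ennreal (?I s * s powr (a / 2 - 1) * (?I m * (s * m) powr (b / 2 - 1)) * (s * E s (s * m))) \<partial>lborel)
       = (\<integral>\<^sup>+s. ennreal (pi powr (n / 2) * m powr (b / 2 - 1) * (1 + m) powr (- (n / 2))) *
           ennreal (?I s * (s powr (c - 1) * exp (- z * s))) \<partial>lborel)"
      proof (rule nn_integral_cong)
        fix s :: real
        show "ennreal (?I s * s powr (a / 2 - 1) * (?I m * (s * m) powr (b / 2 - 1)) * (s * E s (s * m)))
          = ennreal (pi powr (n / 2) * m powr (b / 2 - 1) * (1 + m) powr (- (n / 2))) *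
           ennreal (?I s * (s powr (c - 1) * exp (- z * s)))"
        proof (cases "s > 0")
          case s: True
          have "?I s * s powr (a / 2 - 1) * (?I m * (s * m) powr (b / 2 - 1)) * (s * E s (s * m))
            = s powr (a / 2 - 1) * (s * m) powr (b / 2 - 1) * (s * E s (s * m))"
            using s True by simp
          then show ?thesis unfolding *[OF s] using s by (simp add: ennreal_mult'[symmetric])
        qed auto
      qed
      also have "\<dots> = ennreal (pi powr (n / 2) * m powr (b / 2 - 1) * (1 + m) powr (- (n / 2))) * ennreal (Gamma c * z powr (- c))"
        using z cpq by (subst nn_integral_cmult, simp, subst nn_integral_Gamma_scaled) auto
      also have "\<dots> = ennreal (pi powr (n / 2) * Gamma c * X powr (- c) * ((m powr (b / 2 - 1) * m powr (- c)) * ((1 + m) powr (- (n / 2)) * (1 + m) powr c)))"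
      proof -
        have "z powr (- c) = m powr (- c) * (1 + m) powr c * X powr (- c)"
          using True X unfolding z_def by (simp add: powr_mult powr_divide powr_minus field_simps)
        then show ?thesis using G by (simp add: ennreal_mult'[symmetric] mult_ac)
      qed
      also have "m powr (b / 2 - 1) * m powr (- c) = m powr (p - 1)"
        unfolding powr_add[symmetric] by (rule arg_cong[where f = "\<lambda>e. m powr e"]) (simp add: p_def c_def field_simps)
      also have "(1 + m) powr (- (n / 2)) * (1 + m) powr c = (1 + m) powr (- (p + q))"
        unfolding powr_add[symmetric] by (rule arg_cong[where f = "\<lambda>e. (1 + m) powr e"]) (simp add: p_def q_def c_def field_simps)
      finally show ?thesis using True G by (simp add: ennreal_mult'[symmetric] mult_ac)
    qed auto
  qed
  also have "\<dots> = ennreal (pi powr (n / 2) * Gamma c * X powr (- c)) * ennreal (Gamma p * Gamma q / Gamma (p + q))"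
    using cpq by (subst nn_integral_cmult, simp, subst nn_integral_Beta_prime) auto
  finally have *: "ennreal (Ga * Gb) * (\<integral>\<^sup>+y. ennreal (norm (x - y) powr (- a) * norm y powr (- b)) \<partial>lborel)
     = ennreal (pi powr (n / 2) * Gamma c * X powr (- c) * (Gamma p * Gamma q / Gamma (p + q)))"
    using G by (simp add: ennreal_mult'[symmetric])
  have "(\<integral>\<^sup>+y. ennreal (norm (x - y) powr (- a) * norm y powr (- b)) \<partial>lborel)
     = ennreal (1 / (Ga * Gb)) * (ennreal (Ga * Gb) * (\<integral>\<^sup>+y. ennreal (norm (x - y) powr (- a) * norm y powr (- b)) \<partial>lborel))"
    using G by (simp add: mult.assoc[symmetric] ennreal_mult'[symmetric])
  also have "\<dots> = ennreal (1 / (Ga * Gb) * (pi powr (n / 2) * Gamma c * X powr (- c) * (Gamma p * Gamma q / Gamma (p + q))))"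
    unfolding * using G by (subst ennreal_mult') auto
  also have "1 / (Ga * Gb) * (pi powr (n / 2) * Gamma c * X powr (- c) * (Gamma p * Gamma q / Gamma (p + q)))
     = K_const (n - a) (n - b) n * norm x powr (n - a - b)"
  proof -
    have k1: "X powr (- c) = norm x powr (n - a - b)"
    proof -
      have "X powr (- c) = norm x powr (2 * - c)"
        unfolding X_def using x by (simp add: powr_powr powr_realpow[symmetric] del: powr_numeral)
      also have "2 * - c = n - a - b" by (simp add: c_def field_simps)
      finally show ?thesis .
    qed
    have k2: "K_const (n - a) (n - b) n = (Gamma p * Gamma q * Gamma c) / (Gamma (p + q) * Ga * Gb) *
       ((pi powr (- p) * pi powr (- q) * pi powr (- c)) / (pi powr (- (p + q)) * pi powr (- (a / 2)) * pi powr (- (b / 2))))"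
    proof -
      have e: "(n - (n - a) - (n - b)) / 2 = c" "(n - a + (n - b)) / 2 = p + q" "(n - a) / 2 = p" "(n - b) / 2 = q"
        "- (n - (n - a) - (n - b)) / 2 = - c" "- (n - a + (n - b)) / 2 = - (p + q)" "- (n - a) / 2 = - p" "- (n - b) / 2 = - q"
        "(n - (n - a)) / 2 = a / 2"  "(n - (n - b)) / 2 = b / 2" "- (n - (n - a)) / 2 = - (a / 2)"  "- (n - (n - b)) / 2 = - (b / 2)"
        by (auto simp: p_def q_def c_def field_simps)
      show ?thesis unfolding K_const_def nu_def e Ga_def Gb_def by (simp add: mult_ac)
    qed
    \<comment> \<open>The powers of \<pi> hidden in the six factors \<open>nu\<close> combine to the
      \<pi>^(n/2) contributed by the Gaussian integral.\<close>
    have k3: "(pi powr (- p) * pi powr (- q) * pi powr (- c)) / (pi powr (- (p + q)) * pi powr (- (a / 2)) * pi powr (- (b / 2))) = pi powr (n / 2)"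
      unfolding powr_add[symmetric] powr_diff[symmetric]
      by (rule arg_cong[where f = "\<lambda>e. pi powr e"]) (simp add: p_def q_def c_def field_simps)
    show ?thesis unfolding k1 k2 k3 by (simp add: mult_ac)
  qed
  finally show ?thesis .
qed

text \<open>Again the power becomes a superposition of Gaussians. Integrating out x first leaves,
  after scaling by \<open>c\<close>, the beta integral with parameters a/2 and (n - a)/2, which is
  where the bounds on \<open>a\<close> enter.\<close>

lemma integrable_powr_norm_gaussian:
  assumes "0 \<le> a" "a < real DIM('a)" "c > 0"
  shows "integrable lborel (\<lambda>x::'a::euclidean_space. norm x powr (- a) * exp (- c * (norm x)\<^sup>2))"
proof (cases "a = 0")
  \<comment> \<open>The Gamma integral requires a positive exponent. For \<open>a = 0\<close> the
    weight is at most 1; at the origin it is 0, since \<open>0 powr 0 = 0\<close>.\<close>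
  case True
  have "integrable lborel (\<lambda>x::'a. exp (- c * (norm x)\<^sup>2))" by (rule integrable_gaussian) fact
  then show ?thesis
    by (rule Bochner_Integration.integrable_bound) (auto simp: True)
next
  case False
  let ?I = "\<lambda>y::real. indicator {0<..} y :: real"
  define n where "n = real DIM('a)"
  have a: "a > 0" "a < n" using False assms by (auto simp: n_def)
  have G: "Gamma (a / 2) > 0" using a by (auto intro: Gamma_real_pos)
  have "ennreal (Gamma (a / 2)) * (\<integral>\<^sup>+x. ennreal (norm (x::'a) powr (- a) * exp (- c * (norm x)\<^sup>2)) \<partial>lborel)
    = (\<integral>\<^sup>+x. ennreal (Gamma (a / 2)) * ennreal (norm (x::'a) powr (- a)) * ennreal (exp (- c * (norm x)\<^sup>2)) \<partial>lborel)"
    using G by (subst nn_integral_cmult[symmetric]) (auto simp: ennreal_mult'[symmetric] mult_ac)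
  also have "\<dots> = (\<integral>\<^sup>+x. (\<integral>\<^sup>+s. ennreal (?I s * (s powr (a / 2 - 1) * exp (- s * (norm (x::'a))\<^sup>2))) \<partial>lborel) * ennreal (exp (- c * (norm x)\<^sup>2)) \<partial>lborel)"
    by (intro nn_integral_cong_AE eventually_mono[OF AE_lborel_singleton[of 0]])
       (auto simp: powr_norm_eq_nn_integral[OF a(1)])
  also have "\<dots> = (\<integral>\<^sup>+x. (\<integral>\<^sup>+s. ennreal (?I s * (s powr (a / 2 - 1) * exp (- s * (norm (x::'a))\<^sup>2))) * ennreal (exp (- c * (norm x)\<^sup>2)) \<partial>lborel) \<partial>lborel)"
    by (subst nn_integral_multc) auto
  also have "\<dots> = (\<integral>\<^sup>+s. (\<integral>\<^sup>+x. ennreal (?I s * (s powr (a / 2 - 1) * exp (- s * (norm (x::'a))\<^sup>2))) * ennreal (exp (- c * (norm x)\<^sup>2)) \<partial>lborel) \<partial>lborel)"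
    by (rule lborel_pair.Fubini') measurable
  also have "\<dots> = (\<integral>\<^sup>+s. (\<integral>\<^sup>+x. ennreal (?I s * s powr (a / 2 - 1)) * ennreal (exp (- (s + c) * (norm (x::'a))\<^sup>2)) \<partial>lborel) \<partial>lborel)"
    by (intro nn_integral_cong) (auto simp: ennreal_mult'[symmetric] exp_add[symmetric] algebra_simps)
  also have "\<dots> = (\<integral>\<^sup>+s. ennreal (?I s * s powr (a / 2 - 1)) * (\<integral>\<^sup>+(x::'a). ennreal (exp (- (s + c) * (norm x)\<^sup>2)) \<partial>lborel) \<partial>lborel)"
    by (subst nn_integral_cmult) auto
  also have "\<dots> = (\<integral>\<^sup>+s. ennreal (?I s * (s powr (a / 2 - 1) * (pi / (s + c)) powr (n / 2))) \<partial>lborel)"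
  proof (rule nn_integral_cong)
    fix s :: real
    show "ennreal (?I s * s powr (a / 2 - 1)) * (\<integral>\<^sup>+(x::'a). ennreal (exp (- (s + c) * (norm x)\<^sup>2)) \<partial>lborel)
       = ennreal (?I s * (s powr (a / 2 - 1) * (pi / (s + c)) powr (n / 2)))"
    proof (cases "s > 0")
      case True
      then show ?thesis
        using assms(3) by (subst nn_integral_gaussian) (auto simp: n_def ennreal_mult'[symmetric])
    qed auto
  qed
  also have "\<dots> = ennreal c * (\<integral>\<^sup>+m. ennreal (?I (0 + c * m) * ((0 + c * m) powr (a / 2 - 1) * (pi / ((0 + c * m) + c)) powr (n / 2))) \<partial>lborel)"
    using assms(3) by (subst nn_integral_real_affine[of _ c 0]) auto
  also have "\<dots> = ennreal c * (\<integral>\<^sup>+m. ennreal (c powr (a / 2 - 1) * (pi / c) powr (n / 2)) *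
       ennreal (?I m * (m powr (a / 2 - 1) * (1 + m) powr (- (a / 2 + (n - a) / 2)))) \<partial>lborel)"
  proof (intro arg_cong2[where f = "(*)"] refl nn_integral_cong)
    fix m :: real
    show "ennreal (?I (0 + c * m) * ((0 + c * m) powr (a / 2 - 1) * (pi / ((0 + c * m) + c)) powr (n / 2)))
      = ennreal (c powr (a / 2 - 1) * (pi / c) powr (n / 2)) *
       ennreal (?I m * (m powr (a / 2 - 1) * (1 + m) powr (- (a / 2 + (n - a) / 2))))"
    proof (cases "m > 0")
      case True
      have "pi / ((0 + c * m) + c) = pi / c * (1 + m) powr (- 1)"
        using True assms(3) by (simp add: powr_minus field_simps)
      then have *: "(pi / ((0 + c * m) + c)) powr (n / 2) = (pi / c) powr (n / 2) * (1 + m) powr (- (n / 2))"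
        using True assms(3) by (simp only: powr_mult powr_powr) simp
      have e: "a / 2 + (n - a) / 2 = n / 2" by (simp add: field_simps)
      show ?thesis unfolding * e
        using True assms(3) by (simp add: powr_mult ennreal_mult'[symmetric] mult_ac)
    next
      case False then show ?thesis using assms(3) by (simp add: indicator_def zero_less_mult_iff)
    qed
  qed
  also have "\<dots> < \<infinity>"
    using a nn_integral_Beta_prime[of "a / 2" "(n - a) / 2"]
    by (subst nn_integral_cmult) (auto simp: ennreal_mult_less_top)
  finally have "(\<integral>\<^sup>+x. ennreal (norm (x::'a) powr (- a) * exp (- c * (norm x)\<^sup>2)) \<partial>lborel) < \<infinity>"
    using G by (auto simp: ennreal_mult_less_top)
  then show ?thesis by (intro integrableI_nonneg) auto
qed

text \<open>The power n of 1 + |x|^2 is a Gamma integral of Gaussians; integrating these gives a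
  factor s^(-n/2), and the order n - n/2 that remains is still positive.\<close>

lemma integrable_inverse_power:
  "integrable lborel (\<lambda>x::'a::euclidean_space. 1 / (1 + (norm x)\<^sup>2) ^ DIM('a))"
proof -
  let ?I = "\<lambda>y::real. indicator {0<..} y :: real"
  define n where "n = real DIM('a)"
  have n: "n > 0" by (simp add: n_def)
  have G: "Gamma n > 0" using n by (auto intro: Gamma_real_pos)
  have "ennreal (Gamma n) * (\<integral>\<^sup>+x. ennreal (1 / (1 + (norm (x::'a))\<^sup>2) ^ DIM('a)) \<partial>lborel)
    = (\<integral>\<^sup>+x. ennreal (Gamma n * (1 + (norm (x::'a))\<^sup>2) powr (- n)) \<partial>lborel)"
    using G by (subst nn_integral_cmult[symmetric])
      (auto intro!: nn_integral_cong simp: ennreal_mult'[symmetric] n_def powr_minus powr_realpow add_pos_nonneg field_simps)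
  also have "\<dots> = (\<integral>\<^sup>+x. (\<integral>\<^sup>+s. ennreal (?I s * (s powr (n - 1) * exp (- (1 + (norm (x::'a))\<^sup>2) * s))) \<partial>lborel) \<partial>lborel)"
    using n by (subst nn_integral_Gamma_scaled) (auto simp: add_pos_nonneg)
  also have "\<dots> = (\<integral>\<^sup>+s. (\<integral>\<^sup>+x. ennreal (?I s * (s powr (n - 1) * exp (- (1 + (norm (x::'a))\<^sup>2) * s))) \<partial>lborel) \<partial>lborel)"
    by (rule lborel_pair.Fubini') measurable
  also have "\<dots> = (\<integral>\<^sup>+s. (\<integral>\<^sup>+x. ennreal (?I s * (s powr (n - 1) * exp (- s))) * ennreal (exp (- s * (norm (x::'a))\<^sup>2)) \<partial>lborel) \<partial>lborel)"
    by (intro nn_integral_cong) (auto simp: ennreal_mult'[symmetric] exp_add[symmetric] exp_diff[symmetric] algebra_simps)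
  also have "\<dots> = (\<integral>\<^sup>+s. ennreal (?I s * (s powr (n - 1) * exp (- s))) * (\<integral>\<^sup>+(x::'a). ennreal (exp (- s * (norm x)\<^sup>2)) \<partial>lborel) \<partial>lborel)"
    by (subst nn_integral_cmult) auto
  also have "\<dots> = (\<integral>\<^sup>+s. ennreal (pi powr (n / 2)) * ennreal (?I s * (s powr (n / 2 - 1) * exp (- 1 * s))) \<partial>lborel)"
  proof (rule nn_integral_cong)
    fix s :: real
    show "ennreal (?I s * (s powr (n - 1) * exp (- s))) * (\<integral>\<^sup>+(x::'a). ennreal (exp (- s * (norm x)\<^sup>2)) \<partial>lborel)
      = ennreal (pi powr (n / 2)) * ennreal (?I s * (s powr (n / 2 - 1) * exp (- 1 * s)))"
    proof (cases "s > 0")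
      case True
      have "s powr (n - 1) * s powr (- (n / 2)) = s powr (n / 2 - 1)"
        unfolding powr_add[symmetric] by (rule arg_cong[where f = "\<lambda>e. s powr e"]) (simp add: field_simps)
      then have "s powr (n - 1) * (pi / s) powr (n / 2) = pi powr (n / 2) * s powr (n / 2 - 1)"
        using True by (simp add: powr_divide powr_minus field_simps)
      then show ?thesis using True by (subst nn_integral_gaussian[OF True]) (simp add: n_def[symmetric] ennreal_mult'[symmetric] mult_ac)
    qed auto
  qed
  also have "\<dots> < \<infinity>"
    using n nn_integral_Gamma_scaled[of "n / 2" 1]
    by (subst nn_integral_cmult) (auto simp: ennreal_mult_less_top)
  finally have "(\<integral>\<^sup>+x. ennreal (1 / (1 + (norm (x::'a))\<^sup>2) ^ DIM('a)) \<partial>lborel) < \<infinity>"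
    using G by (auto simp: ennreal_mult_less_top)
  then show ?thesis by (intro integrableI_nonneg) auto
qed

text \<open>Inside the unit ball the weight is compared with a Gaussian, the factor
  \<open>exp 1\<close> making that Gaussian at least 1 there; outside, the singular power is at most
  1 and the inverse power takes over.\<close>

lemma integrable_powr_norm_decay:
  fixes a :: real
  assumes "0 \<le> a" "a < real DIM('a)"
  shows "integrable lborel (\<lambda>x::'a::euclidean_space. norm x powr (- a) / (1 + norm x) ^ (2 * DIM('a)))"
proof (rule Bochner_Integration.integrable_bound)
  show "integrable lborel (\<lambda>x::'a. exp 1 * (norm x powr (- a) * exp (- 1 * (norm x)\<^sup>2)) + 1 / (1 + (norm x)\<^sup>2) ^ DIM('a))"
    by (intro Bochner_Integration.integrable_add integrable_mult_right integrable_powr_norm_gaussian integrable_inverse_power assms) auto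
  show "AE x in lborel. norm (norm (x::'a) powr (- a) / (1 + norm x) ^ (2 * DIM('a)))
     \<le> norm (exp 1 * (norm x powr (- a) * exp (- 1 * (norm x)\<^sup>2)) + 1 / (1 + (norm x)\<^sup>2) ^ DIM('a))"
  proof (rule AE_I2)
    fix x :: 'a
    show "norm (norm x powr (- a) / (1 + norm x) ^ (2 * DIM('a)))
     \<le> norm (exp 1 * (norm x powr (- a) * exp (- 1 * (norm x)\<^sup>2)) + 1 / (1 + (norm x)\<^sup>2) ^ DIM('a))"
    proof (cases "norm x \<le> 1")
      case True
      have "norm x powr (- a) / (1 + norm x) ^ (2 * DIM('a)) \<le> norm x powr (- a) / 1"
        by (intro divide_left_mono) (auto intro!: zero_less_power add_pos_nonneg)
      also have "\<dots> = norm x powr (- a) * 1" by simp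
      also have "\<dots> \<le> norm x powr (- a) * exp (1 - (norm x)\<^sup>2)"
        using True by (intro mult_left_mono) (auto simp: power_le_one)
      also have "\<dots> = exp 1 * (norm x powr (- a) * exp (- 1 * (norm x)\<^sup>2))"
        by (simp add: exp_diff exp_minus field_simps)
      finally show ?thesis by (simp add: add_increasing2)
    next
      case False
      have "norm x powr (- a) \<le> 1"
        using False assms powr_mono[of "- a" 0 "norm x"] by (auto split: if_splits)
      moreover have "(1 + (norm x)\<^sup>2) ^ DIM('a) \<le> (1 + norm x) ^ (2 * DIM('a))"
        unfolding power_mult by (intro power_mono) (auto simp: power2_eq_square algebra_simps)
      ultimately have "norm x powr (- a) / (1 + norm x) ^ (2 * DIM('a)) \<le> 1 / (1 + (norm x)\<^sup>2) ^ DIM('a)"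
        by (intro frac_le) (auto simp: add_pos_nonneg)
      then show ?thesis by (simp add: add_increasing)
    qed
  qed
qed simp

section \<open>Schwartz functions\<close>

definition partial_deriv :: "'n::finite \<Rightarrow> (real ^ 'n \<Rightarrow> complex) \<Rightarrow> real ^ 'n \<Rightarrow> complex" where
  "partial_deriv i \<phi> = (\<lambda>x. frechet_derivative \<phi> (at x) (axis i 1))"

lemma partial_deriv_eqI:
  assumes "\<And>x. (\<phi> has_derivative (\<lambda>h. D x h)) (at x)"
  shows "partial_deriv i \<phi> = (\<lambda>x. D x (axis i 1))"
  unfolding partial_deriv_def using frechet_derivative_at[OF assms] by metis

lemma sum_axis_scaleR: "(\<Sum>j\<in>UNIV. (axis i (1::real) $ j) *\<^sub>R d j) = d i"
  for i :: "'n::finite" and d :: "'n \<Rightarrow> 'b::real_vector"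
  by (simp add: axis_def if_distrib[of "\<lambda>c. c *\<^sub>R _"] cong: if_cong)

text \<open>The Schwartz space is the largest class of differentiable, rapidly decreasing functions
  closed under partial derivatives. Membership is shown by exhibiting any such class, which avoids
  formulas for iterated derivatives.\<close>

lemma schwartz_coinduct:
  assumes diff: "\<And>\<phi> x. \<phi> \<in> A \<Longrightarrow> \<phi> differentiable (at x)"
    and bdd: "\<And>\<phi> N. \<phi> \<in> A \<Longrightarrow> \<exists>C. \<forall>x. (1 + norm x) ^ N * norm (\<phi> x) \<le> C"
    and der: "\<And>\<phi> i. \<phi> \<in> A \<Longrightarrow> partial_deriv i \<phi> \<in> A"
  shows "A \<subseteq> schwartz"
proof
  fix \<phi> assume "\<phi> \<in> A"
  then have it: "iterated_partial is \<phi> \<in> A" for "is"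
    by (induction "is") (auto dest: der simp: partial_deriv_def)
  have "bounded (range (\<lambda>x. (1 + norm x) ^ N *\<^sub>R iterated_partial is \<phi> x))" for "is" N
    using bdd[OF it, of "N" "is"] by (auto simp: bounded_iff power_abs abs_of_nonneg)
  then show "\<phi> \<in> schwartz" using diff[OF it] by (auto simp: schwartz_def)
qed

lemma schwartz_differentiable: "\<phi> \<in> schwartz \<Longrightarrow> \<phi> differentiable (at x)"
  unfolding schwartz_def by (metis (mono_tags, lifting) iterated_partial.simps(1) mem_Collect_eq)

lemma schwartz_decay:
  assumes "\<phi> \<in> schwartz"
  obtains C where "C \<ge> 0" "\<And>x. (1 + norm x) ^ N * norm (\<phi> x) \<le> C" "\<And>x. norm (\<phi> x) \<le> C / (1 + norm x) ^ N"
proof -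
  have "bounded (range (\<lambda>x. (1 + norm x) ^ N *\<^sub>R iterated_partial [] \<phi> x))"
    using assms unfolding schwartz_def by blast
  then obtain C where C: "(1 + norm x) ^ N * norm (\<phi> x) \<le> C" for x
    by (auto simp: bounded_iff power_abs abs_of_nonneg)
  have "0 \<le> (1 + norm (0::real^'a)) ^ N * norm (\<phi> 0)" by simp
  also have "\<dots> \<le> C" by (rule C)
  finally have "C \<ge> 0" .
  moreover have "norm (\<phi> x) \<le> C / (1 + norm x) ^ N" for x
    using C[of x] by (simp add: pos_le_divide_eq add_pos_nonneg mult.commute)
  ultimately show ?thesis using C that by blast
qed

text \<open>The last index of the list is differentiated first, so an inner derivative appears at
  the end.\<close>

lemma iterated_partial_append: "iterated_partial is (partial_deriv i \<phi>) = iterated_partial (is @ [i]) \<phi>"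
  by (induction "is") (auto simp: partial_deriv_def)

lemma schwartz_partial_deriv: "\<phi> \<in> schwartz \<Longrightarrow> partial_deriv i \<phi> \<in> schwartz"
  unfolding schwartz_def by (auto simp: iterated_partial_append)

lemma schwartz_has_derivative:
  assumes "\<phi> \<in> schwartz"
  shows "(\<phi> has_derivative (\<lambda>h. \<Sum>i\<in>UNIV. (h $ i) *\<^sub>R partial_deriv i \<phi> x)) (at x)"
proof -
  let ?D = "frechet_derivative \<phi> (at x)"
  have D: "(\<phi> has_derivative ?D) (at x)"
    using schwartz_differentiable[OF assms] frechet_derivative_works by blast
  have "?D h = (\<Sum>i\<in>UNIV. (h $ i) *\<^sub>R partial_deriv i \<phi> x)" for h
  proof -
    have "?D h = ?D (\<Sum>i\<in>UNIV. (h $ i) *\<^sub>R axis i 1)"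
      using basis_expansion[of h] by (simp add: scalar_mult_eq_scaleR)
    also have "\<dots> = (\<Sum>i\<in>UNIV. (h $ i) *\<^sub>R partial_deriv i \<phi> x)"
      using has_derivative_linear[OF D] by (simp add: linear_sum linear_cmul partial_deriv_def)
    finally show ?thesis .
  qed
  then show ?thesis using D by (metis (no_types, lifting) ext)
qed

lemma schwartz_continuous: "\<phi> \<in> schwartz \<Longrightarrow> continuous_on A \<phi>"
  using schwartz_differentiable differentiable_imp_continuous_within
  by (metis continuous_at_imp_continuous_on)

lemma schwartz_measurable: "\<phi> \<in> schwartz \<Longrightarrow> \<phi> \<in> borel_measurable borel"
  by (intro borel_measurable_continuous_onI schwartz_continuous)

lemma schwartz_add:
  fixes \<phi> \<psi> :: "real^'a::finite \<Rightarrow> complex"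
  assumes "\<phi> \<in> schwartz" "\<psi> \<in> schwartz"
  shows "(\<lambda>x. \<phi> x + \<psi> x) \<in> schwartz"
proof -
  let ?A = "{\<lambda>x. \<phi> x + \<psi> x | \<phi> \<psi> :: real^'a \<Rightarrow> complex. \<phi> \<in> schwartz \<and> \<psi> \<in> schwartz}"
  have "?A \<subseteq> schwartz"
  proof (rule schwartz_coinduct)
    fix f :: "real^'a \<Rightarrow> complex" and x and i
    assume "f \<in> ?A"
    then obtain \<phi> \<psi> where f: "f = (\<lambda>x. \<phi> x + \<psi> x)" and s: "\<phi> \<in> schwartz" "\<psi> \<in> schwartz" by auto
    note d = has_derivative_add[OF schwartz_has_derivative[OF s(1)] schwartz_has_derivative[OF s(2)]]
    show "f differentiable (at x)" unfolding f differentiable_def using d by blast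
    have "partial_deriv i f = (\<lambda>x. partial_deriv i \<phi> x + partial_deriv i \<psi> x)"
      unfolding f by (subst partial_deriv_eqI[OF d]) (simp add: sum_axis_scaleR)
    then show "partial_deriv i f \<in> ?A" using s schwartz_partial_deriv by blast
  next
    fix f :: "real^'a \<Rightarrow> complex" and N
    assume "f \<in> ?A"
    then obtain \<phi> \<psi> where f: "f = (\<lambda>x. \<phi> x + \<psi> x)" and s: "\<phi> \<in> schwartz" "\<psi> \<in> schwartz" by auto
    obtain C where C: "\<And>x. (1 + norm x) ^ N * norm (\<phi> x) \<le> C" by (rule schwartz_decay[OF s(1)]) blast
    obtain D where D: "\<And>x. (1 + norm x) ^ N * norm (\<psi> x) \<le> D" by (rule schwartz_decay[OF s(2)]) blast
    have "(1 + norm x) ^ N * norm (f x) \<le> C + D" for x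
    proof -
      have "(1 + norm x) ^ N * norm (f x) \<le> (1 + norm x) ^ N * (norm (\<phi> x) + norm (\<psi> x))"
        unfolding f by (intro mult_left_mono norm_triangle_ineq) auto
      then show ?thesis using C[of x] D[of x] by (simp add: distrib_left)
    qed
    then show "\<exists>C. \<forall>x. (1 + norm x) ^ N * norm (f x) \<le> C" by blast
  qed
  then show ?thesis using assms by blast
qed

text \<open>If the derivative of m is m times a multiplier \<open>p\<close>, then the derivative of
  m \<phi> is m times the Schwartz function formed by the derivative of \<phi> plus p \<phi>. Hence
  the products m \<phi> are a closed class; constants, modulations and Gaussians have this
  shape.\<close>

lemma schwartz_mult:
  assumes m: "\<And>x. (m has_derivative m' x) (at x)"
    and p: "\<And>i x. m' x (axis i 1) = m x * p i x"
    and ps: "\<And>i \<phi>. \<phi> \<in> schwartz \<Longrightarrow> (\<lambda>x. p i x * \<phi> x) \<in> schwartz"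
    and mb: "\<And>x. norm (m x) \<le> B"
    and \<phi>: "\<phi> \<in> schwartz"
  shows "(\<lambda>x. m x * \<phi> x) \<in> schwartz"
proof -
  let ?A = "{\<lambda>x. m x * \<phi> x | \<phi>. \<phi> \<in> schwartz}"
  have "?A \<subseteq> schwartz"
  proof (rule schwartz_coinduct)
    fix f :: "real^'a \<Rightarrow> complex" and x and i
    assume "f \<in> ?A"
    then obtain \<phi> where f: "f = (\<lambda>x. m x * \<phi> x)" and s: "\<phi> \<in> schwartz" by auto
    note d = has_derivative_mult[OF m schwartz_has_derivative[OF s]]
    show "f differentiable (at x)" unfolding f differentiable_def using d by blast
    define q where "q = (\<lambda>x. partial_deriv i \<phi> x + p i x * \<phi> x)"
    have "partial_deriv i f = (\<lambda>x. m x * q x)"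
      unfolding f q_def by (subst partial_deriv_eqI[OF d]) (simp add: p sum_axis_scaleR algebra_simps)
    moreover have "q \<in> schwartz"
      unfolding q_def by (intro schwartz_add schwartz_partial_deriv s ps)
    ultimately show "partial_deriv i f \<in> ?A" by blast
  next
    fix f :: "real^'a \<Rightarrow> complex" and N
    assume "f \<in> ?A"
    then obtain \<phi> where f: "f = (\<lambda>x. m x * \<phi> x)" and s: "\<phi> \<in> schwartz" by auto
    obtain C where C: "C \<ge> 0" "\<And>x. (1 + norm x) ^ N * norm (\<phi> x) \<le> C" by (rule schwartz_decay[OF s(1)]) blast
    have "(1 + norm x) ^ N * norm (f x) \<le> B * C" for x
    proof -
      have "(1 + norm x) ^ N * norm (f x) = norm (m x) * ((1 + norm x) ^ N * norm (\<phi> x))"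
        by (simp add: f norm_mult)
      also have "\<dots> \<le> B * C" using C mb order_trans[OF norm_ge_zero mb[of x]] by (intro mult_mono) auto
      finally show ?thesis .
    qed
    then show "\<exists>C. \<forall>x. (1 + norm x) ^ N * norm (f x) \<le> C" by blast
  qed
  then show ?thesis using \<phi> by blast
qed

lemma schwartz_zero: "(\<lambda>x. 0) \<in> schwartz"
proof -
  have "{\<lambda>x::real^'a. 0 :: complex} \<subseteq> schwartz"
    by (rule schwartz_coinduct) (auto simp: partial_deriv_def)
  then show ?thesis by simp
qed

lemma schwartz_cmult:
  fixes \<phi> :: "real^'a::finite \<Rightarrow> complex"
  assumes "\<phi> \<in> schwartz"
  shows "(\<lambda>x. c * \<phi> x) \<in> schwartz"
  using assms
  by (rule schwartz_mult[where m' = "\<lambda>x h. 0" and p = "\<lambda>i x. 0" and B = "norm c", rotated -1]) (simp_all add: schwartz_zero)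

lemma schwartz_sum:
  "finite A \<Longrightarrow> (\<And>i. i \<in> A \<Longrightarrow> \<phi> i \<in> schwartz) \<Longrightarrow> (\<lambda>x. \<Sum>i\<in>A. \<phi> i x) \<in> schwartz"
  by (induction A rule: finite_induct) (auto intro: schwartz_zero schwartz_add)

text \<open>Differentiating the coordinate leaves a multiple of \<phi> without the factor, so the
  class closed under derivatives has to include an additional Schwartz summand. The factor costs one
  order of decay.\<close>

lemma schwartz_coord_mult:
  assumes \<phi>: "\<phi> \<in> schwartz"
  shows "(\<lambda>x. complex_of_real (x $ j) * \<phi> x) \<in> schwartz"
proof -
  let ?A = "{\<lambda>x. complex_of_real (x $ j) * \<phi> x + \<psi> x | \<phi> \<psi>. \<phi> \<in> schwartz \<and> \<psi> \<in> schwartz}"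
  have "?A \<subseteq> schwartz"
  proof (rule schwartz_coinduct)
    fix f :: "real^'a \<Rightarrow> complex" and x and i
    assume "f \<in> ?A"
    then obtain \<phi> \<psi> where f: "f = (\<lambda>x. complex_of_real (x $ j) * \<phi> x + \<psi> x)" and s: "\<phi> \<in> schwartz" "\<psi> \<in> schwartz" by auto
    have c: "((\<lambda>x. complex_of_real (x $ j)) has_derivative (\<lambda>h. complex_of_real (h $ j))) (at x)" for x :: "real^'a"
      by (auto intro!: derivative_eq_intros bounded_linear_imp_has_derivative bounded_linear_compose[OF bounded_linear_of_real bounded_linear_vec_nth])
    note d = has_derivative_add[OF has_derivative_mult[OF c schwartz_has_derivative[OF s(1)]] schwartz_has_derivative[OF s(2)]]
    show "f differentiable (at x)" unfolding f differentiable_def using d by blast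
    define q where "q = (\<lambda>x. (if i = j then 1 else 0) * \<phi> x + partial_deriv i \<psi> x)"
    have "partial_deriv i f = (\<lambda>x. complex_of_real (x $ j) * partial_deriv i \<phi> x + q x)"
      unfolding f q_def by (subst partial_deriv_eqI[OF d]) (simp add: sum_axis_scaleR, simp add: axis_def add.assoc)
    moreover have "q \<in> schwartz"
      unfolding q_def by (intro schwartz_add schwartz_cmult schwartz_partial_deriv s)
    ultimately show "partial_deriv i f \<in> ?A" using schwartz_partial_deriv[OF s(1), of i] by blast
  next
    fix f :: "real^'a \<Rightarrow> complex" and N
    assume "f \<in> ?A"
    then obtain \<phi> \<psi> where f: "f = (\<lambda>x. complex_of_real (x $ j) * \<phi> x + \<psi> x)" and s: "\<phi> \<in> schwartz" "\<psi> \<in> schwartz" by auto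
    obtain C where C: "\<And>x. (1 + norm x) ^ Suc N * norm (\<phi> x) \<le> C" by (rule schwartz_decay[OF s(1)]) blast
    obtain D where D: "\<And>x. (1 + norm x) ^ N * norm (\<psi> x) \<le> D" by (rule schwartz_decay[OF s(2)]) blast
    have "(1 + norm x) ^ N * norm (f x) \<le> C + D" for x
    proof -
      have "norm (f x) \<le> norm (complex_of_real (x $ j) * \<phi> x) + norm (\<psi> x)" unfolding f by (rule norm_triangle_ineq)
      also have "\<dots> \<le> (1 + norm x) * norm (\<phi> x) + norm (\<psi> x)"
        using component_le_norm_cart[of x j] by (auto simp: norm_mult intro!: mult_right_mono)
      finally have "(1 + norm x) ^ N * norm (f x) \<le> (1 + norm x) ^ N * ((1 + norm x) * norm (\<phi> x) + norm (\<psi> x))"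
        by (intro mult_left_mono) auto
      also have "\<dots> = (1 + norm x) ^ Suc N * norm (\<phi> x) + (1 + norm x) ^ N * norm (\<psi> x)"
        by (simp add: algebra_simps)
      finally show ?thesis using C[of x] D[of x] by linarith
    qed
    then show "\<exists>C. \<forall>x. (1 + norm x) ^ N * norm (f x) \<le> C" by blast
  qed
  moreover have "(\<lambda>x. complex_of_real (x $ j) * \<phi> x) \<in> ?A" using \<phi> schwartz_zero by force
  ultimately show ?thesis by blast
qed

lemma schwartz_affine:
  fixes L :: "real^'n::finite \<Rightarrow> real^'n"
  assumes L: "linear L" "inj L" and \<phi>: "\<phi> \<in> schwartz"
  shows "(\<lambda>x. \<phi> (t + L x)) \<in> schwartz"
proof -
  have bl: "bounded_linear L" using L linear_conv_bounded_linear by blast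
  obtain b where b: "b > 0" "\<And>x. b * norm x \<le> norm (L x)"
    using linear_inj_bounded_below_pos[OF L] by metis
  \<comment> \<open>Chosen so that 1 + |x| is at most K (1 + |t + L x|): injectivity bounds |L x|
    from below by b |x|, and |t| pays for the translation.\<close>
  define K where "K = 1 + (1 + norm t) / b"
  have K: "1 + norm x \<le> K * (1 + norm (t + L x))" for x
  proof -
    have "norm (L x) \<le> norm (t + L x) + norm t" using norm_triangle_ineq4[of "t + L x" t] by simp
    then have "b * norm x \<le> norm (t + L x) + norm t" using b(2)[of x] by linarith
    also have "\<dots> \<le> (1 + norm t) * (1 + norm (t + L x))" by (simp add: algebra_simps)
    finally have "norm x \<le> (1 + norm t) / b * (1 + norm (t + L x))"
      using b(1) by (simp add: field_simps)
    then show ?thesis unfolding K_def by (simp add: algebra_simps add_increasing)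
  qed
  let ?A = "{\<lambda>x. \<phi> (t + L x) | \<phi>. \<phi> \<in> schwartz}"
  have "?A \<subseteq> schwartz"
  proof (rule schwartz_coinduct)
    fix f :: "real^'n \<Rightarrow> complex" and x and i
    assume "f \<in> ?A"
    then obtain \<phi> where f: "f = (\<lambda>x. \<phi> (t + L x))" and s: "\<phi> \<in> schwartz" by auto
    have "((\<lambda>x. t + L x) has_derivative L) (at x)" for x
      using has_derivative_add[OF has_derivative_const[of t] bounded_linear_imp_has_derivative[OF bl]] by simp
    note d = has_derivative_compose[OF this schwartz_has_derivative[OF s]]
    show "f differentiable (at x)" unfolding f differentiable_def using d by blast
    define q where "q = (\<lambda>y. \<Sum>j\<in>UNIV. complex_of_real (L (axis i 1) $ j) * partial_deriv j \<phi> y)"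
    have "partial_deriv i f = (\<lambda>x. q (t + L x))"
      unfolding f q_def by (subst partial_deriv_eqI[OF d]) (simp add: scaleR_conv_of_real)
    moreover have "q \<in> schwartz"
      unfolding q_def by (intro schwartz_sum schwartz_cmult schwartz_partial_deriv s) auto
    ultimately show "partial_deriv i f \<in> ?A" by blast
  next
    fix f :: "real^'n \<Rightarrow> complex" and N
    assume "f \<in> ?A"
    then obtain \<phi> where f: "f = (\<lambda>x. \<phi> (t + L x))" and s: "\<phi> \<in> schwartz" by auto
    obtain C where C: "C \<ge> 0" "\<And>x. (1 + norm x) ^ N * norm (\<phi> x) \<le> C" by (rule schwartz_decay[OF s(1)]) blast
    have "(1 + norm x) ^ N * norm (f x) \<le> K ^ N * C" for x
    proof -
      have "(1 + norm x) ^ N * norm (f x) \<le> (K * (1 + norm (t + L x))) ^ N * norm (f x)"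
        by (intro mult_right_mono power_mono K) auto
      also have "\<dots> = K ^ N * ((1 + norm (t + L x)) ^ N * norm (\<phi> (t + L x)))"
        by (simp add: power_mult_distrib f)
      also have "\<dots> \<le> K ^ N * C" using b by (intro mult_left_mono C) (auto simp: K_def)
      finally show ?thesis .
    qed
    then show "\<exists>C. \<forall>x. (1 + norm x) ^ N * norm (f x) \<le> C" by blast
  qed
  then show ?thesis using \<phi> by blast
qed

lemma schwartz_cis_mult:
  assumes "\<phi> \<in> schwartz"
  shows "(\<lambda>x. cis (b \<bullet> x) * \<phi> x) \<in> schwartz"
proof (rule schwartz_mult)
  show "((\<lambda>x. cis (b \<bullet> x)) has_derivative (\<lambda>h. (b \<bullet> h) *\<^sub>R (\<i> * cis (b \<bullet> x)))) (at x)" for x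
    by (auto intro!: derivative_eq_intros)
  show "((b \<bullet> axis i 1) *\<^sub>R (\<i> * cis (b \<bullet> x))) = cis (b \<bullet> x) * (\<i> * of_real (b \<bullet> axis i 1))" for i x
    by (simp add: scaleR_conv_of_real)
qed (auto intro: schwartz_cmult assms)

lemma gaussian_has_derivative:
  "((\<lambda>x::'a::real_inner. complex_of_real (exp (- c * (norm x)\<^sup>2))) has_derivative
     (\<lambda>h. complex_of_real (exp (- c * (norm x)\<^sup>2) * (- (2 * c) * (x \<bullet> h))))) (at x)"
proof -
  have "((\<lambda>x::'a. complex_of_real (exp (- c * (x \<bullet> x)))) has_derivative
     (\<lambda>h. complex_of_real (exp (- c * (x \<bullet> x)) * (- (2 * c) * (x \<bullet> h))))) (at x)"
    by (auto intro!: derivative_eq_intros has_derivative_of_real simp: inner_commute algebra_simps)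
  then show ?thesis by (simp only: power2_norm_eq_inner)
qed

lemma schwartz_gaussian_mult:
  assumes "\<phi> \<in> schwartz" "c \<ge> 0"
  shows "(\<lambda>x. complex_of_real (exp (- c * (norm x)\<^sup>2)) * \<phi> x) \<in> schwartz"
proof (rule schwartz_mult[OF gaussian_has_derivative])
  show "complex_of_real (exp (- c * (norm x)\<^sup>2) * (- (2 * c) * (x \<bullet> axis i 1)))
     = complex_of_real (exp (- c * (norm x)\<^sup>2)) * (complex_of_real (- (2 * c)) * complex_of_real (x $ i))" for x i
    by (simp add: inner_axis)
  show "(\<lambda>x. complex_of_real (- (2 * c)) * complex_of_real (x $ i) * \<phi> x) \<in> schwartz" if "\<phi> \<in> schwartz" for \<phi> and i :: 'a
    using schwartz_cmult[OF schwartz_coord_mult[OF that, of i], of "complex_of_real (- (2 * c))"] by (simp add: mult.assoc)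
  show "norm (complex_of_real (exp (- c * (norm x)\<^sup>2))) \<le> 1" for x :: "real^'a" using assms by simp
qed (rule assms)

text \<open>Polynomials, generated by multiplication with one coordinate at a time: this is the form
  in which differentiating a Gaussian produces them.\<close>

inductive_set polyfun :: "(real ^ 'n::finite \<Rightarrow> complex) set" where
  const: "(\<lambda>x. c) \<in> polyfun"
| coord: "p \<in> polyfun \<Longrightarrow> (\<lambda>x. complex_of_real (x $ i) * p x) \<in> polyfun"
| add: "p \<in> polyfun \<Longrightarrow> q \<in> polyfun \<Longrightarrow> (\<lambda>x. p x + q x) \<in> polyfun"

lemma polyfun_cmult: "p \<in> polyfun \<Longrightarrow> (\<lambda>x. c * p x) \<in> polyfun"
proof (induction rule: polyfun.induct)
  case (const d) then show ?case by (rule polyfun.const)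
next
  case (coord p i)
  have "(\<lambda>x. c * (complex_of_real (x $ i) * p x)) = (\<lambda>x. complex_of_real (x $ i) * (c * p x))" by (simp add: mult_ac)
  then show ?case using polyfun.coord[OF coord.IH, of i] by simp
next
  case (add p q) then show ?case using polyfun.add[OF add.IH] by (simp add: distrib_left)
qed

lemma polyfun_growth: "p \<in> polyfun \<Longrightarrow> \<exists>C m. C \<ge> 0 \<and> (\<forall>x. norm (p x) \<le> C * (1 + norm x) ^ m)"
proof (induction rule: polyfun.induct)
  case (const c) then show ?case by (intro exI[of _ "norm c"] exI[of _ 0]) auto
next
  case (coord p i)
  then obtain C m where C: "C \<ge> 0" "\<And>x. norm (p x) \<le> C * (1 + norm x) ^ m" by blast
  have "norm (complex_of_real (x $ i) * p x) \<le> C * (1 + norm x) ^ Suc m" for x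
  proof -
    have "norm (complex_of_real (x $ i) * p x) \<le> (1 + norm x) * (C * (1 + norm x) ^ m)"
      unfolding norm_mult using C(2)[of x] component_le_norm_cart[of x i] by (intro mult_mono) auto
    then show ?thesis by (simp add: mult_ac)
  qed
  then show ?case using C(1) by blast
next
  case (add p q)
  then obtain C m D l where C: "C \<ge> 0" "\<And>x. norm (p x) \<le> C * (1 + norm x) ^ m"
    and D: "D \<ge> 0" "\<And>x. norm (q x) \<le> D * (1 + norm x) ^ l" by blast
  have "norm (p x + q x) \<le> (C + D) * (1 + norm x) ^ max m l" for x
  proof -
    have "C * (1 + norm x) ^ m \<le> C * (1 + norm x) ^ max m l" "D * (1 + norm x) ^ l \<le> D * (1 + norm x) ^ max m l"
      using C D by (auto intro!: mult_left_mono power_increasing)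
    then show ?thesis using C(2)[of x] D(2)[of x] norm_triangle_ineq[of "p x" "q x"] by (simp add: distrib_right)
  qed
  then show ?case using C D by (metis add_nonneg_nonneg)
qed

lemma polyfun_has_derivative:
  "p \<in> polyfun \<Longrightarrow> \<exists>p'. (\<forall>x. (p has_derivative p' x) (at x)) \<and> (\<forall>i. (\<lambda>x. p' x (axis i 1)) \<in> polyfun)"
proof (induction rule: polyfun.induct)
  case (const c)
  then show ?case by (intro exI[of _ "\<lambda>x h. 0"]) (auto intro: polyfun.const)
next
  case (coord p j)
  then obtain p' where p': "\<And>x. (p has_derivative p' x) (at x)" "\<And>i. (\<lambda>x. p' x (axis i 1)) \<in> polyfun" by blast
  have c: "((\<lambda>x. complex_of_real (x $ j)) has_derivative (\<lambda>h. complex_of_real (h $ j))) (at x)" for x :: "real^'a"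
    by (auto intro!: derivative_eq_intros bounded_linear_imp_has_derivative bounded_linear_compose[OF bounded_linear_of_real bounded_linear_vec_nth])
  have "(\<lambda>x. complex_of_real (x $ j) * p' x (axis i 1) + complex_of_real (axis i 1 $ j) * p x) \<in> polyfun" for i
    by (intro polyfun.add polyfun.coord p' polyfun_cmult coord)
  then show ?case using has_derivative_mult[OF c p'(1)]
    by (intro exI[of _ "\<lambda>x h. complex_of_real (x $ j) * p' x h + complex_of_real (h $ j) * p x"]) auto
next
  case (add p q)
  then obtain p' q' where p': "\<And>x. (p has_derivative p' x) (at x)" "\<And>i. (\<lambda>x. p' x (axis i 1)) \<in> polyfun"
    and q': "\<And>x. (q has_derivative q' x) (at x)" "\<And>i. (\<lambda>x. q' x (axis i 1)) \<in> polyfun" by blast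
  have "(\<lambda>x. p' x (axis i 1) + q' x (axis i 1)) \<in> polyfun" for i
    by (intro polyfun.add p' q')
  then show ?case using has_derivative_add[OF p'(1) q'(1)]
    by (intro exI[of _ "\<lambda>x h. p' x h + q' x h"]) auto
qed

lemma one_plus_power_le_exp:
  assumes "c > 0"
  shows "\<exists>C. \<forall>r\<ge>0. (1 + r) ^ N * exp (- c * r\<^sup>2) \<le> (C::real)"
proof -
  have "((\<lambda>r::real. (1 + r) ^ N * exp (- c * r\<^sup>2)) \<longlongrightarrow> 0) at_top"
    using assms by real_asymp
  then have "\<forall>\<^sub>F r in at_top. (1 + r) ^ N * exp (- c * r\<^sup>2) < 1"
    by (rule order_tendstoD) auto
  then obtain R where R: "\<And>r. r \<ge> R \<Longrightarrow> (1 + r) ^ N * exp (- c * r\<^sup>2) < 1"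
    by (auto simp: eventually_at_top_linorder)
  have "(1 + r) ^ N * exp (- c * r\<^sup>2) \<le> (1 + \<bar>R\<bar>) ^ N + 1" if "r \<ge> 0" for r
  proof (cases "r \<ge> R")
    case True
    then have "(1 + r) ^ N * exp (- c * r\<^sup>2) \<le> 1" using R[of r] by simp
    also have "\<dots> \<le> (1 + \<bar>R\<bar>) ^ N + 1" by simp
    finally show ?thesis .
  next
    case False
    have "(1 + r) ^ N * exp (- c * r\<^sup>2) \<le> (1 + \<bar>R\<bar>) ^ N * 1"
      using False that assms by (intro mult_mono power_mono) auto
    then show ?thesis by simp
  qed
  then show ?thesis by blast
qed

text \<open>The constant 1 is not Schwartz, so \<open>schwartz_mult\<close> does not reach the bare
  Gaussian. The class to use is that of Gaussians times polynomials, where exponential decay beats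
  polynomial growth.\<close>

lemma schwartz_gaussian:
  assumes "c > 0"
  shows "(\<lambda>x. complex_of_real (exp (- c * (norm x)\<^sup>2))) \<in> schwartz"
proof -
  let ?g = "\<lambda>x::real^'a. complex_of_real (exp (- c * (norm x)\<^sup>2))"
  let ?A = "{\<lambda>x. ?g x * p x | p. p \<in> polyfun}"
  have "?A \<subseteq> schwartz"
  proof (rule schwartz_coinduct)
    fix f :: "real^'a \<Rightarrow> complex" and x and i
    assume "f \<in> ?A"
    then obtain p where f: "f = (\<lambda>x. ?g x * p x)" and s: "p \<in> polyfun" by auto
    obtain p' where p': "\<And>x. (p has_derivative p' x) (at x)" "\<And>i. (\<lambda>x. p' x (axis i 1)) \<in> polyfun"
      using polyfun_has_derivative[OF s] by blast
    note d = has_derivative_mult[OF gaussian_has_derivative[of c] p'(1)]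
    show "f differentiable (at x)" unfolding f differentiable_def using d by blast
    define q where "q = (\<lambda>x. p' x (axis i 1) + complex_of_real (- (2 * c)) * (complex_of_real (x $ i) * p x))"
    have "partial_deriv i f = (\<lambda>x. ?g x * q x)"
      unfolding f q_def by (subst partial_deriv_eqI[OF d]) (simp add: inner_axis algebra_simps)
    moreover have "q \<in> polyfun"
      unfolding q_def by (intro polyfun.add polyfun_cmult polyfun.coord p' s)
    ultimately show "partial_deriv i f \<in> ?A" by blast
  next
    fix f :: "real^'a \<Rightarrow> complex" and N
    assume "f \<in> ?A"
    then obtain p where f: "f = (\<lambda>x. ?g x * p x)" and s: "p \<in> polyfun" by auto
    obtain C m where C: "C \<ge> 0" "\<And>x. norm (p x) \<le> C * (1 + norm x) ^ m" using polyfun_growth[OF s] by blast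
    obtain D where D: "\<And>r. r \<ge> 0 \<Longrightarrow> (1 + r) ^ (N + m) * exp (- c * r\<^sup>2) \<le> D"
      using one_plus_power_le_exp[OF assms] by metis
    have "(1 + norm x) ^ N * norm (f x) \<le> C * D" for x
    proof -
      have "(1 + norm x) ^ N * norm (f x) \<le> (1 + norm x) ^ N * (exp (- c * (norm x)\<^sup>2) * (C * (1 + norm x) ^ m))"
        unfolding f by (auto simp: norm_mult intro!: mult_left_mono C)
      also have "\<dots> = C * ((1 + norm x) ^ (N + m) * exp (- c * (norm x)\<^sup>2))" by (simp add: power_add mult_ac)
      also have "\<dots> \<le> C * D" by (intro mult_left_mono D C) auto
      finally show ?thesis .
    qed
    then show "\<exists>C. \<forall>x. (1 + norm x) ^ N * norm (f x) \<le> C" by blast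
  qed
  moreover have "?g \<in> ?A" using polyfun.const[of 1] by force
  ultimately show ?thesis by blast
qed

lemma schwartz_integrable_weighted:
  fixes \<phi> :: "real^'n::finite \<Rightarrow> complex"
  assumes \<phi>: "\<phi> \<in> schwartz" and a: "0 \<le> a" "a < real CARD('n)"
  shows "integrable lborel (\<lambda>x. norm x powr (- a) * ((1 + norm x) ^ N * norm (\<phi> x)))"
proof -
  have [measurable]: "\<phi> \<in> borel_measurable borel" by (rule schwartz_measurable[OF \<phi>])
  \<comment> \<open>Besides the \<open>N\<close> powers of the statement, 2n powers of decay are
    spent on \<open>integrable_powr_norm_decay\<close>.\<close>
  obtain C where C: "C \<ge> 0" "\<And>x. (1 + norm x) ^ (2 * CARD('n) + N) * norm (\<phi> x) \<le> C" by (rule schwartz_decay[OF \<phi>]) blast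
  show ?thesis
  proof (rule Bochner_Integration.integrable_bound)
    show "integrable lborel (\<lambda>x::real^'n. C * (norm x powr (- a) / (1 + norm x) ^ (2 * DIM(real^'n))))"
      by (intro integrable_mult_right integrable_powr_norm_decay) (use a in auto)
    show "AE x in lborel. norm (norm x powr (- a) * ((1 + norm x) ^ N * norm (\<phi> x)))
       \<le> norm (C * (norm x powr (- a) / (1 + norm x) ^ (2 * DIM(real^'n))))"
    proof (rule AE_I2)
      fix x :: "real^'n"
      have "(1 + norm x) ^ N * norm (\<phi> x) \<le> C / (1 + norm x) ^ (2 * CARD('n))"
        using C(2)[of x] by (simp add: pos_le_divide_eq power_add mult_ac add_pos_nonneg)
      then have "norm x powr (- a) * ((1 + norm x) ^ N * norm (\<phi> x)) \<le> norm x powr (- a) * (C / (1 + norm x) ^ (2 * CARD('n)))"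
        by (intro mult_left_mono) auto
      then show "norm (norm x powr (- a) * ((1 + norm x) ^ N * norm (\<phi> x)))
       \<le> norm (C * (norm x powr (- a) / (1 + norm x) ^ (2 * DIM(real^'n))))"
        using C(1) by (simp add: abs_mult mult_ac)
    qed
  qed simp
qed

lemma schwartz_integrable_power:
  fixes \<phi> :: "real^'n::finite \<Rightarrow> complex"
  assumes \<phi>: "\<phi> \<in> schwartz"
  shows "integrable lborel (\<lambda>x. (1 + norm x) ^ N * norm (\<phi> x))"
proof (rule Bochner_Integration.integrable_bound[OF schwartz_integrable_weighted[OF \<phi>, of 0 N]])
  have [measurable]: "\<phi> \<in> borel_measurable borel" by (rule schwartz_measurable[OF \<phi>])
  show "(\<lambda>x. (1 + norm x) ^ N * norm (\<phi> x)) \<in> borel_measurable lborel" by measurable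
  \<comment> \<open>The comparison fails at the origin, where \<open>0 powr 0 = 0\<close>.\<close>
  show "AE x in lborel. norm ((1 + norm x) ^ N * norm (\<phi> x)) \<le> norm (norm x powr (- 0) * ((1 + norm x) ^ N * norm (\<phi> x)))"
    by (rule eventually_mono[OF AE_lborel_singleton[of 0]]) auto
qed auto

lemma schwartz_integrable:
  assumes \<phi>: "\<phi> \<in> schwartz"
  shows "integrable lborel \<phi>"
  using schwartz_integrable_power[OF \<phi>, of 0] schwartz_measurable[OF \<phi>]
  by (subst integrable_norm_iff[symmetric]) auto

section \<open>Taylor estimates and differentiation under the integral sign\<close>

lemma norm_sum_coord_le:
  fixes h :: "real^'n::finite" and d :: "'n \<Rightarrow> complex"
  assumes "\<And>i. norm (d i) \<le> B i"
  shows "norm (\<Sum>i\<in>UNIV. (h $ i) *\<^sub>R d i) \<le> (\<Sum>i\<in>UNIV. B i) * norm h"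
proof -
  have "norm (\<Sum>i\<in>UNIV. (h $ i) *\<^sub>R d i) \<le> (\<Sum>i\<in>UNIV. norm h * B i)"
    by (rule order_trans[OF norm_sum], rule sum_mono)
       (auto intro!: mult_mono component_le_norm_cart assms)
  then show ?thesis by (simp add: sum_distrib_left mult.commute)
qed

lemma schwartz_lipschitz:
  fixes \<phi> :: "real^'n::finite \<Rightarrow> complex"
  assumes \<phi>: "\<phi> \<in> schwartz"
  obtains C where "C \<ge> 0" "\<And>y h. norm h \<le> 1 \<Longrightarrow> norm (\<phi> (y + h) - \<phi> y) \<le> norm h * (C / (1 + norm y) ^ N)"
proof -
  have "\<exists>C. C \<ge> 0 \<and> (\<forall>x. norm (partial_deriv i \<phi> x) \<le> C / (1 + norm x) ^ N)" for i
    using schwartz_decay[OF schwartz_partial_deriv[OF \<phi>, of i], of N] by metis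
  then obtain B where B: "\<And>i. B i \<ge> 0" "\<And>i x. norm (partial_deriv i \<phi> x) \<le> B i / (1 + norm x) ^ N" by metis
  \<comment> \<open>The factor 2^N moves the weight from an intermediate point z to y: at distance
    at most 1 one has 1 + |y| \<le> 2 (1 + |z|).\<close>
  define C where "C = 2 ^ N * (\<Sum>i\<in>UNIV. B i)"
  have "C \<ge> 0" using B by (auto simp: C_def intro!: sum_nonneg mult_nonneg_nonneg)
  moreover have "norm (\<phi> (y + h) - \<phi> y) \<le> norm h * (C / (1 + norm y) ^ N)" if h: "norm h \<le> 1" for y h
  proof -
    have "norm (\<phi> (y + h) - \<phi> y) \<le> (C / (1 + norm y) ^ N) * norm (y + h - y)"
    proof (rule differentiable_bound[OF convex_cball[of y 1]])
      fix z assume z: "z \<in> cball y 1"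
      show "(\<phi> has_derivative (\<lambda>h. \<Sum>i\<in>UNIV. (h $ i) *\<^sub>R partial_deriv i \<phi> z)) (at z within cball y 1)"
        by (rule has_derivative_at_withinI[OF schwartz_has_derivative[OF \<phi>]])
      have "norm y \<le> norm z + norm (y - z)" using norm_triangle_ineq[of z "y - z"] by simp
      moreover have "norm (y - z) \<le> 1" using z by (simp add: dist_norm)
      ultimately have "1 + norm y \<le> 2 * (1 + norm z)" using norm_ge_zero[of z] by argo
      then have "(1 + norm y) ^ N \<le> 2 ^ N * (1 + norm z) ^ N"
        by (metis power_mono power_mult_distrib add_nonneg_nonneg norm_ge_zero zero_le_one)
      then have "1 / (1 + norm z) ^ N \<le> 2 ^ N / (1 + norm y) ^ N"
        by (simp add: field_simps add_pos_nonneg)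
      then have *: "B i / (1 + norm z) ^ N \<le> B i * (2 ^ N / (1 + norm y) ^ N)" for i
        using mult_left_mono[of "1 / (1 + norm z) ^ N" "2 ^ N / (1 + norm y) ^ N" "B i"] B(1)[of i] by simp
      have "(\<Sum>i\<in>UNIV. B i * (2 ^ N / (1 + norm y) ^ N)) = C / (1 + norm y) ^ N"
        unfolding C_def sum_distrib_right[symmetric] by (simp add: mult.commute)
      then show "onorm (\<lambda>h. \<Sum>i\<in>UNIV. (h $ i) *\<^sub>R partial_deriv i \<phi> z) \<le> C / (1 + norm y) ^ N"
        using norm_sum_coord_le[of "\<lambda>i. partial_deriv i \<phi> z" "\<lambda>i. B i * (2 ^ N / (1 + norm y) ^ N)", OF order_trans[OF B(2) *]] \<open>C \<ge> 0\<close>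
        by (intro onorm_bound) simp_all
    qed (use h in \<open>auto simp: dist_norm\<close>)
    then show ?thesis by (simp add: mult.commute)
  qed
  ultimately show ?thesis using that by blast
qed

text \<open>The mean value inequality is applied to \<phi> minus its linear part at y, whose
  derivative is controlled by the Lipschitz bound for the partial derivatives. Decay of the constant
  in y keeps the remainder integrable over y.\<close>

lemma schwartz_taylor:
  fixes \<phi> :: "real^'n::finite \<Rightarrow> complex"
  assumes \<phi>: "\<phi> \<in> schwartz"
  obtains C where "C \<ge> 0" "\<And>y h. norm h \<le> 1 \<Longrightarrow>
     norm (\<phi> (y + h) - \<phi> y - (\<Sum>i\<in>UNIV. (h $ i) *\<^sub>R partial_deriv i \<phi> y)) \<le> (norm h)\<^sup>2 * (C / (1 + norm y) ^ N)"
proof -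
  have "\<exists>C. C \<ge> 0 \<and> (\<forall>y h. norm h \<le> 1 \<longrightarrow> norm (partial_deriv i \<phi> (y + h) - partial_deriv i \<phi> y) \<le> norm h * (C / (1 + norm y) ^ N))" for i
    using schwartz_lipschitz[OF schwartz_partial_deriv[OF \<phi>, of i], of N] by metis
  then obtain B where B: "\<And>i. B i \<ge> 0" "\<And>i y h. norm h \<le> 1 \<Longrightarrow>
    norm (partial_deriv i \<phi> (y + h) - partial_deriv i \<phi> y) \<le> norm h * (B i / (1 + norm y) ^ N)" by metis
  define C where "C = (\<Sum>i\<in>UNIV. B i)"
  have "C \<ge> 0" using B by (auto simp: C_def intro!: sum_nonneg mult_nonneg_nonneg)
  moreover have "norm (\<phi> (y + h) - \<phi> y - (\<Sum>i\<in>UNIV. (h $ i) *\<^sub>R partial_deriv i \<phi> y)) \<le> (norm h)\<^sup>2 * (C / (1 + norm y) ^ N)"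
    if h: "norm h \<le> 1" for y h
  proof -
    define g where "g z = \<phi> z - (\<Sum>i\<in>UNIV. (z $ i) *\<^sub>R partial_deriv i \<phi> y)" for z
    have "norm (g (y + h) - g y) \<le> (norm h * (C / (1 + norm y) ^ N)) * norm (y + h - y)"
    proof (rule differentiable_bound[OF convex_cball[of y "norm h"]])
      fix z assume z: "z \<in> cball y (norm h)"
      have "bounded_linear (\<lambda>h. \<Sum>i\<in>UNIV. (h $ i) *\<^sub>R partial_deriv i \<phi> y)"
        by (intro bounded_linear_sum bounded_linear_scaleR_const[OF bounded_linear_vec_nth])
      then have "(g has_derivative (\<lambda>h. (\<Sum>i\<in>UNIV. (h $ i) *\<^sub>R partial_deriv i \<phi> z) - (\<Sum>i\<in>UNIV. (h $ i) *\<^sub>R partial_deriv i \<phi> y))) (at z within cball y (norm h))"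
        unfolding g_def by (intro has_derivative_diff has_derivative_at_withinI[OF schwartz_has_derivative[OF \<phi>]] bounded_linear_imp_has_derivative)
      then show "(g has_derivative (\<lambda>h. (\<Sum>i\<in>UNIV. (h $ i) *\<^sub>R (partial_deriv i \<phi> z - partial_deriv i \<phi> y)))) (at z within cball y (norm h))"
        by (simp add: sum_subtractf scaleR_diff_right)
      have zy: "norm (z - y) \<le> norm h" using z by (simp add: dist_norm norm_minus_commute)
      have *: "norm (partial_deriv i \<phi> z - partial_deriv i \<phi> y) \<le> norm h * (B i / (1 + norm y) ^ N)" for i
      proof -
        have "norm (partial_deriv i \<phi> z - partial_deriv i \<phi> y) \<le> norm (z - y) * (B i / (1 + norm y) ^ N)"
          using B(2)[of "z - y" i y] zy h by simp
        also have "\<dots> \<le> norm h * (B i / (1 + norm y) ^ N)"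
          using zy B(1)[of i] by (intro mult_right_mono) auto
        finally show ?thesis .
      qed
      have "(\<Sum>i\<in>UNIV. norm h * (B i / (1 + norm y) ^ N)) = norm h * (C / (1 + norm y) ^ N)"
        by (simp add: C_def sum_distrib_left sum_divide_distrib)
      then show "onorm (\<lambda>h. \<Sum>i\<in>UNIV. (h $ i) *\<^sub>R (partial_deriv i \<phi> z - partial_deriv i \<phi> y)) \<le> norm h * (C / (1 + norm y) ^ N)"
        using norm_sum_coord_le[of "\<lambda>i. partial_deriv i \<phi> z - partial_deriv i \<phi> y" "\<lambda>i. norm h * (B i / (1 + norm y) ^ N)", OF *] \<open>C \<ge> 0\<close>
        by (intro onorm_bound) simp_all
    qed (auto simp: dist_norm)
    moreover have "g (y + h) - g y = \<phi> (y + h) - \<phi> y - (\<Sum>i\<in>UNIV. (h $ i) *\<^sub>R partial_deriv i \<phi> y)"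
      by (simp add: g_def scaleR_add_left sum.distrib)
    ultimately show ?thesis by (simp add: power2_eq_square mult_ac)
  qed
  ultimately show ?thesis using that by blast
qed

text \<open>A remainder of order |h|^2 with an integrable factor can be integrated directly, so
  differentiation under the integral sign needs no dominated convergence.\<close>

lemma has_derivative_integral_quadratic:
  fixes k :: "real^'n::finite \<Rightarrow> 'z::euclidean_space \<Rightarrow> complex"
  assumes k: "\<And>y. integrable M (k y)" and d: "\<And>i. integrable M (d i)" and B: "integrable M B"
    and quad: "\<And>h z. norm h \<le> 1 \<Longrightarrow> norm (k (x + h) z - k x z - (\<Sum>i\<in>UNIV. (h $ i) *\<^sub>R d i z)) \<le> (norm h)\<^sup>2 * B z"
  shows "((\<lambda>y. LINT z|M. k y z) has_derivative (\<lambda>h. \<Sum>i\<in>UNIV. (h $ i) *\<^sub>R (LINT z|M. d i z))) (at x)"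
proof -
  define F where "F y = (LINT z|M. k y z)" for y
  define D where "D h = (\<Sum>i\<in>UNIV. (h $ i) *\<^sub>R (LINT z|M. d i z))" for h :: "real^'n"
  define b where "b = (LINT z|M. B z)"
  have bl: "bounded_linear D" unfolding D_def
    by (intro bounded_linear_sum bounded_linear_scaleR_const[OF bounded_linear_vec_nth])
  have bound: "norm (F (x + h) - F x - D h) \<le> (norm h)\<^sup>2 * b" if "norm h \<le> 1" for h
  proof -
    have "F (x + h) - F x - D h = (LINT z|M. k (x + h) z - k x z - (\<Sum>i\<in>UNIV. (h $ i) *\<^sub>R d i z))"
      unfolding F_def D_def using k d by (simp add: integral_sum)
    also have "norm \<dots> \<le> (LINT z|M. (norm h)\<^sup>2 * B z)"
    proof (rule Bochner_Integration.integral_norm_bound_integral)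
      show "integrable M (\<lambda>z. k (x + h) z - k x z - (\<Sum>i\<in>UNIV. (h $ i) *\<^sub>R d i z))"
        using k d by auto
    qed (use B quad[OF that] in auto)
    finally show ?thesis by (simp add: b_def)
  qed
  have "(\<lambda>h. norm (F (x + h) - F x - D h) / norm h) \<midarrow>0\<rightarrow> 0"
  proof (rule Lim_null_comparison[where g = "\<lambda>h. norm h * b"])
    show "\<forall>\<^sub>F h in at 0. norm (norm (F (x + h) - F x - D h) / norm h) \<le> norm h * b"
      unfolding eventually_at
    proof (intro exI[of _ 1] conjI ballI impI)
      fix h :: "real^'n" assume "h \<noteq> 0 \<and> dist h 0 < 1"
      then show "norm (norm (F (x + h) - F x - D h) / norm h) \<le> norm h * b"
        using bound[of h] by (simp add: divide_le_eq power2_eq_square mult_ac)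
    qed simp
    show "((\<lambda>h::real^'n. norm h * b) \<longlongrightarrow> 0) (at 0)" by (auto intro!: tendsto_eq_intros)
  qed
  then have "(F has_derivative D) (at x)" using bl by (simp add: has_derivative_at)
  then show ?thesis unfolding F_def D_def .
qed

lemma one_plus_norm_add_power:
  fixes x y :: "'a::real_normed_vector"
  shows "(1 + norm x) ^ N \<le> (1 + norm (y + x)) ^ N * (1 + norm y) ^ N"
proof -
  have "norm x \<le> norm (y + x) + norm y" using norm_triangle_ineq4[of "y + x" y] by simp
  then have "1 + norm x \<le> 1 + norm (y + x) + norm y + norm (y + x) * norm y" by (simp add: add_increasing2)
  also have "\<dots> = (1 + norm (y + x)) * (1 + norm y)" by (simp add: algebra_simps)
  finally have "1 + norm x \<le> (1 + norm (y + x)) * (1 + norm y)" .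
  
  then show ?thesis by (metis power_mono power_mult_distrib add_nonneg_nonneg norm_ge_zero zero_le_one)
qed

text \<open>All derivatives fall on \<phi>; \<open>f\<close> contributes only moments, which
  transfer the decay through (1 + |x|)^N \<le> (1 + |z + x|)^N (1 + |z|)^N. Hence \<open>f\<close>
  may be singular or discontinuous, as are the damped kernel and the indicator of a box used
  below.\<close>

lemma schwartz_correlation:
  fixes f \<phi> :: "real^'n::finite \<Rightarrow> complex"
  assumes [measurable]: "f \<in> borel_measurable borel"
    and f: "\<And>N. integrable lborel (\<lambda>z. (1 + norm z) ^ N * norm (f z))" and \<phi>: "\<phi> \<in> schwartz"
  shows "(\<lambda>x. LBINT z. f z * \<phi> (z + x)) \<in> schwartz"
proof -
  let ?A = "{\<lambda>x. LBINT z. f z * \<phi> (z + x) | \<phi>. \<phi> \<in> schwartz}"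
  have nf: "integrable lborel (\<lambda>z. norm (f z))" using f[of 0] by simp
  have int: "integrable lborel (\<lambda>z. f z * \<phi> (z + x))" if s: "\<phi> \<in> schwartz" for \<phi> x
  proof -
    have [measurable]: "\<phi> \<in> borel_measurable borel" by (rule schwartz_measurable[OF s])
    obtain C where C: "C \<ge> 0" "\<And>x. (1 + norm x) ^ 0 * norm (\<phi> x) \<le> C" by (rule schwartz_decay[OF s]) blast
    show ?thesis
      by (rule Bochner_Integration.integrable_bound[OF integrable_mult_left[OF nf, of C]])
         (use C in \<open>auto simp: norm_mult intro!: mult_left_mono\<close>)
  qed
  have "?A \<subseteq> schwartz"
  proof (rule schwartz_coinduct)
    fix g :: "real^'n \<Rightarrow> complex" and x and i
    assume "g \<in> ?A"
    then obtain \<phi> where g: "g = (\<lambda>x. LBINT z. f z * \<phi> (z + x))" and s: "\<phi> \<in> schwartz" by auto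
    obtain C where C: "C \<ge> 0" "\<And>y h. norm h \<le> 1 \<Longrightarrow>
     norm (\<phi> (y + h) - \<phi> y - (\<Sum>i\<in>UNIV. (h $ i) *\<^sub>R partial_deriv i \<phi> y)) \<le> (norm h)\<^sup>2 * (C / (1 + norm y) ^ 0)"
      by (rule schwartz_taylor[OF s, where N = 0]) blast
    have d: "(g has_derivative (\<lambda>h. \<Sum>i\<in>UNIV. (h $ i) *\<^sub>R (LBINT z. f z * partial_deriv i \<phi> (z + x)))) (at x)" for x
      unfolding g
    proof (rule has_derivative_integral_quadratic[where B = "\<lambda>z. norm (f z) * C"])
      fix h :: "real^'n" and z assume "norm h \<le> 1"
      have "f z * \<phi> (z + (x + h)) - f z * \<phi> (z + x) - (\<Sum>i\<in>UNIV. (h $ i) *\<^sub>R (f z * partial_deriv i \<phi> (z + x)))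
        = f z * (\<phi> ((z + x) + h) - \<phi> (z + x) - (\<Sum>i\<in>UNIV. (h $ i) *\<^sub>R partial_deriv i \<phi> (z + x)))"
        by (simp add: algebra_simps sum_distrib_left)
      also have "norm \<dots> \<le> norm (f z) * ((norm h)\<^sup>2 * C)"
        unfolding norm_mult using C(2)[OF \<open>norm h \<le> 1\<close>, of "z + x"] by (intro mult_left_mono) auto
      finally show "norm (f z * \<phi> (z + (x + h)) - f z * \<phi> (z + x) - (\<Sum>i\<in>UNIV. (h $ i) *\<^sub>R (f z * partial_deriv i \<phi> (z + x))))
        \<le> (norm h)\<^sup>2 * (norm (f z) * C)" by (simp add: mult_ac)
    qed (use int s schwartz_partial_deriv nf in auto)
    show "g differentiable (at x)" unfolding differentiable_def using d by blast
    have "partial_deriv i g = (\<lambda>x. LBINT z. f z * partial_deriv i \<phi> (z + x))"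
      by (subst partial_deriv_eqI[OF d]) (simp add: sum_axis_scaleR)
    then show "partial_deriv i g \<in> ?A" using schwartz_partial_deriv[OF s] by blast
  next
    fix g :: "real^'n \<Rightarrow> complex" and N
    assume "g \<in> ?A"
    then obtain \<phi> where g: "g = (\<lambda>x. LBINT z. f z * \<phi> (z + x))" and s: "\<phi> \<in> schwartz" by auto
    obtain C where C: "C \<ge> 0" "\<And>x. (1 + norm x) ^ N * norm (\<phi> x) \<le> C" by (rule schwartz_decay[OF s(1)]) blast
    have "(1 + norm x) ^ N * norm (g x) \<le> (LBINT z. (1 + norm z) ^ N * norm (f z) * C)" for x
    proof -
      have "(1 + norm x) ^ N * norm (g x) = norm (LBINT z. complex_of_real ((1 + norm x) ^ N) * (f z * \<phi> (z + x)))"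
        by (simp add: g norm_mult norm_power del: of_real_add of_real_power)
      also have "\<dots> \<le> (LBINT z. (1 + norm z) ^ N * norm (f z) * C)"
      proof (rule Bochner_Integration.integral_norm_bound_integral)
        show "integrable lborel (\<lambda>z. complex_of_real ((1 + norm x) ^ N) * (f z * \<phi> (z + x)))"
          by (intro integrable_mult_right int s)
        show "integrable lborel (\<lambda>z. (1 + norm z) ^ N * norm (f z) * C)"
          by (intro integrable_mult_left f)
        fix z
        have "norm (complex_of_real ((1 + norm x) ^ N) * (f z * \<phi> (z + x))) = (1 + norm x) ^ N * (norm (f z) * norm (\<phi> (z + x)))"
          by (simp add: norm_mult norm_power del: of_real_add of_real_power)
        also have "\<dots> \<le> ((1 + norm (z + x)) ^ N * (1 + norm z) ^ N) * (norm (f z) * norm (\<phi> (z + x)))"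
          by (intro mult_right_mono one_plus_norm_add_power) auto
        also have "\<dots> = (1 + norm z) ^ N * norm (f z) * ((1 + norm (z + x)) ^ N * norm (\<phi> (z + x)))" by (simp add: mult_ac)
        also have "\<dots> \<le> (1 + norm z) ^ N * norm (f z) * C" by (intro mult_left_mono C) auto
        finally show "norm (complex_of_real ((1 + norm x) ^ N) * (f z * \<phi> (z + x))) \<le> (1 + norm z) ^ N * norm (f z) * C" .
      qed
      finally show ?thesis .
    qed
    then show "\<exists>C. \<forall>x. (1 + norm x) ^ N * norm (g x) \<le> C" by blast
  qed
  then show ?thesis using \<phi> by blast
qed

text \<open>The integral of a translate does not depend on the translation; differentiating this
  constant under the integral sign gives the claim.\<close>

lemma schwartz_integral_partial_deriv:
  fixes \<phi> :: "real^'n::finite \<Rightarrow> complex"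
  assumes \<phi>: "\<phi> \<in> schwartz"
  shows "(LBINT x. partial_deriv i \<phi> x) = 0"
proof -
  have [measurable]: "\<phi> \<in> borel_measurable borel" by (rule schwartz_measurable[OF \<phi>])
  obtain C where C: "C \<ge> 0" "\<And>y h. norm h \<le> 1 \<Longrightarrow>
     norm (\<phi> (y + h) - \<phi> y - (\<Sum>i\<in>UNIV. (h $ i) *\<^sub>R partial_deriv i \<phi> y)) \<le> (norm h)\<^sup>2 * (C / (1 + norm y) ^ (2 * CARD('n)))"
    by (rule schwartz_taylor[OF \<phi>, where N = "2 * CARD('n)"]) blast
  have eq: "(LBINT z. \<phi> (z + y)) = (LBINT z. \<phi> z)" for y
    using lebesgue_integral_translate[of \<phi> y] by (simp add: add.commute)
  have "((\<lambda>y. LBINT z. \<phi> (z + y)) has_derivative (\<lambda>h. \<Sum>i\<in>UNIV. (h $ i) *\<^sub>R (LBINT z. partial_deriv i \<phi> z))) (at 0)"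
  proof (rule has_derivative_integral_quadratic[where B = "\<lambda>y. C / (1 + norm y) ^ (2 * CARD('n))"])
    show "integrable lborel (\<lambda>z. \<phi> (z + y))" for y
      using schwartz_integrable[OF \<phi>] integrable_translate_iff[of \<phi> y] by (simp add: add.commute)
    show "integrable lborel (partial_deriv i \<phi>)" for i
      by (intro schwartz_integrable schwartz_partial_deriv \<phi>)
    have "integrable lborel (\<lambda>x::real^'n. C * (norm x powr (- 0) / (1 + norm x) ^ (2 * DIM(real^'n))))"
      by (intro integrable_mult_right integrable_powr_norm_decay) auto
    then show "integrable lborel (\<lambda>y::real^'n. C / (1 + norm y) ^ (2 * CARD('n)))"
      by (rule Bochner_Integration.integrable_bound, measurable)
         (rule eventually_mono[OF AE_lborel_singleton[of 0]], auto)
  qed (use C in auto)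
  then have "((\<lambda>y::real^'n. LBINT z. \<phi> z) has_derivative (\<lambda>h. \<Sum>i\<in>UNIV. (h $ i) *\<^sub>R (LBINT z. partial_deriv i \<phi> z))) (at 0)"
    by (simp add: eq)
  then have "(\<lambda>h::real^'n. \<Sum>i\<in>UNIV. (h $ i) *\<^sub>R (LBINT z. partial_deriv i \<phi> z)) = (\<lambda>h. 0)"
    using has_derivative_const has_derivative_unique by blast
  from fun_cong[OF this, of "axis i 1"] show ?thesis
    by (simp add: axis_def if_distrib[of "\<lambda>c. c *\<^sub>R _"] cong: if_cong)
qed

section \<open>The Fourier transform of Schwartz functions\<close>

lemma lborel_pair_integrableI:
  fixes f :: "'a::euclidean_space \<Rightarrow> 'b::euclidean_space \<Rightarrow> 'c::{banach, second_countable_topology}"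
  assumes [measurable]: "case_prod f \<in> borel_measurable (lborel \<Otimes>\<^sub>M lborel)"
    and "(\<integral>\<^sup>+x. (\<integral>\<^sup>+y. ennreal (norm (f x y)) \<partial>lborel) \<partial>lborel) < \<infinity>"
  shows "integrable (lborel \<Otimes>\<^sub>M lborel) (case_prod f)"
  unfolding integrable_iff_bounded
proof
  have "(\<integral>\<^sup>+z. ennreal (norm (case_prod f z)) \<partial>(lborel \<Otimes>\<^sub>M lborel)) = (\<integral>\<^sup>+x. (\<integral>\<^sup>+y. ennreal (norm (f x y)) \<partial>lborel) \<partial>lborel)"
    by (subst lborel.nn_integral_fst[symmetric]) auto
  then show "(\<integral>\<^sup>+z. ennreal (norm (case_prod f z)) \<partial>(lborel \<Otimes>\<^sub>M lborel)) < \<infinity>"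
    using assms(2) by simp
qed measurable

lemma lborel_pair_integrable_bound:
  fixes f :: "'a::euclidean_space \<Rightarrow> 'b::euclidean_space \<Rightarrow> 'c::{banach, second_countable_topology}"
    and g :: "'a \<Rightarrow> 'd::{banach, second_countable_topology}"
    and h :: "'b \<Rightarrow> 'e::{banach, second_countable_topology}"
  assumes [measurable]: "case_prod f \<in> borel_measurable (lborel \<Otimes>\<^sub>M lborel)"
    and g: "integrable lborel g" and h: "integrable lborel h"
    and bound: "AE x in lborel. \<forall>y. norm (f x y) \<le> norm (g x) * norm (h y)"
  shows "integrable (lborel \<Otimes>\<^sub>M lborel) (case_prod f)"
proof (rule lborel_pair_integrableI)
  have [measurable]: "g \<in> borel_measurable borel" "h \<in> borel_measurable borel"
    using g h borel_measurable_integrable by auto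
  have "(\<integral>\<^sup>+x. (\<integral>\<^sup>+y. ennreal (norm (f x y)) \<partial>lborel) \<partial>lborel)
     \<le> (\<integral>\<^sup>+x. (\<integral>\<^sup>+y. ennreal (norm (g x)) * ennreal (norm (h y)) \<partial>lborel) \<partial>lborel)"
    using bound by (intro nn_integral_mono_AE) (auto elim!: eventually_mono intro!: nn_integral_mono simp: ennreal_mult'[symmetric] ennreal_leI)
  also have "\<dots> = (\<integral>\<^sup>+x. ennreal (norm (g x)) \<partial>lborel) * (\<integral>\<^sup>+y. ennreal (norm (h y)) \<partial>lborel)"
    by (simp add: nn_integral_cmult nn_integral_multc)
  also have "\<dots> < \<infinity>" using g h by (simp add: integrable_iff_bounded ennreal_mult_less_top)
  finally show "(\<integral>\<^sup>+x. (\<integral>\<^sup>+y. ennreal (norm (f x y)) \<partial>lborel) \<partial>lborel) < \<infinity>" .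
qed measurable

lemma cis_measurable[measurable]: "cis \<in> borel_measurable borel"
  by (intro borel_measurable_continuous_onI continuous_intros)

lemma exp_neg_eq_cis: "exp (- 2 * pi * \<i> * complex_of_real y) = cis (- (2 * pi) * y)"
  by (simp add: cis_conv_exp algebra_simps)

lemma exp_pos_eq_cis: "exp (2 * pi * \<i> * complex_of_real y) = cis (2 * pi * y)"
  by (simp add: cis_conv_exp algebra_simps)

lemma fourier_cis: "fourier \<phi> \<xi> = (LBINT x. \<phi> x * cis (- (2 * pi) * (\<xi> \<bullet> x)))"
  unfolding fourier_def exp_neg_eq_cis ..

lemma inv_fourier_cis: "inv_fourier \<phi> x = (LBINT \<xi>. \<phi> \<xi> * cis (2 * pi * (x \<bullet> \<xi>)))"
  unfolding inv_fourier_def exp_pos_eq_cis by (simp add: inner_commute)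

lemma inv_fourier_eq_fourier: "inv_fourier \<phi> x = fourier \<phi> (- x)"
  unfolding fourier_cis inv_fourier_cis by simp

lemma integrable_cis_mult:
  fixes \<phi> :: "'a::euclidean_space \<Rightarrow> complex"
  assumes "integrable lborel \<phi>"
  shows "integrable lborel (\<lambda>x. \<phi> x * cis (c * (\<xi> \<bullet> x)))"
  by (rule Bochner_Integration.integrable_bound[OF assms])
     (use borel_measurable_integrable[OF assms] in \<open>auto simp: norm_mult\<close>)

lemma fourier_has_derivative:
  fixes \<phi> :: "real^'n::finite \<Rightarrow> complex"
  assumes \<phi>: "\<phi> \<in> schwartz"
  shows "(fourier \<phi> has_derivative (\<lambda>h. \<Sum>i\<in>UNIV. (h $ i) *\<^sub>R fourier (\<lambda>x. - (2 * pi * \<i>) * (complex_of_real (x $ i) * \<phi> x)) \<xi>)) (at \<xi>)"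
  unfolding fourier_cis
proof (rule has_derivative_integral_quadratic[where B = "\<lambda>x. (2 * pi)\<^sup>2 * ((1 + norm x)^2 * norm (\<phi> x))"])
  show "integrable lborel (\<lambda>x. \<phi> x * cis (- (2 * pi) * (y \<bullet> x)))" for y
    by (intro integrable_cis_mult schwartz_integrable \<phi>)
  show "integrable lborel (\<lambda>x. - (2 * pi * \<i>) * (complex_of_real (x $ i) * \<phi> x) * cis (- (2 * pi) * (\<xi> \<bullet> x)))" for i
    by (intro integrable_cis_mult schwartz_integrable schwartz_cmult schwartz_coord_mult \<phi>)
  show "integrable lborel (\<lambda>x. (2 * pi)\<^sup>2 * ((1 + norm x)^2 * norm (\<phi> x)))"
    by (intro integrable_mult_right schwartz_integrable_power \<phi>)
  fix h x :: "real^'n"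
  \<comment> \<open>The change of phase caused by \<open>h\<close>. The second-order remainder of
    exp(i r) is at most r^2 / 2, which has the quadratic form required.\<close>
  define r where "r = - (2 * pi) * (h \<bullet> x)"
  have "\<phi> x * cis (- (2 * pi) * ((\<xi> + h) \<bullet> x)) - \<phi> x * cis (- (2 * pi) * (\<xi> \<bullet> x)) -
          (\<Sum>i\<in>UNIV. (h $ i) *\<^sub>R (- (2 * pi * \<i>) * (complex_of_real (x $ i) * \<phi> x) * cis (- (2 * pi) * (\<xi> \<bullet> x))))
     = (\<phi> x * cis (- (2 * pi) * (\<xi> \<bullet> x))) * (cis r - (1 + \<i> * complex_of_real r))"
  proof -
    have "cis (- (2 * pi) * ((\<xi> + h) \<bullet> x)) = cis (- (2 * pi) * (\<xi> \<bullet> x)) * cis r"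
      by (simp add: cis_mult r_def inner_add_left algebra_simps)
    moreover have "(\<Sum>i\<in>UNIV. (h $ i) *\<^sub>R (- (2 * pi * \<i>) * (complex_of_real (x $ i) * \<phi> x) * cis (- (2 * pi) * (\<xi> \<bullet> x))))
      = (\<Sum>i\<in>UNIV. complex_of_real (h $ i * x $ i)) * (- (2 * pi * \<i>) * (\<phi> x * cis (- (2 * pi) * (\<xi> \<bullet> x))))"
      unfolding sum_distrib_right by (intro sum.cong refl) (simp add: scaleR_conv_of_real)
    moreover have "(\<Sum>i\<in>UNIV. complex_of_real (h $ i * x $ i)) = complex_of_real (h \<bullet> x)"
      by (simp add: inner_vec_def)
    ultimately show ?thesis by (simp add: r_def algebra_simps)
  qed
  also have "norm \<dots> = norm (\<phi> x) * norm (cis r - (1 + \<i> * complex_of_real r))"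
    by (simp add: norm_mult)
  also have "\<dots> \<le> norm (\<phi> x) * (r\<^sup>2 / 2)"
    using iexp_approx1[of r 1] by (intro mult_left_mono) (auto simp: cis_conv_exp power2_eq_square)
  also have "\<dots> \<le> norm (\<phi> x) * ((norm h)\<^sup>2 * ((2 * pi)\<^sup>2 * (1 + norm x)\<^sup>2))"
  proof (intro mult_left_mono)
    have "\<bar>h \<bullet> x\<bar> \<le> norm h * (1 + norm x)"
      using Cauchy_Schwarz_ineq2[of h x] by (simp add: algebra_simps add_increasing)
    then have "\<bar>r\<bar> \<le> 2 * pi * (norm h * (1 + norm x))"
      by (simp add: r_def abs_mult mult_left_mono)
    then have 1: "\<bar>r\<bar>\<^sup>2 \<le> (2 * pi * (norm h * (1 + norm x)))\<^sup>2" by (intro power_mono) auto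
    have "r\<^sup>2 / 2 \<le> \<bar>r\<bar>\<^sup>2" by simp
    also note 1
    also have "(2 * pi * (norm h * (1 + norm x)))\<^sup>2 = (norm h)\<^sup>2 * ((2 * pi)\<^sup>2 * (1 + norm x)\<^sup>2)"
      by (simp only: power_mult_distrib mult_ac)
    finally show "r\<^sup>2 / 2 \<le> (norm h)\<^sup>2 * ((2 * pi)\<^sup>2 * (1 + norm x)\<^sup>2)" .
  qed simp
  finally show "norm (\<phi> x * cis (- (2 * pi) * ((\<xi> + h) \<bullet> x)) - \<phi> x * cis (- (2 * pi) * (\<xi> \<bullet> x)) -
          (\<Sum>i\<in>UNIV. (h $ i) *\<^sub>R (- (2 * pi * \<i>) * (complex_of_real (x $ i) * \<phi> x) * cis (- (2 * pi) * (\<xi> \<bullet> x)))))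
     \<le> (norm h)\<^sup>2 * ((2 * pi)\<^sup>2 * ((1 + norm x)^2 * norm (\<phi> x)))" by (simp add: mult_ac)
qed

text \<open>Integration by parts: the modulated function \<psi> = e \<phi> is Schwartz, so its
  partial derivative has integral zero, and the product rule does the rest.\<close>

lemma fourier_partial_deriv:
  fixes \<phi> :: "real^'n::finite \<Rightarrow> complex"
  assumes \<phi>: "\<phi> \<in> schwartz"
  shows "fourier (partial_deriv i \<phi>) \<xi> = 2 * pi * \<i> * complex_of_real (\<xi> $ i) * fourier \<phi> \<xi>"
proof -
  define e where "e x = cis ((- (2 * pi) *\<^sub>R \<xi>) \<bullet> x)" for x
  define \<psi> where "\<psi> x = e x * \<phi> x" for x
  have \<psi>: "\<psi> \<in> schwartz" unfolding \<psi>_def e_def by (rule schwartz_cis_mult[OF \<phi>])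
  have e: "(e has_derivative (\<lambda>h. ((- (2 * pi) *\<^sub>R \<xi>) \<bullet> h) *\<^sub>R (\<i> * e x))) (at x)" for x
    unfolding e_def by (auto intro!: derivative_eq_intros)
  have "partial_deriv i \<psi> = (\<lambda>x. e x * partial_deriv i \<phi> x - 2 * pi * \<i> * complex_of_real (\<xi> $ i) * \<psi> x)"
    unfolding \<psi>_def by (subst partial_deriv_eqI[OF has_derivative_mult[OF e schwartz_has_derivative[OF \<phi>]]])
      (simp add: sum_axis_scaleR inner_axis, simp add: scaleR_conv_of_real algebra_simps)
  then have "0 = (LBINT x. e x * partial_deriv i \<phi> x - 2 * pi * \<i> * complex_of_real (\<xi> $ i) * \<psi> x)"
    using schwartz_integral_partial_deriv[OF \<psi>, of i] by simp
  also have "\<dots> = (LBINT x. e x * partial_deriv i \<phi> x) - 2 * pi * \<i> * complex_of_real (\<xi> $ i) * (LBINT x. \<psi> x)"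
  proof -
    have "integrable lborel (\<lambda>x. e x * partial_deriv i \<phi> x)"
      unfolding e_def by (intro schwartz_integrable schwartz_cis_mult schwartz_partial_deriv \<phi>)
    then show ?thesis using schwartz_integrable[OF \<psi>] by simp
  qed
  also have "(LBINT x. e x * partial_deriv i \<phi> x) = fourier (partial_deriv i \<phi>) \<xi>"
    by (simp add: fourier_cis e_def mult.commute)
  also have "(LBINT x. \<psi> x) = fourier \<phi> \<xi>"
    by (simp add: fourier_cis \<psi>_def e_def mult.commute)
  finally show ?thesis by simp
qed

lemma norm_fourier_le: "norm (fourier \<phi> \<xi>) \<le> (LBINT x. norm (\<phi> x))"
  unfolding fourier_cis by (rule order_trans[OF integral_norm_bound]) (simp add: norm_mult)

text \<open>Each further factor |\<xi>| is bounded by the sum of the |\<xi>_i|, and each of these is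
  absorbed by passing to a partial derivative of \<phi>; hence the induction over arbitrary
  \<phi>.\<close>

lemma fourier_decay:
  fixes \<phi> :: "real^'n::finite \<Rightarrow> complex"
  assumes "\<phi> \<in> schwartz"
  shows "\<exists>C. \<forall>\<xi>. (1 + norm \<xi>) ^ N * norm (fourier \<phi> \<xi>) \<le> C"
  using assms
proof (induction N arbitrary: \<phi>)
  case 0 then show ?case using norm_fourier_le[of \<phi>] by auto
next
  case (Suc N)
  obtain C where C: "\<And>\<xi>. (1 + norm \<xi>) ^ N * norm (fourier \<phi> \<xi>) \<le> C" using Suc by blast
  have "\<exists>D. \<forall>\<xi>. (1 + norm \<xi>) ^ N * norm (fourier (partial_deriv i \<phi>) \<xi>) \<le> D" for i
    by (intro Suc.IH schwartz_partial_deriv Suc.prems)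
  then obtain D where D: "\<And>i \<xi>. (1 + norm \<xi>) ^ N * norm (fourier (partial_deriv i \<phi>) \<xi>) \<le> D i" by metis
  have "(1 + norm \<xi>) ^ Suc N * norm (fourier \<phi> \<xi>) \<le> C + (\<Sum>i\<in>UNIV. D i)" for \<xi>
  proof -
    have "norm \<xi> * ((1 + norm \<xi>) ^ N * norm (fourier \<phi> \<xi>)) \<le> (\<Sum>i\<in>UNIV. \<bar>\<xi> $ i\<bar>) * ((1 + norm \<xi>) ^ N * norm (fourier \<phi> \<xi>))"
      by (intro mult_right_mono norm_le_l1_cart) auto
    also have "\<dots> = (\<Sum>i\<in>UNIV. (1 + norm \<xi>) ^ N * (\<bar>\<xi> $ i\<bar> * norm (fourier \<phi> \<xi>)))"
      unfolding sum_distrib_right by (intro sum.cong refl) (simp add: mult_ac)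
    also have "\<dots> \<le> (\<Sum>i\<in>UNIV. D i)"
    proof (rule sum_mono)
      fix i
      have "\<bar>\<xi> $ i\<bar> * norm (fourier \<phi> \<xi>) \<le> norm (fourier (partial_deriv i \<phi>) \<xi>)"
        using pi_gt3 by (simp add: fourier_partial_deriv[OF Suc.prems] norm_mult mult_right_mono mult_le_cancel_right1)
      then have "(1 + norm \<xi>) ^ N * (\<bar>\<xi> $ i\<bar> * norm (fourier \<phi> \<xi>)) \<le> (1 + norm \<xi>) ^ N * norm (fourier (partial_deriv i \<phi>) \<xi>)"
        by (intro mult_left_mono) auto
      then show "(1 + norm \<xi>) ^ N * (\<bar>\<xi> $ i\<bar> * norm (fourier \<phi> \<xi>)) \<le> D i" using D[of \<xi> i] by linarith
    qed
    finally show ?thesis using C[of \<xi>] by (simp add: algebra_simps)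
  qed
  then show ?case by blast
qed

lemma schwartz_fourier:
  fixes \<phi> :: "real^'n::finite \<Rightarrow> complex"
  assumes \<phi>: "\<phi> \<in> schwartz"
  shows "fourier \<phi> \<in> schwartz"
proof -
  let ?A = "{fourier \<phi> | \<phi> :: real^'n \<Rightarrow> complex. \<phi> \<in> schwartz}"
  have "?A \<subseteq> schwartz"
  proof (rule schwartz_coinduct)
    fix f :: "real^'n \<Rightarrow> complex" and x and i
    assume "f \<in> ?A"
    then obtain \<phi> :: "real^'n \<Rightarrow> complex" where f: "f = fourier \<phi>" and s: "\<phi> \<in> schwartz" by auto
    note d = fourier_has_derivative[OF s]
    show "f differentiable (at x)" unfolding f differentiable_def using d by blast
    define q where "q = (\<lambda>x. - (2 * pi * \<i>) * (complex_of_real (x $ i) * \<phi> x))"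
    have "partial_deriv i f = fourier q"
      unfolding f q_def by (subst partial_deriv_eqI[OF d]) (simp add: sum_axis_scaleR)
    moreover have "q \<in> schwartz" unfolding q_def by (intro schwartz_cmult schwartz_coord_mult s)
    ultimately show "partial_deriv i f \<in> ?A" by blast
  next
    fix f :: "real^'n \<Rightarrow> complex" and N
    assume "f \<in> ?A"
    then show "\<exists>C. \<forall>x. (1 + norm x) ^ N * norm (f x) \<le> C" using fourier_decay by blast
  qed
  then show ?thesis using \<phi> by blast
qed

lemma schwartz_uminus: "\<phi> \<in> schwartz \<Longrightarrow> (\<lambda>x. \<phi> (- x)) \<in> schwartz"
  using schwartz_affine[of "\<lambda>x. - x" \<phi> 0] by (simp add: linear_iff)

lemma schwartz_inv_fourier: "\<phi> \<in> schwartz \<Longrightarrow> inv_fourier \<phi> \<in> schwartz"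
  using schwartz_uminus[OF schwartz_fourier] by (simp add: inv_fourier_eq_fourier[abs_def])

text \<open>Damping the frequencies beyond \<open>1 / s\<close> by a Gaussian averages \<open>\<phi>\<close> over a Gaussian of width \<open>s\<close>.\<close>

lemma inv_fourier_fourier:
  fixes \<phi> :: "real^'n::finite \<Rightarrow> complex"
  assumes \<phi>: "\<phi> \<in> schwartz"
  shows "inv_fourier (fourier \<phi>) = \<phi>"
proof
  fix y
  let ?n = "real CARD('n)"
  note [measurable] = schwartz_measurable[OF \<phi>] schwartz_measurable[OF schwartz_fourier[OF \<phi>]]
  \<comment> \<open>With this exponent the transform of the damping factor is a multiple of exp(-|x
    - y|^2 / s^2), a Gaussian of width exactly \<open>s\<close>.\<close>
  define g where "g s \<xi> = exp (- (pi * s)\<^sup>2 * (norm \<xi>)\<^sup>2)" for s and \<xi> :: "real^'n"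
  have gm[measurable]: "g s \<in> borel_measurable borel" for s unfolding g_def by measurable
  define I where "I s = (LBINT \<xi>. fourier \<phi> \<xi> * cis (2 * pi * (y \<bullet> \<xi>)) * complex_of_real (g s \<xi>))" for s
  have I: "I s = complex_of_real (pi powr (- (?n / 2))) * (LBINT z. \<phi> (y + s *\<^sub>R z) * complex_of_real (exp (- 1 * (norm z)\<^sup>2)))"
    if s: "s > 0" for s
  proof -
    have gi: "integrable lborel (g s)"
      unfolding g_def by (rule integrable_gaussian) (use s in auto)
    have "I s = (LBINT \<xi>. LBINT x. \<phi> x * cis (2 * pi * ((y - x) \<bullet> \<xi>)) * complex_of_real (g s \<xi>))"
    proof -
      have *: "fourier \<phi> \<xi> * cis (2 * pi * (y \<bullet> \<xi>)) * complex_of_real (g s \<xi>) = (LBINT x. \<phi> x * cis (2 * pi * ((y - x) \<bullet> \<xi>)) * complex_of_real (g s \<xi>))" for \<xi>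
      proof -
        have "fourier \<phi> \<xi> * cis (2 * pi * (y \<bullet> \<xi>)) * complex_of_real (g s \<xi>)
          = (LBINT x. (\<phi> x * cis (- (2 * pi) * (\<xi> \<bullet> x))) * (cis (2 * pi * (y \<bullet> \<xi>)) * complex_of_real (g s \<xi>)))"
          unfolding fourier_cis by (simp add: mult.assoc[symmetric])
        also have "\<dots> = (LBINT x. \<phi> x * cis (2 * pi * ((y - x) \<bullet> \<xi>)) * complex_of_real (g s \<xi>))"
        proof (intro Bochner_Integration.integral_cong refl)
          fix x
          have "cis (- (2 * pi) * (\<xi> \<bullet> x)) * cis (2 * pi * (y \<bullet> \<xi>)) = cis (2 * pi * ((y - x) \<bullet> \<xi>))"
            by (simp add: cis_mult inner_diff_left inner_commute algebra_simps)
          then show "(\<phi> x * cis (- (2 * pi) * (\<xi> \<bullet> x))) * (cis (2 * pi * (y \<bullet> \<xi>)) * complex_of_real (g s \<xi>))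
             = \<phi> x * cis (2 * pi * ((y - x) \<bullet> \<xi>)) * complex_of_real (g s \<xi>)" by (simp add: mult_ac)
        qed
        finally show ?thesis .
      qed
      show ?thesis unfolding I_def by (simp only: *)
    qed
    also have "\<dots> = (LBINT x. LBINT \<xi>. \<phi> x * cis (2 * pi * ((y - x) \<bullet> \<xi>)) * complex_of_real (g s \<xi>))"
      by (rule lborel_pair.Fubini_integral, rule lborel_pair_integrable_bound[OF _ schwartz_integrable[OF \<phi>] gi])
         (auto simp: norm_mult)
    also have "\<dots> = (LBINT x. \<phi> x * complex_of_real ((1 / (pi * s\<^sup>2)) powr (?n / 2) * exp (- (1 / s\<^sup>2) * (norm (x - y))\<^sup>2)))"
    proof (intro Bochner_Integration.integral_cong refl)
      fix x
      have "(LBINT \<xi>. \<phi> x * cis (2 * pi * ((y - x) \<bullet> \<xi>)) * complex_of_real (g s \<xi>))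
        = \<phi> x * (LBINT \<xi>. complex_of_real (g s \<xi>) * cis (\<xi> \<bullet> ((2 * pi) *\<^sub>R (y - x))))"
        by (subst integral_mult_right_zero[symmetric]) (simp add: mult_ac inner_commute)
      also have "(LBINT \<xi>. complex_of_real (g s \<xi>) * cis (\<xi> \<bullet> ((2 * pi) *\<^sub>R (y - x))))
        = complex_of_real ((pi / (pi * s)\<^sup>2) powr (?n / 2) * exp (- (norm ((2 * pi) *\<^sub>R (y - x)))\<^sup>2 / (4 * (pi * s)\<^sup>2)))"
        unfolding g_def using s by (subst integral_gaussian_cis) auto
      also have "pi / (pi * s)\<^sup>2 = 1 / (pi * s\<^sup>2)" by (simp add: power_mult_distrib power2_eq_square)
      also have "- (norm ((2 * pi) *\<^sub>R (y - x)))\<^sup>2 / (4 * (pi * s)\<^sup>2) = - (1 / s\<^sup>2) * (norm (x - y))\<^sup>2"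
        using s by (simp add: power_mult_distrib norm_minus_commute)
      finally show "(LBINT \<xi>. \<phi> x * cis (2 * pi * ((y - x) \<bullet> \<xi>)) * complex_of_real (g s \<xi>)) =
         \<phi> x * complex_of_real ((1 / (pi * s\<^sup>2)) powr (?n / 2) * exp (- (1 / s\<^sup>2) * (norm (x - y))\<^sup>2))" .
    qed
    \<comment> \<open>The substitution x = y + s z frees the Gaussian from \<open>s\<close>, leaving
      \<open>s\<close> only in the argument of \<phi>, where continuity gives the limit.\<close>
    also have "\<dots> = complex_of_real (s ^ CARD('n)) * (LBINT z. \<phi> (y + s *\<^sub>R z) * complex_of_real ((1 / (pi * s\<^sup>2)) powr (?n / 2) * exp (- (1 / s\<^sup>2) * (norm (y + s *\<^sub>R z - y))\<^sup>2)))"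
      using s by (subst integral_affine) (auto simp: scaleR_conv_of_real)
    also have "\<dots> = complex_of_real (pi powr (- (?n / 2))) * (LBINT z. \<phi> (y + s *\<^sub>R z) * complex_of_real (exp (- 1 * (norm z)\<^sup>2)))"
    proof -
      have c: "s ^ CARD('n) * (1 / (pi * s\<^sup>2)) powr (?n / 2) = pi powr (- (?n / 2))"
      proof -
        have "(1 / (pi * s\<^sup>2)) powr (?n / 2) = (pi powr (- 1) * s powr (- 2)) powr (?n / 2)"
          using s by (simp add: powr_minus field_simps)
        also have "\<dots> = pi powr (- (?n / 2)) * s powr (- ?n)"
          using s by (simp only: powr_mult powr_powr) simp
        finally show ?thesis using s by (simp add: powr_minus powr_realpow)
      qed
      have e: "exp (- (1 / s\<^sup>2) * (norm (y + s *\<^sub>R z - y))\<^sup>2) = exp (- 1 * (norm z)\<^sup>2)" for z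
        using s by (simp add: power_mult_distrib)
      have "(LBINT z. \<phi> (y + s *\<^sub>R z) * complex_of_real ((1 / (pi * s\<^sup>2)) powr (?n / 2) * exp (- 1 * (norm z)\<^sup>2)))
        = complex_of_real ((1 / (pi * s\<^sup>2)) powr (?n / 2)) * (LBINT z. \<phi> (y + s *\<^sub>R z) * complex_of_real (exp (- 1 * (norm z)\<^sup>2)))"
        by (subst integral_mult_right_zero[symmetric]) (simp add: mult_ac)
      then show ?thesis unfolding e c[symmetric] by (simp only: of_real_mult mult.assoc)
    qed
    finally show ?thesis .
  qed
  define s where "s j = 1 / real (Suc j)" for j
  have s: "s j > 0" "s \<longlonglongrightarrow> 0" for j
    using LIMSEQ_inverse_real_of_nat unfolding s_def by (simp_all only: inverse_eq_divide) simp
  have "(\<lambda>j. I (s j)) \<longlonglongrightarrow> (LBINT \<xi>. fourier \<phi> \<xi> * cis (2 * pi * (y \<bullet> \<xi>)))"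
    unfolding I_def
  proof (rule integral_dominated_convergence[where w = "\<lambda>\<xi>. norm (fourier \<phi> \<xi>)"])
    show "integrable lborel (\<lambda>\<xi>. norm (fourier \<phi> \<xi>))"
      by (intro integrable_norm schwartz_integrable schwartz_fourier \<phi>)
    show "AE \<xi> in lborel. (\<lambda>j. fourier \<phi> \<xi> * cis (2 * pi * (y \<bullet> \<xi>)) * complex_of_real (g (s j) \<xi>)) \<longlonglongrightarrow> fourier \<phi> \<xi> * cis (2 * pi * (y \<bullet> \<xi>))"
      unfolding g_def by (auto intro!: AE_I2 tendsto_eq_intros s(2))
    show "AE \<xi> in lborel. norm (fourier \<phi> \<xi> * cis (2 * pi * (y \<bullet> \<xi>)) * complex_of_real (g (s j) \<xi>)) \<le> norm (fourier \<phi> \<xi>)" for j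
      by (intro AE_I2) (simp add: norm_mult g_def mult_left_le)
  qed measurable
  then have 1: "(\<lambda>j. I (s j)) \<longlonglongrightarrow> inv_fourier (fourier \<phi>) y" by (simp add: inv_fourier_cis)
  obtain C where C: "C \<ge> 0" "\<And>x. (1 + norm x) ^ 0 * norm (\<phi> x) \<le> C" by (rule schwartz_decay[OF \<phi>]) blast
  have "(\<lambda>j. (LBINT z. \<phi> (y + s j *\<^sub>R z) * complex_of_real (exp (- 1 * (norm z)\<^sup>2)))) \<longlonglongrightarrow> (LBINT z. \<phi> y * complex_of_real (exp (- 1 * (norm (z::real^'n))\<^sup>2)))"
  proof (rule integral_dominated_convergence[where w = "\<lambda>z::real^'n. C * exp (- 1 * (norm z)\<^sup>2)"])
    show "integrable lborel (\<lambda>z::real^'n. C * exp (- 1 * (norm z)\<^sup>2))"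
      by (intro integrable_mult_right integrable_gaussian) auto
    have cont: "(\<lambda>j. \<phi> (y + s j *\<^sub>R z)) \<longlonglongrightarrow> \<phi> y" for z
    proof (rule continuous_on_tendsto_compose[OF schwartz_continuous[OF \<phi>, of UNIV]])
      show "(\<lambda>j. y + s j *\<^sub>R z) \<longlonglongrightarrow> y" by (auto intro!: tendsto_eq_intros s(2))
    qed auto
    show "AE z in lborel. (\<lambda>j. \<phi> (y + s j *\<^sub>R z) * complex_of_real (exp (- 1 * (norm z)\<^sup>2))) \<longlonglongrightarrow> \<phi> y * complex_of_real (exp (- 1 * (norm z)\<^sup>2))"
      by (intro AE_I2 tendsto_mult cont tendsto_const)
    show "AE z in lborel. norm (\<phi> (y + s j *\<^sub>R z) * complex_of_real (exp (- 1 * (norm z)\<^sup>2))) \<le> C * exp (- 1 * (norm z)\<^sup>2)" for j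
      using C by (auto simp: norm_mult)
  qed measurable
  also have "(LBINT z. \<phi> y * complex_of_real (exp (- 1 * (norm (z::real^'n))\<^sup>2))) = \<phi> y * complex_of_real (pi powr (?n / 2))"
    using integral_gaussian[of 1, where 'a = "real^'n"] by simp
  finally have "(\<lambda>j. complex_of_real (pi powr (- (?n / 2))) * (LBINT z. \<phi> (y + s j *\<^sub>R z) * complex_of_real (exp (- 1 * (norm z)\<^sup>2)))) \<longlonglongrightarrow>
     complex_of_real (pi powr (- (?n / 2))) * (\<phi> y * complex_of_real (pi powr (?n / 2)))"
    by (rule tendsto_mult[OF tendsto_const])
  also have "complex_of_real (pi powr (- (?n / 2))) * (\<phi> y * complex_of_real (pi powr (?n / 2))) = \<phi> y"
    by (simp add: powr_minus)
  finally have "(\<lambda>j. I (s j)) \<longlonglongrightarrow> \<phi> y" unfolding I[OF s(1)] .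
  then show "inv_fourier (fourier \<phi>) y = \<phi> y" using 1 LIMSEQ_unique by blast
qed

text \<open>The two transforms differ by a reflection, so substituting -x turns one composition into
  the other.\<close>

lemma fourier_inv_fourier:
  fixes \<phi> :: "real^'n::finite \<Rightarrow> complex"
  assumes \<phi>: "\<phi> \<in> schwartz"
  shows "fourier (inv_fourier \<phi>) = \<phi>"
proof
  fix y
  note [measurable] = schwartz_measurable[OF schwartz_inv_fourier[OF \<phi>]]
  have "fourier (inv_fourier \<phi>) y = (LBINT x. inv_fourier \<phi> (0 + (- 1) *\<^sub>R x) * cis (- (2 * pi) * (y \<bullet> (0 + (- 1) *\<^sub>R x))))"
    unfolding fourier_cis by (subst integral_affine) auto
  also have "\<dots> = inv_fourier (fourier \<phi>) y"
    by (simp add: inv_fourier_cis[of "fourier \<phi>"] inv_fourier_eq_fourier[of \<phi>])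
  finally show "fourier (inv_fourier \<phi>) y = \<phi> y" by (simp add: inv_fourier_fourier[OF \<phi>])
qed

text \<open>Modulation becomes translation: the transform is a positive Gaussian centred at
  \<open>a\<close>, which makes modulated Gaussians the right tests for positivity on the Fourier
  side.\<close>

lemma fourier_gaussian_cis:
  fixes a y :: "real^'n::finite"
  assumes "c > 0"
  shows "fourier (\<lambda>\<xi>. complex_of_real (exp (- c * (norm \<xi>)\<^sup>2)) * cis (2 * pi * (a \<bullet> \<xi>))) y
     = complex_of_real ((pi / c) powr (CARD('n) / 2) * exp (- (pi\<^sup>2 / c) * (norm (y - a))\<^sup>2))"
proof -
  have "fourier (\<lambda>\<xi>. complex_of_real (exp (- c * (norm \<xi>)\<^sup>2)) * cis (2 * pi * (a \<bullet> \<xi>))) y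
    = (LBINT \<xi>. complex_of_real (exp (- c * (norm \<xi>)\<^sup>2)) * cis (\<xi> \<bullet> ((2 * pi) *\<^sub>R (a - y))))"
    unfolding fourier_cis
  proof (intro Bochner_Integration.integral_cong refl)
    fix \<xi> :: "real^'n"
    have "cis (2 * pi * (a \<bullet> \<xi>)) * cis (- (2 * pi) * (y \<bullet> \<xi>)) = cis (\<xi> \<bullet> ((2 * pi) *\<^sub>R (a - y)))"
      by (simp add: cis_mult inner_diff_right inner_commute algebra_simps)
    then show "complex_of_real (exp (- c * (norm \<xi>)\<^sup>2)) * cis (2 * pi * (a \<bullet> \<xi>)) * cis (- (2 * pi) * (y \<bullet> \<xi>))
      = complex_of_real (exp (- c * (norm \<xi>)\<^sup>2)) * cis (\<xi> \<bullet> ((2 * pi) *\<^sub>R (a - y)))" by (simp add: mult.assoc)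
  qed
  also have "\<dots> = complex_of_real ((pi / c) powr (CARD('n) / 2) * exp (- (norm ((2 * pi) *\<^sub>R (a - y)))\<^sup>2 / (4 * c)))"
    using assms by (subst integral_gaussian_cis) auto
  also have "- (norm ((2 * pi) *\<^sub>R (a - y)))\<^sup>2 / (4 * c) = - (pi\<^sup>2 / c) * (norm (y - a))\<^sup>2"
    by (simp add: power_mult_distrib norm_minus_commute)
  finally show ?thesis .
qed

lemma schwartz_gaussian_cis:
  assumes "c > 0"
  shows "(\<lambda>\<xi>. complex_of_real (exp (- c * (norm \<xi>)\<^sup>2)) * cis (2 * pi * (a \<bullet> \<xi>))) \<in> schwartz"
  using schwartz_cis_mult[OF schwartz_gaussian[OF assms], of "(2 * pi) *\<^sub>R a"] by (simp add: mult.commute)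

lemma fourier_comp_scale:
  fixes \<phi> :: "real^'n::finite \<Rightarrow> complex"
  assumes r: "r > 0" and [measurable]: "\<phi> \<in> borel_measurable borel"
  shows "fourier (\<lambda>x. \<phi> (r *\<^sub>R x)) \<xi> = fourier \<phi> (\<xi> /\<^sub>R r) / complex_of_real (r ^ CARD('n))"
proof -
  have "fourier (\<lambda>x. \<phi> (r *\<^sub>R x)) \<xi> = (LBINT x. \<phi> (0 + r *\<^sub>R x) * cis (- (2 * pi) * ((\<xi> /\<^sub>R r) \<bullet> (0 + r *\<^sub>R x))))"
    unfolding fourier_cis using r by (simp add: field_simps)
  also have "\<dots> = (1 / r ^ CARD('n)) *\<^sub>R fourier \<phi> (\<xi> /\<^sub>R r)"
    unfolding fourier_cis using r by (subst integral_affine) auto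
  finally show ?thesis by (simp add: scaleR_conv_of_real)
qed

lemma fourier_comp_orthogonal:
  fixes \<phi> :: "real^'n::finite \<Rightarrow> complex" and R :: "real^'n \<Rightarrow> real^'n"
  assumes R: "orthogonal_transformation R" and [measurable]: "\<phi> \<in> borel_measurable borel"
  shows "fourier (\<phi> \<circ> R) \<xi> = fourier \<phi> (R \<xi>)"
proof -
  have "fourier (\<phi> \<circ> R) \<xi> = (LBINT x. \<phi> (R x) * cis (- (2 * pi) * (R \<xi> \<bullet> R x)))"
    unfolding fourier_cis using R by (simp add: orthogonal_transformation_def)
  also have "\<dots> = fourier \<phi> (R \<xi>)"
    unfolding fourier_cis by (rule integral_orthogonal[OF R, of "\<lambda>x. \<phi> x * cis (- (2 * pi) * (R \<xi> \<bullet> x))"]) measurable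
  finally show ?thesis .
qed

section \<open>Schwartz functions separate locally integrable functions\<close>

text \<open>The indicator of a box is approximated by Schwartz functions, namely its averages over
  Gaussians of width \<open>s\<close>, which are bounded by the Gaussian mass and converge off the
  boundary.\<close>

lemma box_integral_eq_0:
  fixes F :: "real^'n::finite \<Rightarrow> complex"
  assumes F: "integrable lborel F" and zero: "\<And>\<psi>. \<psi> \<in> schwartz \<Longrightarrow> (LBINT x. F x * \<psi> x) = 0"
  shows "(LBINT x:box l u. F x) = 0"
proof -
  have [measurable]: "F \<in> borel_measurable borel" using F by auto
  define \<psi> where "\<psi> s x = (LBINT w. indicator (box l u) (x + s *\<^sub>R w) * complex_of_real (exp (- 1 * (norm w)\<^sup>2)))" for s x
  have S: "\<psi> s \<in> schwartz" if s: "s > 0" for s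
  proof -
    define G where "G y = complex_of_real (exp (- (1 / s\<^sup>2) * (norm y)\<^sup>2))" for y :: "real^'n"
    have G: "G \<in> schwartz" unfolding G_def by (rule schwartz_gaussian) (use s in auto)
    have [measurable]: "G \<in> borel_measurable borel" by (rule schwartz_measurable[OF G])
    \<comment> \<open>Up to reflection and scaling \<psi> is the correlation of the indicator with a
      Gaussian; the box is bounded, so the indicator has all moments.\<close>
    have "(\<lambda>x. LBINT z. indicator (box l u) z * G (z + x)) \<in> schwartz"
    proof (rule schwartz_correlation[OF _ _ G])
      fix N
      obtain B where B: "\<And>x. x \<in> box l u \<Longrightarrow> norm x \<le> B" using bounded_box[of l u] by (auto simp: bounded_iff)
      show "integrable lborel (\<lambda>z. (1 + norm z) ^ N * norm (indicator (box l u) z :: complex))"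
      proof (rule Bochner_Integration.integrable_bound)
        show "integrable lborel (\<lambda>z. (1 + \<bar>B\<bar>) ^ N * indicator (box l u) z :: real)"
          by (intro integrable_mult_right integrable_real_indicator) (use emeasure_lborel_box_finite[of l u] in auto)
        show "AE z in lborel. norm ((1 + norm z) ^ N * norm (indicator (box l u) z :: complex)) \<le> norm ((1 + \<bar>B\<bar>) ^ N * indicator (box l u) z :: real)"
        proof (rule AE_I2)
          fix z
          have "(1 + norm z) ^ N \<le> (1 + \<bar>B\<bar>) ^ N" if "z \<in> box l u"
            using B[OF that] by (intro power_mono) auto
          then show "norm ((1 + norm z) ^ N * norm (indicator (box l u) z :: complex)) \<le> norm ((1 + \<bar>B\<bar>) ^ N * indicator (box l u) z :: real)"
            by (auto simp: indicator_def)
        qed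
      qed measurable
    qed measurable
    from schwartz_cmult[OF schwartz_uminus[OF this], of "1 / complex_of_real (s ^ CARD('n))"]
    have "(\<lambda>x. (1 / complex_of_real (s ^ CARD('n))) * (LBINT z. indicator (box l u) z * G (z - x))) \<in> schwartz" by simp
    also have "(\<lambda>x. (1 / complex_of_real (s ^ CARD('n))) * (LBINT z. indicator (box l u) z * G (z - x))) = \<psi> s"
    proof
      fix x
      have "\<psi> s x = (LBINT w. indicator (box l u) (x + s *\<^sub>R w) * G ((x + s *\<^sub>R w) - x))"
        unfolding \<psi>_def G_def using s by (simp add: power_mult_distrib)
      also have "\<dots> = (1 / complex_of_real (s ^ CARD('n))) * (LBINT z. indicator (box l u) z * G (z - x))"
        using s by (subst integral_affine[where f = "\<lambda>z. indicator (box l u) z * G (z - x)"]) (auto simp: scaleR_conv_of_real)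
      finally show "(1 / complex_of_real (s ^ CARD('n))) * (LBINT z. indicator (box l u) z * G (z - x)) = \<psi> s x" by simp
    qed
    finally show ?thesis .
  qed
  define s where "s j = 1 / real (Suc j)" for j
  have s: "s j > 0" "s \<longlonglongrightarrow> 0" for j
    using LIMSEQ_inverse_real_of_nat unfolding s_def by (simp_all only: inverse_eq_divide) simp
  define c where "c = complex_of_real (pi powr (CARD('n) / 2))"
  have c: "(LBINT w. complex_of_real (exp (- 1 * (norm (w::real^'n))\<^sup>2))) = c"
    using integral_gaussian[of 1, where 'a = "real^'n"] by (simp add: c_def)
  have gi: "integrable lborel (\<lambda>w::real^'n. exp (- 1 * (norm w)\<^sup>2))" by (rule integrable_gaussian) simp
  \<comment> \<open>Off the boundary the indicator is locally constant, so for each fixed w its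
    argument eventually stays where the value is that at x; the boundary is a null set.\<close>
  have lim: "(\<lambda>j. \<psi> (s j) x) \<longlonglongrightarrow> indicator (box l u) x * c" if x: "x \<notin> cbox l u - box l u" for x
  proof -
    have "(\<lambda>j. \<psi> (s j) x) \<longlonglongrightarrow> (LBINT w. indicator (box l u) x * complex_of_real (exp (- 1 * (norm (w::real^'n))\<^sup>2)))"
      unfolding \<psi>_def
    proof (rule integral_dominated_convergence[where w = "\<lambda>w::real^'n. exp (- 1 * (norm w)\<^sup>2)"])
      fix w :: "real^'n"
      show "AE w in lborel. (\<lambda>j. indicator (box l u) (x + s j *\<^sub>R w) * complex_of_real (exp (- 1 * (norm w)\<^sup>2))) \<longlonglongrightarrow> indicator (box l u) x * complex_of_real (exp (- 1 * (norm w)\<^sup>2))"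
      proof (rule AE_I2)
        fix w :: "real^'n"
        have t: "(\<lambda>j. x + s j *\<^sub>R w) \<longlonglongrightarrow> x" by (auto intro!: tendsto_eq_intros s(2))
        have "\<forall>\<^sub>F j in sequentially. (indicator (box l u) (x + s j *\<^sub>R w) :: complex) = indicator (box l u) x"
        proof (cases "x \<in> box l u")
          case True
          have "\<forall>\<^sub>F j in sequentially. x + s j *\<^sub>R w \<in> box l u" using t True by (rule topological_tendstoD[OF _ open_box])
          then show ?thesis by eventually_elim (use True in auto)
        next
          case False
          then have "x \<in> - cbox l u" using x by auto
          moreover have "open (- cbox l u)" by (simp add: open_Compl closed_cbox)
          ultimately have "\<forall>\<^sub>F j in sequentially. x + s j *\<^sub>R w \<in> - cbox l u" using topological_tendstoD[OF t] by blast
          then show ?thesis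
          proof eventually_elim
            case (elim j)
            then have "x + s j *\<^sub>R w \<notin> box l u" using box_subset_cbox by blast
            then show ?case using False by simp
          qed
        qed
        then have "(\<lambda>j. indicator (box l u) (x + s j *\<^sub>R w) :: complex) \<longlonglongrightarrow> indicator (box l u) x"
          by (rule tendsto_eventually)
        then show "(\<lambda>j. indicator (box l u) (x + s j *\<^sub>R w) * complex_of_real (exp (- 1 * (norm w)\<^sup>2))) \<longlonglongrightarrow> indicator (box l u) x * complex_of_real (exp (- 1 * (norm w)\<^sup>2))"
          by (intro tendsto_mult tendsto_const)
      qed
    qed (use gi in \<open>auto simp: norm_mult indicator_def\<close>)
    then show ?thesis using c by simp
  qed
  have "(\<lambda>j. LBINT x. F x * \<psi> (s j) x) \<longlonglongrightarrow> (LBINT x. F x * (indicator (box l u) x * c))"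
  proof (rule integral_dominated_convergence[where w = "\<lambda>x. norm (F x) * (LBINT w. exp (- 1 * (norm (w::real^'n))\<^sup>2))"])
    show "(\<lambda>x. F x * \<psi> (s j) x) \<in> borel_measurable lborel" for j
      using schwartz_measurable[OF S[OF s(1)[of j]]] by simp
    show "integrable lborel (\<lambda>x. norm (F x) * (LBINT w. exp (- 1 * (norm (w::real^'n))\<^sup>2)))"
      by (intro integrable_mult_left integrable_norm F)
    have "AE x in lborel. x \<notin> cbox l u - box l u" by (rule AE_not_in[OF null_sets_cbox_Diff_box])
    then show "AE x in lborel. (\<lambda>j. F x * \<psi> (s j) x) \<longlonglongrightarrow> F x * (indicator (box l u) x * c)"
      by eventually_elim (intro tendsto_mult tendsto_const lim)
    have "norm (\<psi> (s j) x) \<le> (LBINT w. exp (- 1 * (norm (w::real^'n))\<^sup>2))" for j x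
      unfolding \<psi>_def
      by (rule order_trans[OF integral_norm_bound], rule integral_mono')
         (use gi in \<open>auto simp: norm_mult indicator_def\<close>)
    then show "AE x in lborel. norm (F x * \<psi> (s j) x) \<le> norm (F x) * (LBINT w. exp (- 1 * (norm (w::real^'n))\<^sup>2))" for j
      by (auto simp: norm_mult intro!: mult_left_mono)
  qed simp
  moreover have "(LBINT x. F x * \<psi> (s j) x) = 0" for j by (rule zero[OF S[OF s(1)]])
  ultimately have "(LBINT x. F x * (indicator (box l u) x * c)) = 0" by (simp add: LIMSEQ_const_iff)
  moreover have "(LBINT x. F x * (indicator (box l u) x * c)) = (LBINT x:box l u. F x) * c"
    unfolding set_lebesgue_integral_def
    by (subst integral_mult_left_zero[symmetric]) (auto intro!: Bochner_Integration.integral_cong simp: indicator_def)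
  moreover have "c \<noteq> 0" by (simp add: c_def)
  ultimately show ?thesis by simp
qed

text \<open>Boxes are stable under intersection and generate the Borel sets, and the sets over which
  \<open>F\<close> integrates to 0 form a Dynkin system, the vanishing total integral supplying
  complements. Real and imaginary parts are then densities of the zero measure.\<close>

lemma AE_eq_0_if_box_integrals:
  fixes F :: "'a::euclidean_space \<Rightarrow> complex"
  assumes F: "integrable lborel F" and box: "\<And>l u. (LBINT x:box l u. F x) = 0"
    and UNIV: "(LBINT x. F x) = 0"
  shows "AE x in lborel. F x = 0"
proof -
  let ?G = "range (\<lambda>(a, b). box a b :: 'a set)"
  have sint: "set_integrable lborel A F" if "A \<in> sets borel" for A
    unfolding set_integrable_def using integrable_mult_indicator[OF _ F, of A] that by simp
  have Z: "(LBINT x:A. F x) = 0" if "A \<in> sets borel" for A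
  proof -
    have "A \<in> sigma_sets UNIV ?G" using that by (simp add: borel_eq_box)
    then show ?thesis
    proof (rule sigma_sets_induct_disjoint[rotated 2])
      show "Int_stable ?G" by (auto simp: Int_stable_def box_Int_box)
      show "?G \<subseteq> Pow UNIV" by simp
      fix B assume "B \<in> ?G" then show "(LBINT x:B. F x) = 0" using box by auto
    next
      show "(LBINT x:{}. F x) = 0" by (simp add: set_lebesgue_integral_def)
    next
      fix B assume "B \<in> sigma_sets UNIV ?G" and B0: "(LBINT x:B. F x) = 0"
      then have B: "B \<in> sets borel" by (simp add: borel_eq_box)
      have "(LINT x:(B \<union> (UNIV - B))|lborel. F x) = (LBINT x:B. F x) + (LINT x:(UNIV - B)|lborel. F x)"
        by (rule set_integral_Un) (use B sint in auto)
      moreover have "(LINT x:(B \<union> (UNIV - B))|lborel. F x) = 0"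
        using UNIV by (simp add: set_lebesgue_integral_def Un_Diff_cancel)
      ultimately show "(LINT x:(UNIV - B)|lborel. F x) = 0" using B0 by simp
    next
      fix B :: "nat \<Rightarrow> 'a set"
      assume d: "disjoint_family B" and r: "range B \<subseteq> sigma_sets UNIV ?G" and z: "\<And>i. (LBINT x:B i. F x) = 0"
      have m: "B i \<in> sets borel" for i using r by (auto simp: borel_eq_box)
      have "(LINT x:(\<Union>i. B i)|lborel. F x) = (\<Sum>i. (LINT x:(B i)|lborel. F x))"
        by (rule lebesgue_integral_countable_add) (use m d sint in \<open>auto simp: disjoint_family_on_def\<close>)
      then show "(LINT x:(\<Union>i. B i)|lborel. F x) = 0" using z by simp
    qed
  qed
  have "AE x in lborel. Re (F x) = 0"
  proof (rule density_unique_real)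
    fix A :: "'a set" assume "A \<in> sets lborel"
    then have A: "A \<in> sets borel" by simp
    have "(LBINT x:A. Re (F x)) = Re (LBINT x:A. F x)"
      using sint[OF A] unfolding set_lebesgue_integral_def set_integrable_def
      by (subst integral_Re[symmetric]) auto
    then show "(LBINT x:A. Re (F x)) = (LBINT x:A. 0)" using Z[OF A] by simp
  qed (use F in auto)
  moreover have "AE x in lborel. Im (F x) = 0"
  proof (rule density_unique_real)
    fix A :: "'a set" assume "A \<in> sets lborel"
    then have A: "A \<in> sets borel" by simp
    have "(LBINT x:A. Im (F x)) = Im (LBINT x:A. F x)"
      using sint[OF A] unfolding set_lebesgue_integral_def set_integrable_def
      by (subst integral_Im[symmetric]) auto
    then show "(LBINT x:A. Im (F x)) = (LBINT x:A. 0)" using Z[OF A] by simp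
  qed (use F in auto)
  ultimately show ?thesis by eventually_elim (simp add: complex_eq_iff)
qed

text \<open>Multiplying by a Gaussian makes f integrable and keeps the hypothesis, since a Gaussian
  times a test function is again a test function.\<close>

theorem schwartz_separates:
  fixes f :: "real^'n::finite \<Rightarrow> complex"
  assumes int: "\<And>\<psi>. \<psi> \<in> schwartz \<Longrightarrow> integrable lborel (\<lambda>x. f x * \<psi> x)"
    and zero: "\<And>\<psi>. \<psi> \<in> schwartz \<Longrightarrow> (LBINT x. f x * \<psi> x) = 0"
  shows "AE x in lborel. f x = 0"
proof -
  define g where "g x = complex_of_real (exp (- 1 * (norm x)\<^sup>2))" for x :: "real^'n"
  define F where "F x = f x * g x" for x
  have g: "g \<in> schwartz" unfolding g_def by (rule schwartz_gaussian) simp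
  have F: "integrable lborel F" unfolding F_def by (rule int[OF g])
  have [measurable]: "F \<in> borel_measurable borel" using F by auto
  have Z: "(LBINT x. F x * \<psi> x) = 0" if "\<psi> \<in> schwartz" for \<psi>
    using zero[OF schwartz_gaussian_mult[OF that, of 1]] by (simp add: F_def g_def mult.assoc)
  have "AE x in lborel. F x = 0"
  proof (rule AE_eq_0_if_box_integrals[OF F box_integral_eq_0[OF F Z]])
    show "(LBINT x. F x) = 0" unfolding F_def by (rule zero[OF g])
  qed
  then show ?thesis by eventually_elim (simp add: F_def g_def)
qed

section \<open>The integral equation on the Fourier side\<close>

lemma K_const_pos:
  assumes "\<theta>\<^sub>1 > 0" "\<theta>\<^sub>2 > 0" "\<theta>\<^sub>1 + \<theta>\<^sub>2 < n"
  shows "K_const \<theta>\<^sub>1 \<theta>\<^sub>2 n > 0"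
  unfolding K_const_def nu_def using assms
  by (intro divide_pos_pos mult_pos_pos Gamma_real_pos) auto

text \<open>The bound is uniform in \<open>t\<close>; with A = 4 \<pi>^2 |\<xi>|^2 it is the gain of
  two powers of |\<xi>| from the heat flow.\<close>

lemma exp_decay_integral:
  fixes A t :: real
  assumes "A > 0"
  shows "integrable lborel (\<lambda>s. indicator {0..t} s * exp (- A * (t - s)))"
    and "(LBINT s. indicator {0..t} s * exp (- A * (t - s))) \<le> 1 / A"
proof -
  have "(\<integral>\<^sup>+s. ennreal (indicator {0..t} s * exp (- A * (t - s))) \<partial>lborel)
     \<le> (\<integral>\<^sup>+s. ennreal (indicator {0..} (t - s) * exp (- A * (t - s))) \<partial>lborel)"
    by (intro nn_integral_mono) (auto simp: indicator_def)
  also have "\<dots> = (\<integral>\<^sup>+s. ennreal (indicator {0..} s * exp (- A * s)) \<partial>lborel)"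
    by (rule nn_integral_reflect[of "\<lambda>s. ennreal (indicator {0..} s * exp (- A * s))"]) measurable
  also have "\<dots> = (\<integral>\<^sup>+s. ennreal (indicator {0<..} s * (s powr (1 - 1) * exp (- A * s))) \<partial>lborel)"
    by (intro nn_integral_cong_AE eventually_mono[OF AE_lborel_singleton[of 0]]) (auto simp: indicator_def)
  also have "\<dots> = ennreal (Gamma 1 * A powr (- 1))"
    by (rule nn_integral_Gamma_scaled) (use assms in auto)
  also have "\<dots> = ennreal (1 / A)" using assms by (simp add: powr_minus field_simps)
  finally have nn: "(\<integral>\<^sup>+s. ennreal (indicator {0..t} s * exp (- A * (t - s))) \<partial>lborel) \<le> ennreal (1 / A)" .
  then have "(\<integral>\<^sup>+s. ennreal (indicator {0..t} s * exp (- A * (t - s))) \<partial>lborel) < \<infinity>"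
    using ennreal_less_top order_le_less_trans by fastforce
  then show int: "integrable lborel (\<lambda>s. indicator {0..t} s * exp (- A * (t - s)))"
    by (intro integrableI_nonneg) auto
  show "(LBINT s. indicator {0..t} s * exp (- A * (t - s))) \<le> 1 / A"
    using nn nn_integral_eq_integral[OF int] assms by (auto simp: ennreal_le_iff)
qed

lemma norm_heat_symbol: "norm (heat_symbol t \<xi>) = exp (- 4 * pi\<^sup>2 * (norm \<xi>)\<^sup>2 * t)"
  by (simp add: heat_symbol_def)

lemma norm_heat_symbol_le_1: "t \<ge> 0 \<Longrightarrow> norm (heat_symbol t \<xi>) \<le> 1"
  by (simp add: norm_heat_symbol)

lemma heat_symbol_measurable[measurable (raw)]:
  assumes [measurable]: "f \<in> borel_measurable M" "g \<in> borel_measurable M"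
  shows "(\<lambda>x. heat_symbol (f x) (g x)) \<in> borel_measurable M"
  unfolding heat_symbol_def by measurable

lemma schwartz_heat_mult:
  assumes "\<psi> \<in> schwartz" "t \<ge> 0"
  shows "(\<lambda>\<xi>. heat_symbol t \<xi> * \<psi> \<xi>) \<in> schwartz"
proof -
  have "heat_symbol t \<xi> = complex_of_real (exp (- (4 * pi\<^sup>2 * t) * (norm \<xi>)\<^sup>2))" for \<xi> :: "real^'a"
    by (simp add: heat_symbol_def mult_ac)
  then show ?thesis using schwartz_gaussian_mult[OF assms(1), of "4 * pi\<^sup>2 * t"] assms(2) by simp
qed

lemma exp_minus_diff_le: "x \<ge> 0 \<Longrightarrow> y \<ge> 0 \<Longrightarrow> \<bar>exp (- x) - exp (- y)\<bar> \<le> \<bar>x - y :: real\<bar>"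
proof (induction x y rule: linorder_wlog)
  case (le x y)
  have "1 - (y - x) \<le> exp (- (y - x))" using exp_ge_add_one_self[of "x - y"] by (simp add: algebra_simps)
  then have "exp (- x) * (1 - exp (- (y - x))) \<le> 1 * (y - x)"
    using le by (intro mult_mono) auto
  moreover have "exp (- x) * (1 - exp (- (y - x))) = exp (- x) - exp (- y)"
    by (simp add: right_diff_distrib exp_add[symmetric])
  moreover have "exp (- y) \<le> exp (- x)" using le by simp
  ultimately show ?case using le by simp
next
  case (sym x y) then show ?case by (simp add: abs_minus_commute)
qed

lemma heat_symbol_lipschitz:
  assumes "s \<ge> 0" "t \<ge> 0"
  shows "norm (heat_symbol s \<xi> - heat_symbol t \<xi>) \<le> 4 * pi\<^sup>2 * (norm \<xi>)\<^sup>2 * \<bar>s - t\<bar>"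
proof -
  define c where "c = 4 * pi\<^sup>2 * (norm \<xi>)\<^sup>2"
  have c: "c \<ge> 0" by (simp add: c_def)
  have "norm (heat_symbol s \<xi> - heat_symbol t \<xi>) = \<bar>exp (- (c * s)) - exp (- (c * t))\<bar>"
    unfolding heat_symbol_def c_def by (simp only: of_real_diff[symmetric] norm_of_real) simp
  also have "\<dots> \<le> \<bar>c * s - c * t\<bar>" using c assms by (intro exp_minus_diff_le) auto
  also have "\<dots> = c * \<bar>s - t\<bar>" using c by (simp add: right_diff_distrib[symmetric] abs_mult)
  finally show ?thesis unfolding c_def .
qed

lemma convolution_measurable[measurable (raw)]:
  fixes f g :: "real^'n::finite \<Rightarrow> complex"
  assumes [measurable]: "f \<in> borel_measurable borel" "g \<in> borel_measurable borel"
  shows "convolution f g \<in> borel_measurable borel"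
  unfolding convolution_def[abs_def] by measurable

text \<open>Turns joint measurability, which is what an induction can carry, into the curried form
  that the \<open>measurable\<close> method can use as a rule.\<close>

lemma measurable_uncurried:
  assumes Q: "(\<lambda>z. Q (fst z) (snd z)) \<in> borel_measurable (borel \<Otimes>\<^sub>M borel)"
    and [measurable]: "f \<in> borel_measurable S" "g \<in> borel_measurable S"
  shows "(\<lambda>x. Q (f x) (g x)) \<in> borel_measurable S"
  using measurable_compose[of "\<lambda>x. (f x, g x)" S "borel \<Otimes>\<^sub>M borel", OF _ Q] by simp

text \<open>The bounds may be required at every point because only the class modulo null sets
  matters; at the origin they force \<open>a\<close> and \<open>b\<close> to vanish, as
  \<open>0 powr x = 0\<close>.\<close>

locale perturbed_heat =
  fixes a b :: "real^'n::finite \<Rightarrow> complex" and k v M :: real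
  assumes dim: "CARD('n) \<ge> 3" and k: "2 < k" "k < real CARD('n)"
    and a_meas[measurable]: "a \<in> borel_measurable borel"
    and b_meas[measurable]: "b \<in> borel_measurable borel"
    and v: "v \<ge> 0" and M: "M \<ge> 0"
    and a_le: "\<And>\<xi>. norm (a \<xi>) \<le> v * norm \<xi> powr (- (real CARD('n) - 2))"
    and b_le: "\<And>\<xi>. norm (b \<xi>) \<le> M * norm \<xi> powr (- k)"
    and small: "v * C_const (real CARD('n)) k < 1"
begin

text \<open>The bound for convolution with \<open>a\<close> as a map from the weight |\<xi>|^(-k) to
  |\<xi>|^(-(k-2)); the time integral divides it by 4 \<pi>^2, giving the contraction constant
  \<open>q\<close>.\<close>

definition L where "L = v * K_const 2 (real CARD('n) - k) (real CARD('n))"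

definition q where "q = v * C_const (real CARD('n)) k"

text \<open>\<open>U\<close> and \<open>W\<close> are the norms dual to the weights of order k - 2
  and k: the first controls pairings with a convolution, the second pairings with a
  solution.\<close>

definition U :: "(real^'n \<Rightarrow> complex) \<Rightarrow> real" where
  "U \<phi> = (LBINT \<xi>. norm \<xi> powr (- (k - 2)) * norm (\<phi> \<xi>))"

definition W :: "(real^'n \<Rightarrow> complex) \<Rightarrow> real" where
  "W \<phi> = (LBINT \<xi>. norm \<xi> powr (- k) * norm (\<phi> \<xi>))"

text \<open>The origin is left out because the Riesz and time estimates hold only away from it, so
  the values of the iterates there are not controlled.\<close>

definition wbound :: "real \<Rightarrow> (real^'n \<Rightarrow> complex) \<Rightarrow> bool" where
  "wbound N g \<longleftrightarrow> g \<in> borel_measurable borel \<and> (\<forall>\<xi>. \<xi> \<noteq> 0 \<longrightarrow> norm (g \<xi>) \<le> N * norm \<xi> powr (- k))"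

lemma wbound_meas: "wbound N g \<Longrightarrow> g \<in> borel_measurable borel" by (simp add: wbound_def)

lemma wbound_le: "wbound N g \<Longrightarrow> \<xi> \<noteq> 0 \<Longrightarrow> norm (g \<xi>) \<le> N * norm \<xi> powr (- k)" by (simp add: wbound_def)

lemma wbound_nonneg:
  assumes "wbound N g" shows "N \<ge> 0"
proof -
  have "0 \<le> norm (g (axis undefined 1))" by simp
  also have "\<dots> \<le> N * norm (axis undefined (1::real) :: real^'n) powr (- k)"
    using assms by (rule wbound_le) (simp add: axis_eq_0_iff)
  finally show ?thesis by (simp add: norm_axis_1)
qed

lemma wbound_diff: "wbound N f \<Longrightarrow> wbound N' g \<Longrightarrow> wbound (N + N') (\<lambda>\<xi>. f \<xi> - g \<xi>)"
  unfolding wbound_def by (auto simp: distrib_right intro!: order_trans[OF norm_triangle_ineq4] add_mono)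

lemma L_nonneg: "L \<ge> 0"
  unfolding L_def using v k dim by (intro mult_nonneg_nonneg less_imp_le[OF K_const_pos]) auto

lemma q: "q = L / (4 * pi\<^sup>2)" "q \<ge> 0" "q < 1"
proof -
  show "q = L / (4 * pi\<^sup>2)" by (simp add: q_def L_def C_const_def)
  then show "q \<ge> 0" using L_nonneg by simp
  show "q < 1" using small by (simp add: q_def)
qed

lemma U_integrable: "(\<phi> :: real^'n \<Rightarrow> complex) \<in> schwartz \<Longrightarrow> integrable lborel (\<lambda>\<xi>. norm \<xi> powr (- (k - 2)) * norm (\<phi> \<xi>))"
  using schwartz_integrable_weighted[of \<phi> "k - 2" 0] k by simp

lemma W_integrable: "(\<phi> :: real^'n \<Rightarrow> complex) \<in> schwartz \<Longrightarrow> integrable lborel (\<lambda>\<xi>. norm \<xi> powr (- k) * norm (\<phi> \<xi>))"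
  using schwartz_integrable_weighted[of \<phi> k 0] k by simp

lemma wbound_integrable:
  assumes g: "wbound N g" and \<phi>: "\<phi> \<in> schwartz"
  shows "integrable lborel (\<lambda>\<xi>. g \<xi> * \<phi> \<xi>)" and "norm (LBINT \<xi>. g \<xi> * \<phi> \<xi>) \<le> N * W \<phi>"
proof -
  note [measurable] = wbound_meas[OF g] schwartz_measurable[OF \<phi>]
  have ae: "AE \<xi> in lborel. norm (g \<xi> * \<phi> \<xi>) \<le> N * (norm \<xi> powr (- k) * norm (\<phi> \<xi>))"
    using AE_lborel_singleton[of 0]
  proof eventually_elim
    case (elim \<xi>)
    show ?case using mult_right_mono[OF wbound_le[OF g elim], of "norm (\<phi> \<xi>)"] by (simp add: norm_mult mult.assoc)
  qed
  have i: "integrable lborel (\<lambda>\<xi>. N * (norm \<xi> powr (- k) * norm (\<phi> \<xi>)))"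
    by (intro integrable_mult_right W_integrable \<phi>)
  show int: "integrable lborel (\<lambda>\<xi>. g \<xi> * \<phi> \<xi>)"
    by (rule Bochner_Integration.integrable_bound[OF i]) (use ae in \<open>auto elim!: eventually_mono\<close>)
  have "norm (LBINT \<xi>. g \<xi> * \<phi> \<xi>) \<le> (LBINT \<xi>. norm (g \<xi> * \<phi> \<xi>))"
    by (rule integral_norm_bound)
  also have "\<dots> \<le> (LBINT \<xi>. N * (norm \<xi> powr (- k) * norm (\<phi> \<xi>)))"
    by (rule integral_mono_AE[OF integrable_norm[OF int] i ae])
  finally show "norm (LBINT \<xi>. g \<xi> * \<phi> \<xi>) \<le> N * W \<phi>" by (simp add: W_def)
qed

text \<open>The Riesz composition formula with exponents n - 2 and k; their sum exceeds n because k
  > 2.\<close>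

lemma nn_integral_kernel:
  assumes "\<xi> \<noteq> 0"
  shows "(\<integral>\<^sup>+\<eta>. ennreal (norm (a (\<xi> - \<eta>)) * norm \<eta> powr (- k)) \<partial>lborel) \<le> ennreal (L * norm \<xi> powr (- (k - 2)))"
proof -
  have "(\<integral>\<^sup>+\<eta>. ennreal (norm (a (\<xi> - \<eta>)) * norm \<eta> powr (- k)) \<partial>lborel)
    \<le> (\<integral>\<^sup>+\<eta>. ennreal v * ennreal (norm (\<xi> - \<eta>) powr (- (real CARD('n) - 2)) * norm \<eta> powr (- k)) \<partial>lborel)"
    using v a_le by (intro nn_integral_mono) (auto simp: ennreal_mult'[symmetric] mult.assoc[symmetric] intro!: ennreal_leI mult_right_mono)
  also have "\<dots> = ennreal v * (\<integral>\<^sup>+\<eta>. ennreal (norm (\<xi> - \<eta>) powr (- (real CARD('n) - 2)) * norm \<eta> powr (- k)) \<partial>lborel)"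
    by (rule nn_integral_cmult) measurable
  also have "(\<integral>\<^sup>+\<eta>. ennreal (norm (\<xi> - \<eta>) powr (- (real CARD('n) - 2)) * norm \<eta> powr (- k)) \<partial>lborel)
    = ennreal (K_const (real DIM(real^'n) - (real CARD('n) - 2)) (real DIM(real^'n) - k) (real DIM(real^'n)) * norm \<xi> powr (real DIM(real^'n) - (real CARD('n) - 2) - k))"
    by (rule nn_integral_Riesz_composition) (use k dim assms in auto)
  finally show ?thesis using v by (simp add: L_def ennreal_mult'[symmetric] mult.assoc)
qed

lemma wbound_kernel_le:
  assumes g: "wbound N g" and "\<eta> \<noteq> 0"
  shows "norm (a (\<xi> - \<eta>) * g \<eta>) \<le> N * (norm (a (\<xi> - \<eta>)) * norm \<eta> powr (- k))"
  using mult_left_mono[OF wbound_le[OF assms], of "norm (a (\<xi> - \<eta>))"] by (simp add: norm_mult mult_ac)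

lemma nn_integral_convolution:
  assumes g: "wbound N g" and \<xi>: "\<xi> \<noteq> 0"
  shows "(\<integral>\<^sup>+\<eta>. ennreal (norm (a (\<xi> - \<eta>) * g \<eta>)) \<partial>lborel) \<le> ennreal (N * (L * norm \<xi> powr (- (k - 2))))"
proof -
  have "(\<integral>\<^sup>+\<eta>. ennreal (norm (a (\<xi> - \<eta>) * g \<eta>)) \<partial>lborel)
    \<le> (\<integral>\<^sup>+\<eta>. ennreal N * ennreal (norm (a (\<xi> - \<eta>)) * norm \<eta> powr (- k)) \<partial>lborel)"
    using wbound_kernel_le[OF g] wbound_nonneg[OF g]
    by (intro nn_integral_mono_AE eventually_mono[OF AE_lborel_singleton[of 0]]) (auto simp: ennreal_mult'[symmetric] intro!: ennreal_leI)
  also have "\<dots> = ennreal N * (\<integral>\<^sup>+\<eta>. ennreal (norm (a (\<xi> - \<eta>)) * norm \<eta> powr (- k)) \<partial>lborel)"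
    by (rule nn_integral_cmult) measurable
  also have "\<dots> \<le> ennreal N * ennreal (L * norm \<xi> powr (- (k - 2)))"
    by (intro mult_left_mono nn_integral_kernel \<xi>) auto
  finally show ?thesis using wbound_nonneg[OF g] by (simp add: ennreal_mult'[symmetric])
qed

lemma convolution_integrable:
  assumes g: "wbound N g" and \<xi>: "\<xi> \<noteq> 0"
  shows "integrable lborel (\<lambda>\<eta>. a (\<xi> - \<eta>) * g \<eta>)"
  unfolding integrable_iff_bounded
proof
  note [measurable] = wbound_meas[OF g]
  show "(\<lambda>\<eta>. a (\<xi> - \<eta>) * g \<eta>) \<in> borel_measurable lborel" by measurable
  show "(\<integral>\<^sup>+\<eta>. ennreal (norm (a (\<xi> - \<eta>) * g \<eta>)) \<partial>lborel) < \<infinity>"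
    using order_le_less_trans[OF nn_integral_convolution[OF assms] ennreal_less_top] by simp
qed

lemma convolution_le:
  assumes g: "wbound N g" and \<xi>: "\<xi> \<noteq> 0"
  shows "norm (convolution a g \<xi>) \<le> N * L * norm \<xi> powr (- (k - 2))"
proof -
  have "ennreal (norm (convolution a g \<xi>)) \<le> (\<integral>\<^sup>+\<eta>. ennreal (norm (a (\<xi> - \<eta>) * g \<eta>)) \<partial>lborel)"
    unfolding convolution_def by (rule integral_norm_bound_ennreal[OF convolution_integrable[OF assms]])
  also note nn_integral_convolution[OF assms]
  finally show ?thesis using wbound_nonneg[OF g] L_nonneg by (simp add: ennreal_le_iff mult.assoc)
qed

lemma kernel_finite:
  assumes g: "wbound N g" and \<phi>: "\<phi> \<in> schwartz"
  shows "(\<integral>\<^sup>+\<xi>. (\<integral>\<^sup>+\<eta>. ennreal (norm (a (\<xi> - \<eta>) * g \<eta> * \<phi> \<xi>)) \<partial>lborel) \<partial>lborel) \<le> ennreal (N * L * U \<phi>)"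
proof -
  note [measurable] = wbound_meas[OF g] schwartz_measurable[OF \<phi>]
  have "(\<integral>\<^sup>+\<xi>. (\<integral>\<^sup>+\<eta>. ennreal (norm (a (\<xi> - \<eta>) * g \<eta> * \<phi> \<xi>)) \<partial>lborel) \<partial>lborel)
    = (\<integral>\<^sup>+\<xi>. (\<integral>\<^sup>+\<eta>. ennreal (norm (a (\<xi> - \<eta>) * g \<eta>)) \<partial>lborel) * ennreal (norm (\<phi> \<xi>)) \<partial>lborel)"
    by (simp add: norm_mult[of "_ * _"] ennreal_mult' nn_integral_multc)
  also have "\<dots> \<le> (\<integral>\<^sup>+\<xi>. ennreal (N * (L * norm \<xi> powr (- (k - 2)))) * ennreal (norm (\<phi> \<xi>)) \<partial>lborel)"
    by (intro nn_integral_mono_AE eventually_mono[OF AE_lborel_singleton[of 0]] mult_right_mono nn_integral_convolution[OF g]) auto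
  also have "\<dots> = (\<integral>\<^sup>+\<xi>. ennreal (N * L * (norm \<xi> powr (- (k - 2)) * norm (\<phi> \<xi>))) \<partial>lborel)"
    using wbound_nonneg[OF g] L_nonneg by (intro nn_integral_cong) (simp add: ennreal_mult'[symmetric] mult_ac)
  also have "\<dots> = ennreal (LBINT \<xi>. N * L * (norm \<xi> powr (- (k - 2)) * norm (\<phi> \<xi>)))"
    by (intro nn_integral_eq_integral integrable_mult_right U_integrable \<phi>) (use wbound_nonneg[OF g] L_nonneg in auto)
  also have "\<dots> = ennreal (N * L * U \<phi>)" by (simp add: U_def)
  finally show ?thesis .
qed

lemma kernel_integrable:
  assumes g: "wbound N g" and \<phi>: "\<phi> \<in> schwartz"
  shows "integrable (lborel \<Otimes>\<^sub>M lborel) (\<lambda>(\<xi>, \<eta>). a (\<xi> - \<eta>) * g \<eta> * \<phi> \<xi>)"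
proof (rule lborel_pair_integrableI)
  note [measurable] = wbound_meas[OF g] schwartz_measurable[OF \<phi>]
  show "(\<lambda>(\<xi>, \<eta>). a (\<xi> - \<eta>) * g \<eta> * \<phi> \<xi>) \<in> borel_measurable (lborel \<Otimes>\<^sub>M lborel)" by measurable
  show "(\<integral>\<^sup>+\<xi>. (\<integral>\<^sup>+\<eta>. ennreal (norm (a (\<xi> - \<eta>) * g \<eta> * \<phi> \<xi>)) \<partial>lborel) \<partial>lborel) < \<infinity>"
    using order_le_less_trans[OF kernel_finite[OF assms] ennreal_less_top] by simp
qed

section \<open>The pairing of the convolution with a test function, and its transposition\<close>

definition Bform :: "(real^'n \<Rightarrow> complex) \<Rightarrow> (real^'n \<Rightarrow> complex) \<Rightarrow> complex" where
  "Bform g \<phi> = (LBINT \<xi>. convolution a g \<xi> * \<phi> \<xi>)"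

lemma Bform_eq: "Bform g \<phi> = (LBINT \<xi>. LBINT \<eta>. a (\<xi> - \<eta>) * g \<eta> * \<phi> \<xi>)"
  unfolding Bform_def convolution_def by simp

lemma Bform_integrable:
  assumes g: "wbound N g" and \<phi>: "\<phi> \<in> schwartz"
  shows "integrable lborel (\<lambda>\<xi>. convolution a g \<xi> * \<phi> \<xi>)"
  using lborel_pair.integrable_fst[OF kernel_integrable[OF assms]] by (simp add: convolution_def)

lemma Bform_le:
  assumes g: "wbound N g" and \<phi>: "\<phi> \<in> schwartz"
  shows "norm (Bform g \<phi>) \<le> N * L * U \<phi>"
proof -
  have ae: "AE \<xi> in lborel. norm (convolution a g \<xi> * \<phi> \<xi>) \<le> N * L * (norm \<xi> powr (- (k - 2)) * norm (\<phi> \<xi>))"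
    using AE_lborel_singleton[of 0]
  proof eventually_elim
    case (elim \<xi>)
    show ?case using mult_right_mono[OF convolution_le[OF g elim], of "norm (\<phi> \<xi>)"] by (simp add: norm_mult mult_ac)
  qed
  have "norm (Bform g \<phi>) \<le> (LBINT \<xi>. norm (convolution a g \<xi> * \<phi> \<xi>))"
    unfolding Bform_def by (rule integral_norm_bound)
  also have "\<dots> \<le> (LBINT \<xi>. N * L * (norm \<xi> powr (- (k - 2)) * norm (\<phi> \<xi>)))"
    by (intro integral_mono_AE integrable_norm Bform_integrable[OF assms] integrable_mult_right U_integrable \<phi> ae)
  finally show ?thesis by (simp add: U_def)
qed

lemma Bform_diff:
  assumes f: "wbound N f" and g: "wbound N' g" and \<phi>: "\<phi> \<in> schwartz"
  shows "Bform (\<lambda>\<xi>. f \<xi> - g \<xi>) \<phi> = Bform f \<phi> - Bform g \<phi>"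
proof -
  note [measurable] = wbound_meas[OF f] wbound_meas[OF g] schwartz_measurable[OF \<phi>] wbound_meas[OF wbound_diff[OF f g]]
  have "Bform (\<lambda>\<xi>. f \<xi> - g \<xi>) \<phi> = (LBINT \<xi>. convolution a f \<xi> * \<phi> \<xi> - convolution a g \<xi> * \<phi> \<xi>)"
    unfolding Bform_def
  proof (intro integral_cong_AE)
    show "AE \<xi> in lborel. convolution a (\<lambda>\<xi>. f \<xi> - g \<xi>) \<xi> * \<phi> \<xi> = convolution a f \<xi> * \<phi> \<xi> - convolution a g \<xi> * \<phi> \<xi>"
      using AE_lborel_singleton[of 0]
    proof eventually_elim
      case (elim \<xi>)
      then have "convolution a (\<lambda>\<xi>. f \<xi> - g \<xi>) \<xi> = convolution a f \<xi> - convolution a g \<xi>"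
        unfolding convolution_def right_diff_distrib
        by (intro Bochner_Integration.integral_diff convolution_integrable[OF f] convolution_integrable[OF g])
      then show ?case by (simp add: left_diff_distrib)
    qed
  qed measurable
  also have "\<dots> = Bform f \<phi> - Bform g \<phi>"
    unfolding Bform_def by (intro Bochner_Integration.integral_diff Bform_integrable[OF f \<phi>] Bform_integrable[OF g \<phi>])
  finally show ?thesis .
qed

text \<open>Regularizing \<open>a\<close> by a Gaussian turns \<open>Bform\<close> into a pairing with Schwartz functions.\<close>

definition areg :: "nat \<Rightarrow> real^'n \<Rightarrow> complex" where
  "areg j \<zeta> = a \<zeta> * complex_of_real (exp (- (1 / real (Suc j)) * (norm \<zeta>)\<^sup>2))"

text \<open>The transpose of convolution with \<open>areg j\<close>. The damping gives the kernel
  all moments, so the result is Schwartz; with \<open>a\<close> in place of \<open>areg j\<close> it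
  need not be.\<close>

definition chi :: "nat \<Rightarrow> (real^'n \<Rightarrow> complex) \<Rightarrow> real^'n \<Rightarrow> complex" where
  "chi j \<phi> \<eta> = (LBINT \<zeta>. areg j \<zeta> * \<phi> (\<zeta> + \<eta>))"

lemma areg_meas[measurable]: "areg j \<in> borel_measurable borel" unfolding areg_def by measurable

lemma areg_le: "norm (areg j \<zeta>) \<le> norm (a \<zeta>)"
  by (simp add: areg_def norm_mult mult_left_le)

lemma areg_moments: "integrable lborel (\<lambda>z. (1 + norm z) ^ N * norm (areg j z))"
proof -
  define c where "c = 1 / real (Suc j)"
  have c: "c > 0" by (simp add: c_def)
  have "integrable lborel (\<lambda>x::real^'n. v * (norm x powr (- (real CARD('n) - 2)) * ((1 + norm x) ^ N * norm (complex_of_real (exp (- c * (norm x)\<^sup>2))))))"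
    by (intro integrable_mult_right schwartz_integrable_weighted schwartz_gaussian c) (use dim in auto)
  then show ?thesis
  proof (rule Bochner_Integration.integrable_bound)
    show "AE x in lborel. norm ((1 + norm x) ^ N * norm (areg j x))
       \<le> norm (v * (norm x powr (- (real CARD('n) - 2)) * ((1 + norm x) ^ N * norm (complex_of_real (exp (- c * (norm x)\<^sup>2))))))"
    proof (rule AE_I2)
      fix x :: "real^'n"
      have "norm (areg j x) \<le> (v * norm x powr (- (real CARD('n) - 2))) * norm (complex_of_real (exp (- c * (norm x)\<^sup>2)))"
        unfolding areg_def norm_mult c_def by (intro mult_right_mono a_le) auto
      then have "(1 + norm x) ^ N * norm (areg j x) \<le> (1 + norm x) ^ N * ((v * norm x powr (- (real CARD('n) - 2))) * norm (complex_of_real (exp (- c * (norm x)\<^sup>2))))"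
        by (intro mult_left_mono) auto
      then show "norm ((1 + norm x) ^ N * norm (areg j x))
       \<le> norm (v * (norm x powr (- (real CARD('n) - 2)) * ((1 + norm x) ^ N * norm (complex_of_real (exp (- c * (norm x)\<^sup>2))))))"
        using v by (simp add: abs_mult power_abs mult_ac)
    qed
  qed measurable
qed

lemma chi_schwartz: "\<phi> \<in> schwartz \<Longrightarrow> chi j \<phi> \<in> schwartz"
  unfolding chi_def by (rule schwartz_correlation[OF areg_meas areg_moments])

lemma chi_alt:
  assumes \<phi>: "\<phi> \<in> schwartz"
  shows "chi j \<phi> \<eta> = (LBINT \<xi>. areg j (\<xi> - \<eta>) * \<phi> \<xi>)"
proof -
  note [measurable] = schwartz_measurable[OF \<phi>]
  have "chi j \<phi> \<eta> = (LBINT \<xi>. areg j (- \<eta> + \<xi>) * \<phi> ((- \<eta> + \<xi>) + \<eta>))"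
    unfolding chi_def by (rule lebesgue_integral_translate[symmetric]) measurable
  then show ?thesis by simp
qed

lemma chi_integrable:
  assumes \<phi>: "\<phi> \<in> schwartz"
  shows "integrable lborel (\<lambda>\<zeta>. areg j \<zeta> * \<phi> (\<zeta> + \<eta>))"
proof -
  note [measurable] = schwartz_measurable[OF \<phi>]
  obtain C where C: "C \<ge> 0" "\<And>x. (1 + norm x) ^ 0 * norm (\<phi> x) \<le> C" by (rule schwartz_decay[OF \<phi>]) blast
  show ?thesis
    by (rule Bochner_Integration.integrable_bound[OF integrable_mult_left[OF areg_moments[of 0 j], of C]])
       (use C in \<open>auto simp: norm_mult intro!: mult_left_mono\<close>)
qed

lemma chi_diff:
  assumes "\<phi> \<in> schwartz" "\<psi> \<in> schwartz"
  shows "chi j (\<lambda>x. \<phi> x - \<psi> x) \<eta> = chi j \<phi> \<eta> - chi j \<psi> \<eta>"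
  unfolding chi_def using chi_integrable[OF assms(1)] chi_integrable[OF assms(2)]
  by (simp add: right_diff_distrib)

lemma areg_kernel_le: "norm (areg j (\<xi> - \<eta>) * g \<eta> * \<phi> \<xi>) \<le> norm (a (\<xi> - \<eta>) * g \<eta> * \<phi> \<xi>)"
  unfolding norm_mult by (intro mult_right_mono areg_le) auto

lemma areg_kernel_integrable:
  assumes g: "wbound N g" and \<phi>: "\<phi> \<in> schwartz"
  shows "integrable (lborel \<Otimes>\<^sub>M lborel) (\<lambda>(\<xi>, \<eta>). areg j (\<xi> - \<eta>) * g \<eta> * \<phi> \<xi>)"
proof (rule Bochner_Integration.integrable_bound[OF kernel_integrable[OF assms]])
  note [measurable] = wbound_meas[OF g] schwartz_measurable[OF \<phi>]
  show "(\<lambda>(\<xi>, \<eta>). areg j (\<xi> - \<eta>) * g \<eta> * \<phi> \<xi>) \<in> borel_measurable (lborel \<Otimes>\<^sub>M lborel)" by measurable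
qed (auto intro!: AE_I2 areg_kernel_le)

lemma chi_pairing:
  assumes g: "wbound N g" and \<phi>: "\<phi> \<in> schwartz"
  shows "(LBINT \<eta>. g \<eta> * chi j \<phi> \<eta>) = (LINT z|(lborel \<Otimes>\<^sub>M lborel). (case z of (\<xi>, \<eta>) \<Rightarrow> areg j (\<xi> - \<eta>) * g \<eta> * \<phi> \<xi>))"
proof -
  have "(LBINT \<eta>. g \<eta> * chi j \<phi> \<eta>) = (LBINT \<eta>. LBINT \<xi>. areg j (\<xi> - \<eta>) * g \<eta> * \<phi> \<xi>)"
    unfolding chi_alt[OF \<phi>]
    by (subst integral_mult_right_zero[symmetric]) (simp add: mult_ac)
  then show ?thesis using lborel_pair.integral_snd[OF areg_kernel_integrable[OF assms]] by simp
qed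

text \<open>Expresses \<open>Bform\<close> through pairings of \<open>g\<close> with Schwartz
  functions alone, so bounds, signs and measurability of such pairings pass to it. The undamped
  kernel dominates on the product space.\<close>

lemma chi_pairing_tendsto:
  assumes g: "wbound N g" and \<phi>: "\<phi> \<in> schwartz"
  shows "(\<lambda>j. LBINT \<eta>. g \<eta> * chi j \<phi> \<eta>) \<longlonglongrightarrow> Bform g \<phi>"
proof -
  note [measurable] = wbound_meas[OF g] schwartz_measurable[OF \<phi>]
  have "(\<lambda>j. LINT z|(lborel \<Otimes>\<^sub>M lborel). (case z of (\<xi>, \<eta>) \<Rightarrow> areg j (\<xi> - \<eta>) * g \<eta> * \<phi> \<xi>)) \<longlonglongrightarrow>
    (LINT z|(lborel \<Otimes>\<^sub>M lborel). (case z of (\<xi>, \<eta>) \<Rightarrow> a (\<xi> - \<eta>) * g \<eta> * \<phi> \<xi>))"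
  proof (rule integral_dominated_convergence[where w = "\<lambda>z. norm (case z of (\<xi>, \<eta>) \<Rightarrow> a (\<xi> - \<eta>) * g \<eta> * \<phi> \<xi>)"])
    show "integrable (lborel \<Otimes>\<^sub>M lborel) (\<lambda>z. norm (case z of (\<xi>, \<eta>) \<Rightarrow> a (\<xi> - \<eta>) * g \<eta> * \<phi> \<xi>))"
      by (rule integrable_norm[OF kernel_integrable[OF assms]])
    have lim: "(\<lambda>j. areg j \<zeta>) \<longlonglongrightarrow> a \<zeta>" for \<zeta>
    proof -
      have "(\<lambda>j. 1 / real (Suc j)) \<longlonglongrightarrow> 0" using LIMSEQ_inverse_real_of_nat by (simp only: inverse_eq_divide)
      then have "(\<lambda>j. a \<zeta> * complex_of_real (exp (- (1 / real (Suc j)) * (norm \<zeta>)\<^sup>2))) \<longlonglongrightarrow> a \<zeta> * complex_of_real (exp (- 0 * (norm \<zeta>)\<^sup>2))"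
        by (intro tendsto_intros)
      then show ?thesis by (simp add: areg_def)
    qed
    show "AE z in lborel \<Otimes>\<^sub>M lborel. (\<lambda>j. case z of (\<xi>, \<eta>) \<Rightarrow> areg j (\<xi> - \<eta>) * g \<eta> * \<phi> \<xi>) \<longlonglongrightarrow> (case z of (\<xi>, \<eta>) \<Rightarrow> a (\<xi> - \<eta>) * g \<eta> * \<phi> \<xi>)"
      by (intro AE_I2) (auto intro!: tendsto_mult lim)
    show "AE z in lborel \<Otimes>\<^sub>M lborel. norm (case z of (\<xi>, \<eta>) \<Rightarrow> areg j (\<xi> - \<eta>) * g \<eta> * \<phi> \<xi>) \<le> norm (case z of (\<xi>, \<eta>) \<Rightarrow> a (\<xi> - \<eta>) * g \<eta> * \<phi> \<xi>)" for j
      by (intro AE_I2) (auto intro!: areg_kernel_le)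
  qed measurable
  then show ?thesis
    unfolding chi_pairing[OF assms, symmetric] Bform_eq lborel_pair.integral_fst[OF kernel_integrable[OF assms]] .
qed

text \<open>The estimate for convolution read in transposed form: the weight |\<eta>|^(-k) itself
  satisfies \<open>wbound 1\<close>, and exchanging the integrals reduces to
  \<open>kernel_finite\<close>. The bound does not depend on \<open>j\<close>.\<close>

lemma W_chi_le:
  assumes \<phi>: "\<phi> \<in> schwartz"
  shows "W (chi j \<phi>) \<le> L * U \<phi>"
proof -
  note [measurable] = schwartz_measurable[OF \<phi>] schwartz_measurable[OF chi_schwartz[OF \<phi>]]
  define w where "w \<eta> = complex_of_real (norm \<eta> powr (- k))" for \<eta> :: "real^'n"
  have [measurable]: "w \<in> borel_measurable borel" unfolding w_def by measurable
  have w: "wbound 1 w" by (auto simp: wbound_def w_def)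
  have "ennreal (W (chi j \<phi>)) = (\<integral>\<^sup>+\<eta>. ennreal (norm \<eta> powr (- k) * norm (chi j \<phi> \<eta>)) \<partial>lborel)"
    unfolding W_def by (rule nn_integral_eq_integral[symmetric]) (auto intro!: W_integrable chi_schwartz \<phi>)
  also have "\<dots> \<le> (\<integral>\<^sup>+\<eta>. (\<integral>\<^sup>+\<xi>. ennreal (norm (a (\<xi> - \<eta>) * w \<eta> * \<phi> \<xi>)) \<partial>lborel) \<partial>lborel)"
  proof (intro nn_integral_mono)
    fix \<eta>
    have int: "integrable lborel (\<lambda>\<xi>. areg j (\<xi> - \<eta>) * \<phi> \<xi>)"
    proof -
      have "integrable lborel (\<lambda>\<xi>. areg j (- \<eta> + \<xi>) * \<phi> ((- \<eta> + \<xi>) + \<eta>))"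
        by (subst integrable_translate_iff) (auto intro!: chi_integrable \<phi>)
      then show ?thesis by simp
    qed
    have "ennreal (norm (chi j \<phi> \<eta>)) \<le> (\<integral>\<^sup>+\<xi>. ennreal (norm (areg j (\<xi> - \<eta>) * \<phi> \<xi>)) \<partial>lborel)"
      unfolding chi_alt[OF \<phi>] by (rule integral_norm_bound_ennreal[OF int])
    then have "ennreal (norm \<eta> powr (- k) * norm (chi j \<phi> \<eta>)) \<le> ennreal (norm \<eta> powr (- k)) * (\<integral>\<^sup>+\<xi>. ennreal (norm (areg j (\<xi> - \<eta>) * \<phi> \<xi>)) \<partial>lborel)"
      by (simp add: ennreal_mult' mult_left_mono)
    also have "\<dots> = (\<integral>\<^sup>+\<xi>. ennreal (norm \<eta> powr (- k)) * ennreal (norm (areg j (\<xi> - \<eta>) * \<phi> \<xi>)) \<partial>lborel)"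
      by (rule nn_integral_cmult[symmetric]) measurable
    also have "\<dots> \<le> (\<integral>\<^sup>+\<xi>. ennreal (norm (a (\<xi> - \<eta>) * w \<eta> * \<phi> \<xi>)) \<partial>lborel)"
    proof (intro nn_integral_mono)
      fix \<xi>
      have "norm \<eta> powr (- k) * norm (areg j (\<xi> - \<eta>) * \<phi> \<xi>) = norm (areg j (\<xi> - \<eta>) * w \<eta> * \<phi> \<xi>)"
        by (simp add: norm_mult w_def)
      also have "\<dots> \<le> norm (a (\<xi> - \<eta>) * w \<eta> * \<phi> \<xi>)" by (rule areg_kernel_le)
      finally show "ennreal (norm \<eta> powr (- k)) * ennreal (norm (areg j (\<xi> - \<eta>) * \<phi> \<xi>)) \<le> ennreal (norm (a (\<xi> - \<eta>) * w \<eta> * \<phi> \<xi>))"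
        by (simp add: ennreal_mult'[symmetric] ennreal_leI)
    qed
    finally show "ennreal (norm \<eta> powr (- k) * norm (chi j \<phi> \<eta>)) \<le> (\<integral>\<^sup>+\<xi>. ennreal (norm (a (\<xi> - \<eta>) * w \<eta> * \<phi> \<xi>)) \<partial>lborel)" .
  qed
  also have "\<dots> = (\<integral>\<^sup>+\<xi>. (\<integral>\<^sup>+\<eta>. ennreal (norm (a (\<xi> - \<eta>) * w \<eta> * \<phi> \<xi>)) \<partial>lborel) \<partial>lborel)"
    by (rule lborel_pair.Fubini') measurable
  also have "\<dots> \<le> ennreal (1 * L * U \<phi>)" by (rule kernel_finite[OF w \<phi>])
  finally have "ennreal (W (chi j \<phi>)) \<le> ennreal (L * U \<phi>)" by simp
  moreover have "L * U \<phi> \<ge> 0" using L_nonneg by (auto simp: U_def intro!: mult_nonneg_nonneg integral_nonneg_AE)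
  ultimately show ?thesis by (simp add: ennreal_le_iff)
qed

text \<open>The pointwise bound N secures convergence, but the resulting constant is \<rho>, known
  only from pairings. This is what allows a weak error bound to be iterated.\<close>

lemma Bform_le_weak:
  assumes g: "wbound N g" and weak: "\<And>\<psi>. \<psi> \<in> schwartz \<Longrightarrow> norm (LBINT \<eta>. g \<eta> * \<psi> \<eta>) \<le> \<rho> * W \<psi>"
    and \<rho>: "\<rho> \<ge> 0" and \<phi>: "\<phi> \<in> schwartz"
  shows "norm (Bform g \<phi>) \<le> \<rho> * (L * U \<phi>)"
proof (rule LIMSEQ_le_const2[OF tendsto_norm[OF chi_pairing_tendsto[OF g \<phi>]]])
  have "norm (LBINT \<eta>. g \<eta> * chi j \<phi> \<eta>) \<le> \<rho> * (L * U \<phi>)" for j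
    using weak[OF chi_schwartz[OF \<phi>], of j] mult_left_mono[OF W_chi_le[OF \<phi>, of j] \<rho>] by linarith
  then show "\<exists>N. \<forall>j\<ge>N. norm (LBINT \<eta>. g \<eta> * chi j \<phi> \<eta>) \<le> \<rho> * (L * U \<phi>)" by blast
qed

text \<open>The factor |\<xi>|^2 in the Lipschitz constant of the heat symbol is absorbed by the
  decay of \<psi>. It serves to vary the test function with time in the measurability proof
  below.\<close>

lemma U_heat_diff_le:
  assumes \<psi>: "\<psi> \<in> schwartz"
  obtains Q where "Q \<ge> 0" "\<And>s t. s \<ge> 0 \<Longrightarrow> t \<ge> 0 \<Longrightarrow> U (\<lambda>\<xi>. heat_symbol s \<xi> * \<psi> \<xi> - heat_symbol t \<xi> * \<psi> \<xi>) \<le> Q * \<bar>s - t\<bar>"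
proof
  let ?Q = "LBINT \<xi>. 4 * pi\<^sup>2 * (norm \<xi> powr (- (k - 2)) * ((1 + norm \<xi>) ^ 2 * norm (\<psi> \<xi>)))"
  show "?Q \<ge> 0" by (intro integral_nonneg_AE AE_I2) auto
  fix s t :: real assume st: "s \<ge> 0" "t \<ge> 0"
  have I: "integrable lborel (\<lambda>\<xi>. 4 * pi\<^sup>2 * (norm \<xi> powr (- (k - 2)) * ((1 + norm \<xi>) ^ 2 * norm (\<psi> \<xi>))))"
    by (intro integrable_mult_right schwartz_integrable_weighted \<psi>) (use k in auto)
  have "U (\<lambda>\<xi>. heat_symbol s \<xi> * \<psi> \<xi> - heat_symbol t \<xi> * \<psi> \<xi>) \<le>
     (LBINT \<xi>. 4 * pi\<^sup>2 * (norm \<xi> powr (- (k - 2)) * ((1 + norm \<xi>) ^ 2 * norm (\<psi> \<xi>))) * \<bar>s - t\<bar>)"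
    unfolding U_def
  proof (rule integral_mono')
    show "integrable lborel (\<lambda>\<xi>. 4 * pi\<^sup>2 * (norm \<xi> powr (- (k - 2)) * ((1 + norm \<xi>) ^ 2 * norm (\<psi> \<xi>))) * \<bar>s - t\<bar>)"
      by (intro integrable_mult_left I)
    fix \<xi> :: "real^'n"
    have "norm (heat_symbol s \<xi> * \<psi> \<xi> - heat_symbol t \<xi> * \<psi> \<xi>) = norm (heat_symbol s \<xi> - heat_symbol t \<xi>) * norm (\<psi> \<xi>)"
      by (simp add: left_diff_distrib[symmetric] norm_mult)
    also have "\<dots> \<le> (4 * pi\<^sup>2 * (norm \<xi>)\<^sup>2 * \<bar>s - t\<bar>) * norm (\<psi> \<xi>)"
      by (intro mult_right_mono heat_symbol_lipschitz st) auto
    also have "\<dots> \<le> (4 * pi\<^sup>2 * (1 + norm \<xi>)\<^sup>2 * \<bar>s - t\<bar>) * norm (\<psi> \<xi>)"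
      by (intro mult_right_mono mult_left_mono power_mono) auto
    finally have "norm (heat_symbol s \<xi> * \<psi> \<xi> - heat_symbol t \<xi> * \<psi> \<xi>) \<le> (4 * pi\<^sup>2 * (1 + norm \<xi>)\<^sup>2 * \<bar>s - t\<bar>) * norm (\<psi> \<xi>)" .
    from mult_left_mono[OF this, of "norm \<xi> powr (- (k - 2))"]
    show "norm \<xi> powr (- (k - 2)) * norm (heat_symbol s \<xi> * \<psi> \<xi> - heat_symbol t \<xi> * \<psi> \<xi>) \<le>
       4 * pi\<^sup>2 * (norm \<xi> powr (- (k - 2)) * ((1 + norm \<xi>) ^ 2 * norm (\<psi> \<xi>))) * \<bar>s - t\<bar>" by (simp add: mult_ac)
  qed auto
  then show "U (\<lambda>\<xi>. heat_symbol s \<xi> * \<psi> \<xi> - heat_symbol t \<xi> * \<psi> \<xi>) \<le> ?Q * \<bar>s - t\<bar>" by simp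
qed

lemma U_heat_le:
  assumes \<psi>: "\<psi> \<in> schwartz" and "t \<ge> 0"
  shows "U (\<lambda>\<xi>. heat_symbol t \<xi> * \<psi> \<xi>) \<le> U \<psi>"
  unfolding U_def
  by (intro integral_mono U_integrable schwartz_heat_mult assms mult_left_mono)
     (auto simp: norm_mult intro!: mult_left_le_one_le norm_heat_symbol_le_1 assms)

definition weakly_continuous :: "(real \<Rightarrow> real^'n \<Rightarrow> complex) \<Rightarrow> bool" where
  "weakly_continuous f \<longleftrightarrow> (\<forall>\<psi>\<in>schwartz. continuous_on {0..} (\<lambda>s. LBINT \<eta>. f s \<eta> * \<psi> \<eta>))"

lemma Bform_time_integrableI:
  assumes f: "\<And>s. s \<ge> 0 \<Longrightarrow> wbound N (f s)" and \<psi>: "\<psi> \<in> schwartz"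
    and meas: "(\<lambda>s. indicator {0..t} s *\<^sub>R Bform (f s) (\<lambda>\<xi>. heat_symbol (t - s) \<xi> * \<psi> \<xi>)) \<in> borel_measurable lborel"
  shows "set_integrable lborel {0..t} (\<lambda>s. Bform (f s) (\<lambda>\<xi>. heat_symbol (t - s) \<xi> * \<psi> \<xi>))"
  unfolding set_integrable_def
proof (rule Bochner_Integration.integrable_bound[OF _ meas])
  have N: "N \<ge> 0" using wbound_nonneg[OF f[of 0]] by simp
  have "U \<psi> \<ge> 0" unfolding U_def by (intro integral_nonneg_AE AE_I2) auto
  show "integrable lborel (\<lambda>s. N * L * U \<psi> * indicator {0..t} s)"
    by (intro integrable_mult_right integrable_real_indicator) (auto simp: emeasure_lborel_Icc_eq)
  have "norm (Bform (f s) (\<lambda>\<xi>. heat_symbol (t - s) \<xi> * \<psi> \<xi>)) \<le> N * L * U \<psi>" if "s \<in> {0..t}" for s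
  proof -
    have "norm (Bform (f s) (\<lambda>\<xi>. heat_symbol (t - s) \<xi> * \<psi> \<xi>)) \<le> N * L * U (\<lambda>\<xi>. heat_symbol (t - s) \<xi> * \<psi> \<xi>)"
      using that by (intro Bform_le[OF f schwartz_heat_mult[OF \<psi>]]) auto
    also have "\<dots> \<le> N * L * U \<psi>" using that N L_nonneg by (intro mult_left_mono U_heat_le \<psi>) auto
    finally show ?thesis .
  qed
  then show "AE s in lborel. norm (indicator {0..t} s *\<^sub>R Bform (f s) (\<lambda>\<xi>. heat_symbol (t - s) \<xi> * \<psi> \<xi>)) \<le> norm (N * L * U \<psi> * indicator {0..t} s)"
    using N L_nonneg \<open>U \<psi> \<ge> 0\<close> by (intro AE_I2) (auto simp: indicator_def)
qed

text \<open>Weak continuity is not known to pass to the singular pairing \<open>Bform\<close>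
  directly. For each \<open>j\<close>, however, the pairing with \<open>chi j\<close> is continuous
  in time, and the integrand is the pointwise limit of these functions, hence measurable.\<close>

lemma weakly_continuous_time_integrable:
  assumes f: "\<And>s. s \<ge> 0 \<Longrightarrow> wbound N (f s)" and wc: "weakly_continuous f" and \<psi>: "\<psi> \<in> schwartz"
  shows "set_integrable lborel {0..t} (\<lambda>s. Bform (f s) (\<lambda>\<xi>. heat_symbol (t - s) \<xi> * \<psi> \<xi>))"
proof (rule Bform_time_integrableI[OF f \<psi>])
  define \<phi> where "\<phi> s = (\<lambda>\<xi>. heat_symbol (t - s) \<xi> * \<psi> \<xi>)" for s
  have \<phi>: "\<phi> s \<in> schwartz" if "s \<in> {0..t}" for s
    unfolding \<phi>_def using that by (intro schwartz_heat_mult \<psi>) auto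
  have N: "N \<ge> 0" using wbound_nonneg[OF f[of 0]] by simp
  obtain Q where Q: "Q \<ge> 0" "\<And>s t. s \<ge> 0 \<Longrightarrow> t \<ge> 0 \<Longrightarrow> U (\<lambda>\<xi>. heat_symbol s \<xi> * \<psi> \<xi> - heat_symbol t \<xi> * \<psi> \<xi>) \<le> Q * \<bar>s - t\<bar>"
    using U_heat_diff_le[OF \<psi>] by blast
  define A where "A j s = (LBINT \<eta>. f s \<eta> * chi j (\<phi> s) \<eta>)" for j s
  have cont: "continuous_on {0..t} (A j)" for j
    unfolding continuous_on_def
  proof
    fix r assume r: "r \<in> {0..t}"
    \<comment> \<open>Both \<open>f s\<close> and the test function depend on \<open>s\<close>.
      \<open>D\<close> carries the change of the test function and tends to 0 by uniform bounds;
      \<open>E\<close> has a fixed test function and is continuous by assumption.\<close>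
    define D where "D s = (LBINT \<eta>. f s \<eta> * chi j (\<lambda>\<xi>. \<phi> s \<xi> - \<phi> r \<xi>) \<eta>)" for s
    define E where "E s = (LBINT \<eta>. f s \<eta> * chi j (\<phi> r) \<eta>)" for s
    have diff: "(\<lambda>\<xi>. \<phi> s \<xi> - \<phi> r \<xi>) \<in> schwartz" if "s \<in> {0..t}" for s
      using schwartz_add[OF \<phi>[OF that] schwartz_cmult[OF \<phi>[OF r], of "- 1"]] by simp
    have AE: "A j s = D s + E s" if s: "s \<in> {0..t}" for s
    proof -
      have "D s = A j s - E s"
        unfolding D_def A_def E_def chi_diff[OF \<phi>[OF s] \<phi>[OF r]] right_diff_distrib
        using s by (intro Bochner_Integration.integral_diff wbound_integrable(1)[OF f] chi_schwartz \<phi> r) auto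
      then show ?thesis by simp
    qed
    have D: "norm (D s) \<le> N * (L * (Q * \<bar>s - r\<bar>))" if s: "s \<in> {0..t}" for s
    proof -
      have "norm (D s) \<le> N * W (chi j (\<lambda>\<xi>. \<phi> s \<xi> - \<phi> r \<xi>))"
        unfolding D_def using s by (intro wbound_integrable(2)[OF f] chi_schwartz diff) auto
      also have "\<dots> \<le> N * (L * U (\<lambda>\<xi>. \<phi> s \<xi> - \<phi> r \<xi>))"
        using N by (intro mult_left_mono W_chi_le diff s) auto
      also have "\<dots> \<le> N * (L * (Q * \<bar>s - r\<bar>))"
        using Q(2)[of "t - s" "t - r"] s r N L_nonneg unfolding \<phi>_def
        by (intro mult_left_mono) (auto simp: abs_minus_commute)
      finally show ?thesis .
    qed
    have "(D \<longlongrightarrow> 0) (at r within {0..t})"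
    proof (rule Lim_null_comparison[where g = "\<lambda>s. N * (L * (Q * \<bar>s - r\<bar>))"])
      show "\<forall>\<^sub>F s in at r within {0..t}. norm (D s) \<le> N * (L * (Q * \<bar>s - r\<bar>))"
        using D by (auto simp: eventually_at_filter)
      show "((\<lambda>s. N * (L * (Q * \<bar>s - r\<bar>))) \<longlongrightarrow> 0) (at r within {0..t})"
        by (auto intro!: tendsto_eq_intros)
    qed
    moreover have "(E \<longlongrightarrow> E r) (at r within {0..t})"
    proof -
      have "continuous_on {0..} E"
        unfolding E_def using wc chi_schwartz[OF \<phi>[OF r]] by (auto simp: weakly_continuous_def)
      then have "continuous_on {0..t} E" by (rule continuous_on_subset) auto
      then show ?thesis using r by (auto simp: continuous_on_def)
    qed
    ultimately have "((\<lambda>s. D s + E s) \<longlongrightarrow> 0 + E r) (at r within {0..t})" by (rule tendsto_add)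
    then have "((\<lambda>s. D s + E s) \<longlongrightarrow> A j r) (at r within {0..t})" by (simp add: E_def A_def)
    then show "(A j \<longlongrightarrow> A j r) (at r within {0..t})"
      by (rule Lim_transform_eventually) (use AE in \<open>auto simp: eventually_at_filter\<close>)
  qed
  have "(\<lambda>s. indicator {0..t} s *\<^sub>R Bform (f s) (\<phi> s)) \<in> borel_measurable borel"
  proof (rule borel_measurable_LIMSEQ_metric)
    show "(\<lambda>s. indicator {0..t} s *\<^sub>R A j s) \<in> borel_measurable borel" for j
      by (rule borel_measurable_continuous_on_indicator[OF _ cont]) auto
    show "(\<lambda>j. indicator {0..t} s *\<^sub>R A j s) \<longlonglongrightarrow> indicator {0..t} s *\<^sub>R Bform (f s) (\<phi> s)" for s
      using chi_pairing_tendsto[OF f \<phi>] by (cases "s \<in> {0..t}") (auto simp: A_def)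
  qed
  then show "(\<lambda>s. indicator {0..t} s *\<^sub>R Bform (f s) (\<lambda>\<xi>. heat_symbol (t - s) \<xi> * \<psi> \<xi>)) \<in> borel_measurable lborel"
    by (simp add: \<phi>_def)
qed

subsection \<open>Picard iteration\<close>

text \<open>Here the time integral is taken pointwise in \<xi>, which keeps the iterates explicit
  and jointly measurable; \<open>P_Suc_pairing\<close> recovers the weak form.\<close>

primrec P :: "nat \<Rightarrow> real \<Rightarrow> real^'n \<Rightarrow> complex" where
  "P 0 = (\<lambda>t \<xi>. 0)"
| "P (Suc m) = (\<lambda>t \<xi>. heat_symbol t \<xi> * b \<xi> + (LBINT s:{0..t}. heat_symbol (t - s) \<xi> * convolution a (P m s) \<xi>))"

lemma P_measurable_pair: "(\<lambda>z. P m (fst z) (snd z)) \<in> borel_measurable (borel \<Otimes>\<^sub>M borel)"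
proof (induction m)
  case (Suc m)
  note [measurable (raw)] = measurable_uncurried[OF Suc]
  show ?case unfolding P.simps convolution_def set_lebesgue_integral_def indicator_def atLeastAtMost_iff by measurable
qed simp

lemmas P_measurable[measurable (raw)] = measurable_uncurried[OF P_measurable_pair]

text \<open>The time integral gains the factor 1 / (4 \<pi>^2 |\<xi>|^2), exactly restoring the two
  powers lost in the convolution.\<close>

lemma duhamel_le:
  assumes "\<xi> \<noteq> 0" and c: "\<And>s. s \<ge> 0 \<Longrightarrow> norm (c s) \<le> B * norm \<xi> powr (- (k - 2))" and B: "B \<ge> 0"
  shows "norm (LBINT s:{0..t}. heat_symbol (t - s) \<xi> * c s) \<le> B / (4 * pi\<^sup>2) * norm \<xi> powr (- k)"
proof -
  define A where "A = 4 * pi\<^sup>2 * (norm \<xi>)\<^sup>2"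
  have A: "A > 0" using assms by (simp add: A_def)
  let ?R = "B * norm \<xi> powr (- (k - 2))"
  have R: "?R \<ge> 0" using B by simp
  have "norm (LBINT s:{0..t}. heat_symbol (t - s) \<xi> * c s) \<le> (LBINT s. norm (indicator {0..t} s *\<^sub>R (heat_symbol (t - s) \<xi> * c s)))"
    unfolding set_lebesgue_integral_def by (rule integral_norm_bound)
  also have "\<dots> \<le> (LBINT s. (indicator {0..t} s * exp (- A * (t - s))) * ?R)"
  proof (rule integral_mono')
    show "integrable lborel (\<lambda>s. (indicator {0..t} s * exp (- A * (t - s))) * ?R)"
      by (intro integrable_mult_left exp_decay_integral A)
    fix s
    show "norm (indicator {0..t} s *\<^sub>R (heat_symbol (t - s) \<xi> * c s)) \<le> (indicator {0..t} s * exp (- A * (t - s))) * ?R"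
      using c[of s] by (auto simp: indicator_def norm_mult norm_heat_symbol A_def mult_ac intro!: mult_left_mono)
  qed (use R in auto)
  also have "\<dots> = (LBINT s. indicator {0..t} s * exp (- A * (t - s))) * ?R" by simp
  also have "\<dots> \<le> (1 / A) * ?R" by (intro mult_right_mono exp_decay_integral A R)
  also have "\<dots> = B / (4 * pi\<^sup>2) * norm \<xi> powr (- k)"
  proof -
    have "norm \<xi> powr (- (k - 2)) = norm \<xi> powr (- k) * (norm \<xi>)\<^sup>2"
      using assms(1) by (simp add: powr_add[symmetric] powr_realpow[symmetric] del: powr_numeral)
    then show ?thesis using assms(1) by (simp add: A_def)
  qed
  finally show ?thesis .
qed

text \<open>The fixed point of the map taking N to M + q N, so one constant bounds all iterates at
  all times.\<close>

definition N\<^sub>0 where "N\<^sub>0 = M / (1 - q)"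

lemma N\<^sub>0: "N\<^sub>0 \<ge> 0" "M + q * N\<^sub>0 = N\<^sub>0"
  using M q by (auto simp: N\<^sub>0_def field_simps)

lemma P_wbound: "t \<ge> 0 \<Longrightarrow> wbound N\<^sub>0 (P m t)"
proof (induction m arbitrary: t)
  case 0 then show ?case using N\<^sub>0 by (simp add: wbound_def)
next
  case (Suc m)
  show ?case unfolding wbound_def
  proof (intro conjI allI impI)
    show "P (Suc m) t \<in> borel_measurable borel" by (rule P_measurable) measurable
    fix \<xi> :: "real^'n" assume \<xi>: "\<xi> \<noteq> 0"
    have "norm (heat_symbol t \<xi> * b \<xi>) \<le> 1 * (M * norm \<xi> powr (- k))"
      unfolding norm_mult by (intro mult_mono norm_heat_symbol_le_1 Suc.prems b_le) auto
    moreover have "norm (LBINT s:{0..t}. heat_symbol (t - s) \<xi> * convolution a (P m s) \<xi>) \<le> (N\<^sub>0 * L) / (4 * pi\<^sup>2) * norm \<xi> powr (- k)"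
      using N\<^sub>0 L_nonneg by (intro duhamel_le \<xi> convolution_le[OF Suc.IH]) auto
    ultimately have "norm (P (Suc m) t \<xi>) \<le> M * norm \<xi> powr (- k) + (N\<^sub>0 * L) / (4 * pi\<^sup>2) * norm \<xi> powr (- k)"
      unfolding P.simps by (intro order_trans[OF norm_triangle_ineq]) auto
    also have "\<dots> = (M + q * N\<^sub>0) * norm \<xi> powr (- k)" by (simp add: q(1) algebra_simps)
    finally show "norm (P (Suc m) t \<xi>) \<le> N\<^sub>0 * norm \<xi> powr (- k)" by (simp add: N\<^sub>0(2))
  qed
qed

lemma P_kernel_integrable:
  assumes \<psi>: "\<psi> \<in> schwartz" and t: "t \<ge> 0"
  shows "integrable (lborel \<Otimes>\<^sub>M lborel) (\<lambda>(\<xi>, s). indicator {0..t} s *\<^sub>R (heat_symbol (t - s) \<xi> * convolution a (P m s) \<xi> * \<psi> \<xi>))"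
proof (rule lborel_pair_integrable_bound[where g = "\<lambda>\<xi>. N\<^sub>0 * L * (norm \<xi> powr (- (k - 2)) * norm (\<psi> \<xi>))" and h = "indicator {0..t} :: real \<Rightarrow> real"])
  note [measurable] = schwartz_measurable[OF \<psi>]
  show "(\<lambda>(\<xi>, s). indicator {0..t} s *\<^sub>R (heat_symbol (t - s) \<xi> * convolution a (P m s) \<xi> * \<psi> \<xi>)) \<in> borel_measurable (lborel \<Otimes>\<^sub>M lborel)"
    unfolding convolution_def by measurable
  show "integrable lborel (\<lambda>\<xi>. N\<^sub>0 * L * (norm \<xi> powr (- (k - 2)) * norm (\<psi> \<xi>)))"
    by (intro integrable_mult_right U_integrable \<psi>)
  show "integrable lborel (indicator {0..t} :: real \<Rightarrow> real)" by (intro integrable_real_indicator) (auto simp: emeasure_lborel_Icc_eq)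
  show "AE \<xi> in lborel. \<forall>s. norm (indicator {0..t} s *\<^sub>R (heat_symbol (t - s) \<xi> * convolution a (P m s) \<xi> * \<psi> \<xi>))
      \<le> norm (N\<^sub>0 * L * (norm \<xi> powr (- (k - 2)) * norm (\<psi> \<xi>))) * norm (indicator {0..t} s :: real)"
    using AE_lborel_singleton[of 0]
  proof (eventually_elim, intro allI)
    fix \<xi> :: "real^'n" and s assume \<xi>: "\<xi> \<noteq> 0"
    show "norm (indicator {0..t} s *\<^sub>R (heat_symbol (t - s) \<xi> * convolution a (P m s) \<xi> * \<psi> \<xi>))
      \<le> norm (N\<^sub>0 * L * (norm \<xi> powr (- (k - 2)) * norm (\<psi> \<xi>))) * norm (indicator {0..t} s :: real)"
    proof (cases "s \<in> {0..t}")
      case True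
      have "norm (heat_symbol (t - s) \<xi> * convolution a (P m s) \<xi> * \<psi> \<xi>) \<le> 1 * (N\<^sub>0 * L * norm \<xi> powr (- (k - 2))) * norm (\<psi> \<xi>)"
        unfolding norm_mult using True
        by (intro mult_right_mono mult_mono norm_heat_symbol_le_1 convolution_le[OF P_wbound] \<xi>) auto
      then show ?thesis using True N\<^sub>0 L_nonneg by (simp add: abs_mult mult_ac)
    qed auto
  qed
qed

lemma P_time_integrable:
  assumes \<psi>: "\<psi> \<in> schwartz" and t: "t \<ge> 0"
  shows "set_integrable lborel {0..t} (\<lambda>s. Bform (P m s) (\<lambda>\<xi>. heat_symbol (t - s) \<xi> * \<psi> \<xi>))"
  using lborel_pair.integrable_snd[OF P_kernel_integrable[OF assms]]
  unfolding set_integrable_def Bform_def by (simp add: mult_ac)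

text \<open>Fubini in frequency and time, after which the heat symbol is moved to the test function;
  the iterates thus satisfy the recursion in the weak form of the equation.\<close>

lemma P_Suc_pairing:
  assumes \<psi>: "\<psi> \<in> schwartz" and t: "t \<ge> 0"
  shows "(LBINT \<xi>. P (Suc m) t \<xi> * \<psi> \<xi>) = (LBINT \<xi>. heat_symbol t \<xi> * b \<xi> * \<psi> \<xi>)
     + (LBINT s:{0..t}. Bform (P m s) (\<lambda>\<xi>. heat_symbol (t - s) \<xi> * \<psi> \<xi>))"
proof -
  note [measurable] = schwartz_measurable[OF \<psi>]
  have hb: "wbound M (\<lambda>\<xi>. heat_symbol t \<xi> * b \<xi>)"
    unfolding wbound_def
  proof (intro conjI allI impI)
    show "norm (heat_symbol t \<xi> * b \<xi>) \<le> M * norm \<xi> powr (- k)" for \<xi>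
      using mult_mono[OF norm_heat_symbol_le_1[OF t] b_le[of \<xi>], of \<xi>] by (simp add: norm_mult)
  qed measurable
  have "(LBINT \<xi>. P (Suc m) t \<xi> * \<psi> \<xi>) = (LBINT \<xi>. heat_symbol t \<xi> * b \<xi> * \<psi> \<xi> +
      (LBINT s. indicator {0..t} s *\<^sub>R (heat_symbol (t - s) \<xi> * convolution a (P m s) \<xi> * \<psi> \<xi>)))"
    unfolding P.simps set_lebesgue_integral_def distrib_right
    by (subst integral_mult_left_zero[symmetric]) simp
  also have "\<dots> = (LBINT \<xi>. heat_symbol t \<xi> * b \<xi> * \<psi> \<xi>) +
     (LBINT \<xi>. LBINT s. indicator {0..t} s *\<^sub>R (heat_symbol (t - s) \<xi> * convolution a (P m s) \<xi> * \<psi> \<xi>))"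
    by (intro Bochner_Integration.integral_add wbound_integrable(1)[OF hb \<psi>] lborel_pair.integrable_fst[OF P_kernel_integrable[OF assms]])
  also have "(LBINT \<xi>. LBINT s. indicator {0..t} s *\<^sub>R (heat_symbol (t - s) \<xi> * convolution a (P m s) \<xi> * \<psi> \<xi>))
     = (LBINT s. LBINT \<xi>. indicator {0..t} s *\<^sub>R (heat_symbol (t - s) \<xi> * convolution a (P m s) \<xi> * \<psi> \<xi>))"
    by (rule lborel_pair.Fubini_integral[OF P_kernel_integrable[OF assms], symmetric])
  also have "\<dots> = (LBINT s:{0..t}. Bform (P m s) (\<lambda>\<xi>. heat_symbol (t - s) \<xi> * \<psi> \<xi>))"
    unfolding set_lebesgue_integral_def Bform_def by (simp add: mult_ac)
  finally show ?thesis .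
qed

text \<open>The dual counterpart of \<open>duhamel_le\<close>: after exchanging the integrals, the
  heat factor turns the weight of \<open>U\<close> into that of \<open>W\<close>, uniformly in
  \<open>t\<close>.\<close>

lemma time_integral_U_le:
  assumes \<psi>: "\<psi> \<in> schwartz" and t: "t \<ge> 0"
  shows "integrable lborel (\<lambda>s. indicator {0..t} s * U (\<lambda>\<xi>. heat_symbol (t - s) \<xi> * \<psi> \<xi>))"
    and "(LBINT s. indicator {0..t} s * U (\<lambda>\<xi>. heat_symbol (t - s) \<xi> * \<psi> \<xi>)) \<le> W \<psi> / (4 * pi\<^sup>2)"
proof -
  note [measurable] = schwartz_measurable[OF \<psi>]
  let ?f = "\<lambda>\<xi> s. indicator {0..t} s * (norm \<xi> powr (- (k - 2)) * norm (heat_symbol (t - s) \<xi> * \<psi> \<xi>))"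
  have int: "integrable (lborel \<Otimes>\<^sub>M lborel) (\<lambda>(\<xi>, s). ?f \<xi> s)"
  proof (rule lborel_pair_integrable_bound[where g = "\<lambda>\<xi>. norm \<xi> powr (- (k - 2)) * norm (\<psi> \<xi>)" and h = "indicator {0..t} :: real \<Rightarrow> real"])
    show "integrable lborel (\<lambda>\<xi>. norm \<xi> powr (- (k - 2)) * norm (\<psi> \<xi>))" by (rule U_integrable[OF \<psi>])
    show "integrable lborel (indicator {0..t} :: real \<Rightarrow> real)" by (intro integrable_real_indicator) (auto simp: emeasure_lborel_Icc_eq)
    show "AE \<xi> in lborel. \<forall>s. norm (?f \<xi> s) \<le> norm (norm \<xi> powr (- (k - 2)) * norm (\<psi> \<xi>)) * norm (indicator {0..t} s :: real)"
      by (intro AE_I2 allI) (auto simp: indicator_def norm_mult intro!: mult_left_mono mult_left_le_one_le norm_heat_symbol_le_1)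
  qed measurable
  show "integrable lborel (\<lambda>s. indicator {0..t} s * U (\<lambda>\<xi>. heat_symbol (t - s) \<xi> * \<psi> \<xi>))"
    using lborel_pair.integrable_snd[OF int] unfolding U_def by simp
  have "(LBINT s. indicator {0..t} s * U (\<lambda>\<xi>. heat_symbol (t - s) \<xi> * \<psi> \<xi>)) = (LBINT \<xi>. LBINT s. ?f \<xi> s)"
    unfolding U_def using lborel_pair.Fubini_integral[OF int] by simp
  also have "\<dots> \<le> (LBINT \<xi>. norm \<xi> powr (- k) * norm (\<psi> \<xi>) * (1 / (4 * pi\<^sup>2)))"
  proof (rule integral_mono_AE[OF lborel_pair.integrable_fst[OF int]])
    show "integrable lborel (\<lambda>\<xi>. norm \<xi> powr (- k) * norm (\<psi> \<xi>) * (1 / (4 * pi\<^sup>2)))"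
      by (intro integrable_mult_left W_integrable \<psi>)
    show "AE \<xi> in lborel. (LBINT s. ?f \<xi> s) \<le> norm \<xi> powr (- k) * norm (\<psi> \<xi>) * (1 / (4 * pi\<^sup>2))"
      using AE_lborel_singleton[of 0]
    proof eventually_elim
      case (elim \<xi>)
      define A where "A = 4 * pi\<^sup>2 * (norm \<xi>)\<^sup>2"
      have A: "A > 0" using elim by (simp add: A_def)
      have "(LBINT s. ?f \<xi> s) = (LBINT s. (indicator {0..t} s * exp (- A * (t - s))) * (norm \<xi> powr (- (k - 2)) * norm (\<psi> \<xi>)))"
        by (intro Bochner_Integration.integral_cong refl) (simp add: norm_mult norm_heat_symbol A_def mult_ac)
      also have "\<dots> = (LBINT s. indicator {0..t} s * exp (- A * (t - s))) * (norm \<xi> powr (- (k - 2)) * norm (\<psi> \<xi>))" by simp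
      also have "\<dots> \<le> (1 / A) * (norm \<xi> powr (- (k - 2)) * norm (\<psi> \<xi>))"
        by (intro mult_right_mono exp_decay_integral A) auto
      also have "\<dots> = norm \<xi> powr (- k) * norm (\<psi> \<xi>) * (1 / (4 * pi\<^sup>2))"
      proof -
        have "norm \<xi> powr (- (k - 2)) = norm \<xi> powr (- k) * (norm \<xi>)\<^sup>2"
          using elim by (simp add: powr_add[symmetric] powr_realpow[symmetric] del: powr_numeral)
        then show ?thesis using elim by (simp add: A_def)
      qed
      finally show ?case .
    qed
  qed
  also have "\<dots> = W \<psi> / (4 * pi\<^sup>2)" by (simp add: W_def)
  finally show "(LBINT s. indicator {0..t} s * U (\<lambda>\<xi>. heat_symbol (t - s) \<xi> * \<psi> \<xi>)) \<le> W \<psi> / (4 * pi\<^sup>2)" .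
qed

definition is_sol :: "(real \<Rightarrow> real^'n \<Rightarrow> complex) \<Rightarrow> bool" where
  "is_sol f \<longleftrightarrow> (\<forall>t\<ge>0. \<forall>\<psi>\<in>schwartz. (LBINT \<xi>. f t \<xi> * \<psi> \<xi>) = (LBINT \<xi>. heat_symbol t \<xi> * b \<xi> * \<psi> \<xi>)
     + (LBINT s:{0..t}. Bform (f s) (\<lambda>\<xi>. heat_symbol (t - s) \<xi> * \<psi> \<xi>)))"

text \<open>Subtracting the two weak equations cancels the free term. The induction hypothesis at
  earlier times, for all test functions, is a weak bound that \<open>Bform_le_weak\<close> carries
  through the convolution at the cost of \<open>L\<close>; the time integral divides by 4 \<pi>^2,
  so each step gains the factor \<open>q\<close>.\<close>

lemma picard_error:
  assumes f: "\<And>s. s \<ge> 0 \<Longrightarrow> wbound N (f s)" and wc: "weakly_continuous f" and sol: "is_sol f"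
    and "t \<ge> 0" "\<psi> \<in> schwartz"
  shows "norm (LBINT \<xi>. (f t \<xi> - P m t \<xi>) * \<psi> \<xi>) \<le> q ^ m * N * W \<psi>"
  using assms(4,5)
proof (induction m arbitrary: t \<psi>)
  case 0 then show ?case using wbound_integrable(2)[OF f] by simp
next
  case (Suc m)
  note t = Suc.prems(1) note \<psi> = Suc.prems(2)
  have N: "N \<ge> 0" using wbound_nonneg[OF f[of 0]] by simp
  let ?h = "\<lambda>s \<xi>. heat_symbol (t - s) \<xi> * \<psi> \<xi>"
  have h: "?h s \<in> schwartz" if "s \<in> {0..t}" for s using that by (intro schwartz_heat_mult \<psi>) auto
  have "(LBINT \<xi>. (f t \<xi> - P (Suc m) t \<xi>) * \<psi> \<xi>) = (LBINT \<xi>. f t \<xi> * \<psi> \<xi>) - (LBINT \<xi>. P (Suc m) t \<xi> * \<psi> \<xi>)"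
    unfolding left_diff_distrib
    by (intro Bochner_Integration.integral_diff wbound_integrable(1)[OF f] wbound_integrable(1)[OF P_wbound] t \<psi>)
  also have "\<dots> = (LBINT s:{0..t}. Bform (f s) (?h s)) - (LBINT s:{0..t}. Bform (P m s) (?h s))"
    using sol t \<psi> unfolding is_sol_def P_Suc_pairing[OF \<psi> t] by simp
  also have "\<dots> = (LBINT s:{0..t}. Bform (f s) (?h s) - Bform (P m s) (?h s))"
    by (intro set_integral_diff(2)[symmetric] weakly_continuous_time_integrable[OF f wc \<psi>] P_time_integrable \<psi> t) auto
  also have "norm \<dots> \<le> (LBINT s. norm (indicator {0..t} s *\<^sub>R (Bform (f s) (?h s) - Bform (P m s) (?h s))))"
    unfolding set_lebesgue_integral_def by (rule integral_norm_bound)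
  also have "\<dots> \<le> (LBINT s. (q ^ m * N * L) * (indicator {0..t} s * U (?h s)))"
  proof (rule integral_mono')
    show "integrable lborel (\<lambda>s. (q ^ m * N * L) * (indicator {0..t} s * U (?h s)))"
      by (intro integrable_mult_right time_integral_U_le \<psi> t)
    fix s
    show "norm (indicator {0..t} s *\<^sub>R (Bform (f s) (?h s) - Bform (P m s) (?h s))) \<le> (q ^ m * N * L) * (indicator {0..t} s * U (?h s))"
    proof (cases "s \<in> {0..t}")
      case True
      then have s: "s \<ge> 0" by simp
      \<comment> \<open>The induction hypothesis enters as the weak bound with \<rho> = q^m
        N.\<close>
      have "norm (Bform (\<lambda>\<xi>. f s \<xi> - P m s \<xi>) (?h s)) \<le> (q ^ m * N) * (L * U (?h s))"
        using q N by (intro Bform_le_weak[OF wbound_diff[OF f P_wbound]] Suc.IH h True s) auto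
      then have "norm (Bform (f s) (?h s) - Bform (P m s) (?h s)) \<le> (q ^ m * N) * (L * U (?h s))"
        unfolding Bform_diff[OF f[OF s] P_wbound[OF s] h[OF True]] .
      then show ?thesis using True by (simp add: mult_ac)
    qed auto
    have "U (?h s) \<ge> 0" unfolding U_def by (intro integral_nonneg_AE AE_I2) auto
    then show "0 \<le> (q ^ m * N * L) * (indicator {0..t} s * U (?h s))"
      using q N L_nonneg by (intro mult_nonneg_nonneg) auto
  qed
  also have "\<dots> = (q ^ m * N * L) * (LBINT s. indicator {0..t} s * U (?h s))" by simp
  also have "\<dots> \<le> (q ^ m * N * L) * (W \<psi> / (4 * pi\<^sup>2))"
    using q N L_nonneg by (intro mult_left_mono time_integral_U_le \<psi> t mult_nonneg_nonneg) auto
  also have "\<dots> = q ^ Suc m * N * W \<psi>" by (simp add: q(1))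
  finally show ?case .
qed

text \<open>The limit is the same for every solution in the class, so properties stable under limits
  of pairings can be proved on the iterates.\<close>

theorem picard_limit:
  assumes f: "\<And>s. s \<ge> 0 \<Longrightarrow> wbound N (f s)" and wc: "weakly_continuous f" and sol: "is_sol f"
    and t: "t \<ge> 0" and \<psi>: "\<psi> \<in> schwartz"
  shows "(\<lambda>m. LBINT \<xi>. P m t \<xi> * \<psi> \<xi>) \<longlonglongrightarrow> (LBINT \<xi>. f t \<xi> * \<psi> \<xi>)"
proof -
  have d: "(LBINT \<xi>. (f t \<xi> - P m t \<xi>) * \<psi> \<xi>) = (LBINT \<xi>. f t \<xi> * \<psi> \<xi>) - (LBINT \<xi>. P m t \<xi> * \<psi> \<xi>)" for m
    unfolding left_diff_distrib
    by (intro Bochner_Integration.integral_diff wbound_integrable(1)[OF f] wbound_integrable(1)[OF P_wbound] t \<psi>)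
  have "(\<lambda>m. (LBINT \<xi>. f t \<xi> * \<psi> \<xi>) - (LBINT \<xi>. P m t \<xi> * \<psi> \<xi>)) \<longlonglongrightarrow> 0"
  proof (rule Lim_null_comparison[where g = "\<lambda>m. q ^ m * N * W \<psi>"])
    show "\<forall>\<^sub>F m in sequentially. norm ((LBINT \<xi>. f t \<xi> * \<psi> \<xi>) - (LBINT \<xi>. P m t \<xi> * \<psi> \<xi>)) \<le> q ^ m * N * W \<psi>"
      using picard_error[OF f wc sol t \<psi>] unfolding d by (intro always_eventually allI)
    have "(\<lambda>m. q ^ m) \<longlonglongrightarrow> 0" by (rule LIMSEQ_realpow_zero[OF q(2) q(3)])
    then show "(\<lambda>m. q ^ m * N * W \<psi>) \<longlonglongrightarrow> 0" by (intro tendsto_mult_left_zero)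
  qed
  from tendsto_diff[OF tendsto_const[of "LBINT \<xi>. f t \<xi> * \<psi> \<xi>"] this] show ?thesis by simp
qed

end

section \<open>Positivity on the Fourier side\<close>

lemma complex_nonneg_iff: "0 \<le> (z::complex) \<longleftrightarrow> 0 \<le> Re z \<and> Im z = 0"
  by (auto simp: less_eq_complex_def)

lemma complex_of_real_nonneg: "0 \<le> r \<Longrightarrow> 0 \<le> complex_of_real r"
  by (simp add: complex_nonneg_iff)

lemma complex_integral_nonneg:
  fixes f :: "'a \<Rightarrow> complex"
  assumes "\<And>x. x \<in> space S \<Longrightarrow> 0 \<le> f x"
  shows "0 \<le> (LINT x|S. f x)"
proof (cases "integrable S f")
  case True
  have "(LINT x|S. f x) = (LINT x|S. complex_of_real (Re (f x)))"
    using assms by (intro Bochner_Integration.integral_cong refl) (auto simp: complex_nonneg_iff complex_eq_iff)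
  also have "\<dots> = complex_of_real (LINT x|S. Re (f x))" by simp
  also have "0 \<le> \<dots>"
    using assms by (intro complex_of_real_nonneg integral_nonneg_AE AE_I2) (auto simp: complex_nonneg_iff)
  finally show ?thesis .
next
  \<comment> \<open>No integrability is assumed, because the default value 0 of the integral is
    nonnegative.\<close>
  case False then show ?thesis by (simp add: not_integrable_integral_eq)
qed

lemma complex_LIMSEQ_nonneg:
  fixes X :: "nat \<Rightarrow> complex"
  assumes "X \<longlonglongrightarrow> z" "\<And>j. 0 \<le> X j"
  shows "0 \<le> z"
proof -
  have "0 \<le> Re z" by (rule LIMSEQ_le_const[OF tendsto_Re[OF assms(1)]]) (use assms(2) in \<open>auto simp: complex_nonneg_iff\<close>)
  moreover have "(\<lambda>j. Im (X j)) \<longlonglongrightarrow> Im z" by (rule tendsto_Im[OF assms(1)])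
  then have "Im z = 0" using assms(2) by (simp add: complex_nonneg_iff LIMSEQ_const_iff)
  ultimately show ?thesis by (simp add: complex_nonneg_iff)
qed

text \<open>Its Fourier transform is a positive Gaussian centred at \<open>x\<close>, so pairing it
  with the transform of a distribution T evaluates a Gaussian average of T at \<open>x\<close>, up
  to a positive factor.\<close>

definition gtest :: "real \<Rightarrow> real^'n::finite \<Rightarrow> real^'n \<Rightarrow> complex" where
  "gtest c x = (\<lambda>\<xi>. complex_of_real (exp (- c * (norm \<xi>)\<^sup>2)) * cis (2 * pi * (x \<bullet> \<xi>)))"

lemma gtest_schwartz: "c > 0 \<Longrightarrow> gtest c x \<in> schwartz"
  unfolding gtest_def by (rule schwartz_gaussian_cis)

lemma gtest_measurable[measurable (raw)]:
  assumes [measurable]: "f \<in> borel_measurable S" "g \<in> borel_measurable S"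
  shows "(\<lambda>z. gtest c (f z) (g z)) \<in> borel_measurable S"
  unfolding gtest_def by measurable

lemma fourier_gtest_nonneg: "c > 0 \<Longrightarrow> 0 \<le> fourier (gtest c x) y"
  unfolding gtest_def by (subst fourier_gaussian_cis, assumption) (rule complex_of_real_nonneg, simp)

lemma norm_gtest: "norm (gtest c x \<xi>) = exp (- c * (norm \<xi>)\<^sup>2)"
  by (simp add: gtest_def norm_mult)

lemma gtest_0_mult_cis: "gtest c 0 \<xi> * cis (2 * pi * (x \<bullet> \<xi>)) = gtest c x \<xi>"
  by (simp add: gtest_def)

text \<open>The heat flow only increases the parameter \<open>c\<close>, so the family of tests is
  preserved.\<close>

lemma heat_mult_gtest: "heat_symbol t \<xi> * gtest c x \<xi> = gtest (c + 4 * pi\<^sup>2 * t) x \<xi>"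
proof -
  have "exp (- 4 * pi\<^sup>2 * (norm \<xi>)\<^sup>2 * t) * exp (- c * (norm \<xi>)\<^sup>2) = exp (- (c + 4 * pi\<^sup>2 * t) * (norm \<xi>)\<^sup>2)"
    by (simp add: exp_add[symmetric] algebra_simps)
  then show ?thesis unfolding gtest_def heat_symbol_def by (simp only: mult.assoc[symmetric] of_real_mult[symmetric])
qed

lemma heat_eq_gtest: "heat_symbol t \<xi> = gtest (4 * pi\<^sup>2 * t) 0 \<xi>"
  by (simp add: heat_symbol_def gtest_def mult_ac)

text \<open>A distribution whose Fourier transform is a function \<open>g\<close> is nonnegative if and only
  if its convolutions with Gaussians are; the latter are the integrals below.\<close>

definition gauss_nonneg :: "(real^'n::finite \<Rightarrow> complex) \<Rightarrow> bool" where
  "gauss_nonneg g \<longleftrightarrow> (\<forall>c>0. \<forall>x. 0 \<le> (LBINT \<xi>. g \<xi> * gtest c x \<xi>))"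

text \<open>The damping factor together with the character in \<open>inv_fourier\<close> forms a
  modulated Gaussian; Fubini then shows that the damped pairing integrates \<phi> against the
  Gaussian averages.\<close>

lemma
  fixes g :: "real^'n::finite \<Rightarrow> complex"
  assumes [measurable]: "g \<in> borel_measurable borel"
    and int: "\<And>\<psi>. \<psi> \<in> schwartz \<Longrightarrow> integrable lborel (\<lambda>\<xi>. g \<xi> * \<psi> \<xi>)"
    and c: "c > 0" and \<phi>: "\<phi> \<in> schwartz"
  shows gtest_pairing: "(LBINT \<xi>. g \<xi> * gtest c 0 \<xi> * inv_fourier \<phi> \<xi>) = (LBINT x. \<phi> x * (LBINT \<xi>. g \<xi> * gtest c x \<xi>))"
    and gtest_pairing_integrable: "integrable lborel (\<lambda>x. \<phi> x * (LBINT \<xi>. g \<xi> * gtest c x \<xi>))"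
proof -
  note [measurable] = schwartz_measurable[OF \<phi>]
  have I: "integrable (lborel \<Otimes>\<^sub>M lborel) (\<lambda>(\<xi>, x). g \<xi> * gtest c x \<xi> * \<phi> x)"
    by (rule lborel_pair_integrable_bound[OF _ int[OF gtest_schwartz[OF c, of 0]] schwartz_integrable[OF \<phi>]])
       (auto simp: norm_mult norm_gtest)
  have "(LBINT \<xi>. g \<xi> * gtest c 0 \<xi> * inv_fourier \<phi> \<xi>) = (LBINT \<xi>. LBINT x. g \<xi> * gtest c x \<xi> * \<phi> x)"
  proof (intro Bochner_Integration.integral_cong refl)
    fix \<xi>
    have "g \<xi> * gtest c 0 \<xi> * inv_fourier \<phi> \<xi> = (LBINT x. g \<xi> * gtest c 0 \<xi> * (\<phi> x * cis (2 * pi * (\<xi> \<bullet> x))))"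
      unfolding inv_fourier_cis by simp
    also have "\<dots> = (LBINT x. g \<xi> * gtest c x \<xi> * \<phi> x)"
    proof (intro Bochner_Integration.integral_cong refl)
      fix x
      show "g \<xi> * gtest c 0 \<xi> * (\<phi> x * cis (2 * pi * (\<xi> \<bullet> x))) = g \<xi> * gtest c x \<xi> * \<phi> x"
        using gtest_0_mult_cis[of c \<xi> x] by (simp only: inner_commute[of \<xi> x] mult_ac)
    qed
    finally show "g \<xi> * gtest c 0 \<xi> * inv_fourier \<phi> \<xi> = (LBINT x. g \<xi> * gtest c x \<xi> * \<phi> x)" .
  qed
  also have "\<dots> = (LBINT x. LBINT \<xi>. g \<xi> * gtest c x \<xi> * \<phi> x)"
    by (rule lborel_pair.Fubini_integral[OF I, symmetric])
  also have "\<dots> = (LBINT x. \<phi> x * (LBINT \<xi>. g \<xi> * gtest c x \<xi>))"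
    by (simp add: mult.commute)
  finally show "(LBINT \<xi>. g \<xi> * gtest c 0 \<xi> * inv_fourier \<phi> \<xi>) = (LBINT x. \<phi> x * (LBINT \<xi>. g \<xi> * gtest c x \<xi>))" .
  show "integrable lborel (\<lambda>x. \<phi> x * (LBINT \<xi>. g \<xi> * gtest c x \<xi>))"
    using lborel_pair.integrable_snd[OF I] by (simp add: mult.commute)
qed

text \<open>For fixed damping the pairing integrates a product of nonnegative functions; removing
  the damping by dominated convergence preserves the sign.\<close>

lemma gauss_nonneg_pairing:
  fixes g :: "real^'n::finite \<Rightarrow> complex"
  assumes g[measurable]: "g \<in> borel_measurable borel"
    and int: "\<And>\<psi>. \<psi> \<in> schwartz \<Longrightarrow> integrable lborel (\<lambda>\<xi>. g \<xi> * \<psi> \<xi>)"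
    and pos: "gauss_nonneg g" and \<phi>: "\<phi> \<in> schwartz" "\<And>x. 0 \<le> \<phi> x"
  shows "0 \<le> (LBINT \<xi>. g \<xi> * inv_fourier \<phi> \<xi>)"
proof (rule complex_LIMSEQ_nonneg)
  note [measurable] = schwartz_measurable[OF schwartz_inv_fourier[OF \<phi>(1)]]
  define c where "c j = 1 / real (Suc j)" for j
  have c: "c j > 0" "c \<longlonglongrightarrow> 0" for j
    using LIMSEQ_inverse_real_of_nat unfolding c_def by (simp_all only: inverse_eq_divide) simp
  show "(\<lambda>j. LBINT \<xi>. g \<xi> * gtest (c j) 0 \<xi> * inv_fourier \<phi> \<xi>) \<longlonglongrightarrow> (LBINT \<xi>. g \<xi> * inv_fourier \<phi> \<xi>)"
  proof (rule integral_dominated_convergence[where w = "\<lambda>\<xi>. norm (g \<xi> * inv_fourier \<phi> \<xi>)"])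
    show "integrable lborel (\<lambda>\<xi>. norm (g \<xi> * inv_fourier \<phi> \<xi>))"
      by (intro integrable_norm int schwartz_inv_fourier \<phi>)
    have "(\<lambda>j. gtest (c j) 0 \<xi>) \<longlonglongrightarrow> 1" for \<xi> :: "real^'n"
      unfolding gtest_def by (auto intro!: tendsto_eq_intros c(2))
    then have "(\<lambda>j. g \<xi> * gtest (c j) 0 \<xi> * inv_fourier \<phi> \<xi>) \<longlonglongrightarrow> g \<xi> * 1 * inv_fourier \<phi> \<xi>" for \<xi>
      by (intro tendsto_mult tendsto_const)
    then show "AE \<xi> in lborel. (\<lambda>j. g \<xi> * gtest (c j) 0 \<xi> * inv_fourier \<phi> \<xi>) \<longlonglongrightarrow> g \<xi> * inv_fourier \<phi> \<xi>"
      by simp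
    have "norm (gtest (c j) 0 \<xi>) \<le> 1" for j and \<xi> :: "real^'n" using c(1)[of j] by (simp add: norm_gtest)
    then show "AE \<xi> in lborel. norm (g \<xi> * gtest (c j) 0 \<xi> * inv_fourier \<phi> \<xi>) \<le> norm (g \<xi> * inv_fourier \<phi> \<xi>)" for j
      unfolding norm_mult by (intro AE_I2 mult_right_mono mult_right_le_one_le) auto
  qed measurable
  show "0 \<le> (LBINT \<xi>. g \<xi> * gtest (c j) 0 \<xi> * inv_fourier \<phi> \<xi>)" for j
  proof -
    have "(LBINT \<xi>. g \<xi> * gtest (c j) 0 \<xi> * inv_fourier \<phi> \<xi>) = (LBINT x. \<phi> x * (LBINT \<xi>. g \<xi> * gtest (c j) x \<xi>))"
      by (rule gtest_pairing[OF g int c(1) \<phi>(1)])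
    also have "0 \<le> \<dots>"
      using pos c(1) \<phi>(2) by (intro complex_integral_nonneg, intro mult_nonneg_nonneg) (auto simp: gauss_nonneg_def)
    finally show ?thesis .
  qed
qed

context perturbed_heat
begin

text \<open>Correlation becomes multiplication. The first factor is a Gaussian average of the
  potential near \<open>y\<close>, so \<open>chi\<close> is the Fourier side of multiplying by a
  smoothed potential.\<close>

lemma fourier_chi:
  assumes \<phi>: "\<phi> \<in> schwartz"
  shows "fourier (chi j \<phi>) y = (LBINT \<zeta>. a \<zeta> * gtest (1 / real (Suc j)) y \<zeta>) * fourier \<phi> y"
proof -
  note [measurable] = schwartz_measurable[OF \<phi>]
  have \<phi>i: "integrable lborel \<phi>" by (rule schwartz_integrable[OF \<phi>])
  have I: "integrable (lborel \<Otimes>\<^sub>M lborel) (\<lambda>(\<zeta>, \<eta>). areg j \<zeta> * \<phi> (\<zeta> + \<eta>) * cis (- (2 * pi) * (y \<bullet> \<eta>)))"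
  proof (rule lborel_pair_integrableI)
    have "(\<integral>\<^sup>+\<zeta>. (\<integral>\<^sup>+\<eta>. ennreal (norm (areg j \<zeta> * \<phi> (\<zeta> + \<eta>) * cis (- (2 * pi) * (y \<bullet> \<eta>)))) \<partial>lborel) \<partial>lborel)
      = (\<integral>\<^sup>+\<zeta>. ennreal (norm (areg j \<zeta>)) * (\<integral>\<^sup>+\<eta>. ennreal (norm (\<phi> (\<zeta> + \<eta>))) \<partial>lborel) \<partial>lborel)"
      by (simp add: norm_mult ennreal_mult' nn_integral_cmult)
    also have "\<dots> = (\<integral>\<^sup>+\<zeta>. ennreal (norm (areg j \<zeta>)) \<partial>lborel) * (\<integral>\<^sup>+\<eta>. ennreal (norm (\<phi> \<eta>)) \<partial>lborel)"
      using nn_integral_translate[of "\<lambda>x. ennreal (norm (\<phi> x))"] by (simp add: nn_integral_multc)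
    also have "\<dots> < \<infinity>"
      using areg_moments[of 0 j] \<phi>i by (simp add: integrable_iff_bounded ennreal_mult_less_top)
    finally show "(\<integral>\<^sup>+\<zeta>. (\<integral>\<^sup>+\<eta>. ennreal (norm (areg j \<zeta> * \<phi> (\<zeta> + \<eta>) * cis (- (2 * pi) * (y \<bullet> \<eta>)))) \<partial>lborel) \<partial>lborel) < \<infinity>" .
  qed measurable
  have "fourier (chi j \<phi>) y = (LBINT \<eta>. LBINT \<zeta>. areg j \<zeta> * \<phi> (\<zeta> + \<eta>) * cis (- (2 * pi) * (y \<bullet> \<eta>)))"
    unfolding fourier_cis chi_def by simp
  also have "\<dots> = (LBINT \<zeta>. LBINT \<eta>. areg j \<zeta> * \<phi> (\<zeta> + \<eta>) * cis (- (2 * pi) * (y \<bullet> \<eta>)))"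
    by (rule lborel_pair.Fubini_integral[OF I])
  also have "\<dots> = (LBINT \<zeta>. a \<zeta> * gtest (1 / real (Suc j)) y \<zeta> * fourier \<phi> y)"
  proof (intro Bochner_Integration.integral_cong refl)
    fix \<zeta>
    have "(LBINT \<eta>. areg j \<zeta> * \<phi> (\<zeta> + \<eta>) * cis (- (2 * pi) * (y \<bullet> \<eta>)))
      = (LBINT \<eta>. (areg j \<zeta> * cis (2 * pi * (y \<bullet> \<zeta>))) * (\<phi> (\<zeta> + \<eta>) * cis (- (2 * pi) * (y \<bullet> (\<zeta> + \<eta>)))))"
    proof (intro Bochner_Integration.integral_cong refl)
      fix \<eta>
      have "cis (- (2 * pi) * (y \<bullet> \<eta>)) = cis (2 * pi * (y \<bullet> \<zeta>)) * cis (- (2 * pi) * (y \<bullet> (\<zeta> + \<eta>)))"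
        by (simp add: cis_mult inner_add_right algebra_simps)
      then show "areg j \<zeta> * \<phi> (\<zeta> + \<eta>) * cis (- (2 * pi) * (y \<bullet> \<eta>)) = (areg j \<zeta> * cis (2 * pi * (y \<bullet> \<zeta>))) * (\<phi> (\<zeta> + \<eta>) * cis (- (2 * pi) * (y \<bullet> (\<zeta> + \<eta>))))"
        by (simp only: mult_ac)
    qed
    also have "\<dots> = (areg j \<zeta> * cis (2 * pi * (y \<bullet> \<zeta>))) * (LBINT \<eta>. \<phi> (\<zeta> + \<eta>) * cis (- (2 * pi) * (y \<bullet> (\<zeta> + \<eta>))))"
      by simp
    also have "(LBINT \<eta>. \<phi> (\<zeta> + \<eta>) * cis (- (2 * pi) * (y \<bullet> (\<zeta> + \<eta>)))) = fourier \<phi> y"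
      unfolding fourier_cis by (rule lebesgue_integral_translate[of "\<lambda>x. \<phi> x * cis (- (2 * pi) * (y \<bullet> x))"]) measurable
    also have "areg j \<zeta> * cis (2 * pi * (y \<bullet> \<zeta>)) = a \<zeta> * gtest (1 / real (Suc j)) y \<zeta>"
      by (simp add: areg_def gtest_def)
    finally show "(LBINT \<eta>. areg j \<zeta> * \<phi> (\<zeta> + \<eta>) * cis (- (2 * pi) * (y \<bullet> \<eta>))) = a \<zeta> * gtest (1 / real (Suc j)) y \<zeta> * fourier \<phi> y" .
  qed
  finally show ?thesis by simp
qed

text \<open>The product of two distributions need not make sense, but a smoothed potential times a
  positive Gaussian is a nonnegative Schwartz function. Its inverse transform is
  \<open>chi j\<close>, so \<open>g\<close> pairs with it nonnegatively, and the limit in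
  \<open>j\<close> gives the sign of \<open>Bform\<close>.\<close>

lemma Bform_gtest_nonneg:
  assumes a: "gauss_nonneg a" and g: "wbound N g" "gauss_nonneg g" and c: "c > 0"
  shows "0 \<le> Bform g (gtest c x)"
proof (rule complex_LIMSEQ_nonneg[OF chi_pairing_tendsto[OF g(1) gtest_schwartz[OF c]]])
  fix j
  have S: "chi j (gtest c x) \<in> schwartz" by (intro chi_schwartz gtest_schwartz c)
  have "0 \<le> (LBINT \<eta>. g \<eta> * inv_fourier (fourier (chi j (gtest c x))) \<eta>)"
  proof (rule gauss_nonneg_pairing[OF wbound_meas[OF g(1)] wbound_integrable(1)[OF g(1)] g(2) schwartz_fourier[OF S]])
    fix y
    have "0 \<le> (LBINT \<zeta>. a \<zeta> * gtest (1 / real (Suc j)) y \<zeta>)" using a by (simp add: gauss_nonneg_def)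
    then show "0 \<le> fourier (chi j (gtest c x)) y"
      unfolding fourier_chi[OF gtest_schwartz[OF c]] by (intro mult_nonneg_nonneg fourier_gtest_nonneg c)
  qed
  then show "0 \<le> (LBINT \<eta>. g \<eta> * chi j (gtest c x) \<eta>)" by (simp add: inv_fourier_fourier[OF S])
qed

lemma P_gauss_nonneg:
  assumes a: "gauss_nonneg a" and b: "gauss_nonneg b" and t: "t \<ge> 0"
  shows "gauss_nonneg (P m t)"
  using t
proof (induction m arbitrary: t)
  case 0 then show ?case by (simp add: gauss_nonneg_def)
next
  case (Suc m)
  show ?case unfolding gauss_nonneg_def
  proof (intro allI impI)
    fix c :: real and x :: "real^'n" assume c: "c > 0"
    have "(LBINT \<xi>. heat_symbol t \<xi> * b \<xi> * gtest c x \<xi>) = (LBINT \<xi>. b \<xi> * gtest (c + 4 * pi\<^sup>2 * t) x \<xi>)"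
      unfolding heat_mult_gtest[symmetric] by (simp only: mult_ac)
    also have "0 \<le> \<dots>" using b c Suc.prems by (simp add: gauss_nonneg_def add_pos_nonneg)
    finally have 1: "0 \<le> (LBINT \<xi>. heat_symbol t \<xi> * b \<xi> * gtest c x \<xi>)" .
    have "0 \<le> indicator {0..t} s *\<^sub>R Bform (P m s) (\<lambda>\<xi>. heat_symbol (t - s) \<xi> * gtest c x \<xi>)" for s
    proof (cases "s \<in> {0..t}")
      case True
      then have "0 \<le> Bform (P m s) (gtest (c + 4 * pi\<^sup>2 * (t - s)) x)"
        using c by (intro Bform_gtest_nonneg[OF a P_wbound] Suc.IH) (auto simp: add_pos_nonneg)
      then show ?thesis using True by (simp add: heat_mult_gtest)
    qed auto
    then have 2: "0 \<le> (LBINT s:{0..t}. Bform (P m s) (\<lambda>\<xi>. heat_symbol (t - s) \<xi> * gtest c x \<xi>))"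
      unfolding set_lebesgue_integral_def by (rule complex_integral_nonneg)
    show "0 \<le> (LBINT \<xi>. P (Suc m) t \<xi> * gtest c x \<xi>)"
      unfolding P_Suc_pairing[OF gtest_schwartz[OF c] Suc.prems] using 1 2 by (simp add: complex_nonneg_iff)
  qed
qed

text \<open>A limit of positive numbers is only nonnegative. The free solution is therefore
  subtracted before passing to the limit and supplies strictness separately.\<close>

lemma solution_minus_free_nonneg:
  assumes a: "gauss_nonneg a" and b: "gauss_nonneg b"
    and f: "\<And>s. s \<ge> 0 \<Longrightarrow> wbound N (f s)" "weakly_continuous f" "is_sol f"
    and t: "t \<ge> 0" and \<phi>: "\<phi> \<in> schwartz" "\<And>x. 0 \<le> \<phi> x"
  shows "0 \<le> (LBINT \<xi>. f t \<xi> * inv_fourier \<phi> \<xi>) - (LBINT \<xi>. heat_symbol t \<xi> * b \<xi> * inv_fourier \<phi> \<xi>)"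
proof (rule complex_LIMSEQ_nonneg)
  let ?\<psi> = "inv_fourier \<phi>"
  have \<psi>: "?\<psi> \<in> schwartz" by (rule schwartz_inv_fourier[OF \<phi>(1)])
  \<comment> \<open>Successor iterates, because \<open>P 0\<close> is zero and does not contain the
    free term.\<close>
  show "(\<lambda>m. (LBINT \<xi>. P (Suc m) t \<xi> * ?\<psi> \<xi>) - (LBINT \<xi>. heat_symbol t \<xi> * b \<xi> * ?\<psi> \<xi>)) \<longlonglongrightarrow>
    (LBINT \<xi>. f t \<xi> * ?\<psi> \<xi>) - (LBINT \<xi>. heat_symbol t \<xi> * b \<xi> * ?\<psi> \<xi>)"
    by (intro tendsto_diff tendsto_const LIMSEQ_Suc picard_limit[OF f t \<psi>])
  fix m
  have "0 \<le> indicator {0..t} s *\<^sub>R Bform (P m s) (\<lambda>\<xi>. heat_symbol (t - s) \<xi> * ?\<psi> \<xi>)" for s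
  proof (cases "s \<in> {0..t}")
    case True
    then have s: "s \<ge> 0" "t - s \<ge> 0" by auto
    note Pm = P_wbound[OF s(1), of m]
    note [measurable] = wbound_meas[OF Pm]
    have "0 \<le> (LBINT \<xi>. (convolution a (P m s) \<xi> * heat_symbol (t - s) \<xi>) * ?\<psi> \<xi>)"
    proof (rule gauss_nonneg_pairing[OF _ _ _ \<phi>])
      show "integrable lborel (\<lambda>\<xi>. convolution a (P m s) \<xi> * heat_symbol (t - s) \<xi> * \<psi> \<xi>)" if "\<psi> \<in> schwartz" for \<psi>
        using Bform_integrable[OF Pm schwartz_heat_mult[OF that s(2)]] by (simp add: mult.assoc)
      show "gauss_nonneg (\<lambda>\<xi>. convolution a (P m s) \<xi> * heat_symbol (t - s) \<xi>)"
        unfolding gauss_nonneg_def mult.assoc heat_mult_gtest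
        using Bform_gtest_nonneg[OF a Pm P_gauss_nonneg[OF a b s(1)]] s(2)
        by (auto simp: Bform_def add_pos_nonneg)
    qed measurable
    then show ?thesis using True by (simp add: Bform_def mult.assoc)
  qed auto
  then have "0 \<le> (LBINT s:{0..t}. Bform (P m s) (\<lambda>\<xi>. heat_symbol (t - s) \<xi> * ?\<psi> \<xi>))"
    unfolding set_lebesgue_integral_def by (rule complex_integral_nonneg)
  then show "0 \<le> (LBINT \<xi>. P (Suc m) t \<xi> * ?\<psi> \<xi>) - (LBINT \<xi>. heat_symbol t \<xi> * b \<xi> * ?\<psi> \<xi>)"
    unfolding P_Suc_pairing[OF \<psi> t] by simp
qed

lemma b_wbound: "wbound M b"
  using b_le by (simp add: wbound_def)

text \<open>The pairing equals the integral of \<phi> against the nonnegative function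
  \<open>B\<close> of Gaussian averages. If it vanished, then \<open>B\<close> would be zero almost
  everywhere because \<phi> is strictly positive; the heat symbol times \<open>b\<close> would
  annihilate all test functions, and the heat symbol has no zeros.\<close>

lemma free_solution_pos:
  assumes b: "gauss_nonneg b" and nz: "\<not> (AE \<xi> in lborel. b \<xi> = 0)"
    and t: "t > 0" and \<phi>: "\<phi> \<in> schwartz" "\<And>x. 0 < \<phi> x"
  shows "0 < (LBINT \<xi>. heat_symbol t \<xi> * b \<xi> * inv_fourier \<phi> \<xi>)"
proof -
  define c where "c = 4 * pi\<^sup>2 * t"
  have c: "c > 0" using t by (simp add: c_def)
  define B where "B x = (LBINT \<xi>. b \<xi> * gtest c x \<xi>)" for x
  note bi = wbound_integrable(1)[OF b_wbound]
  have eq: "(LBINT \<xi>. heat_symbol t \<xi> * b \<xi> * inv_fourier \<psi> \<xi>) = (LBINT x. \<psi> x * B x)" if "\<psi> \<in> schwartz" for \<psi>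
    using gtest_pairing[OF b_meas bi c that] unfolding B_def heat_eq_gtest c_def[symmetric] by (simp only: mult.commute[of "gtest c 0 _"])
  have int: "integrable lborel (\<lambda>x. \<phi> x * B x)"
    unfolding B_def by (rule gtest_pairing_integrable[OF b_meas bi c \<phi>(1)])
  have B0: "0 \<le> B x" for x using b c by (simp add: B_def gauss_nonneg_def)
  have \<phi>0: "0 < Re (\<phi> x)" "Im (\<phi> x) = 0" for x using \<phi>(2)[of x] by (auto simp: less_complex_def)
  have nn: "0 \<le> \<phi> x * B x" for x using B0 \<phi>(2) by (intro mult_nonneg_nonneg) (auto simp: less_imp_le)
  have "0 \<le> (LBINT x. \<phi> x * B x)" by (rule complex_integral_nonneg) (rule nn)
  moreover have "(LBINT x. \<phi> x * B x) \<noteq> 0"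
  proof
    assume "(LBINT x. \<phi> x * B x) = 0"
    then have "(LBINT x. Re (\<phi> x * B x)) = 0" using integral_Re[OF int] by simp
    moreover have "AE x in lborel. 0 \<le> Re (\<phi> x * B x)" using nn by (simp add: complex_nonneg_iff)
    ultimately have "AE x in lborel. Re (\<phi> x * B x) = 0"
      using integral_nonneg_eq_0_iff_AE[OF integrable_Re[OF int]] by blast
    then have Bz: "AE x in lborel. B x = 0"
    proof eventually_elim
      case (elim x)
      then have "Re (\<phi> x) * Re (B x) = 0" using \<phi>0(2)[of x] by simp
      then show ?case using \<phi>0(1)[of x] B0[of x] by (simp add: complex_nonneg_iff complex_eq_iff)
    qed
    have "AE \<xi> in lborel. heat_symbol t \<xi> * b \<xi> = 0"
    proof (rule schwartz_separates)
      fix \<psi> :: "real^'n \<Rightarrow> complex" assume \<psi>: "\<psi> \<in> schwartz"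
      show "integrable lborel (\<lambda>\<xi>. heat_symbol t \<xi> * b \<xi> * \<psi> \<xi>)"
        using bi[OF schwartz_heat_mult[OF \<psi>, of t]] t by (simp add: mult_ac)
      \<comment> \<open>Every Schwartz function is an inverse transform, so the identity
        \<open>eq\<close> reaches all tests and not only positive ones.\<close>
      have "(LBINT \<xi>. heat_symbol t \<xi> * b \<xi> * inv_fourier (fourier \<psi>) \<xi>) = (LBINT x. fourier \<psi> x * B x)"
        by (rule eq[OF schwartz_fourier[OF \<psi>]])
      also have "\<dots> = 0"
        by (rule integral_eq_zero_AE) (use Bz in eventually_elim, simp)
      finally show "(LBINT \<xi>. heat_symbol t \<xi> * b \<xi> * \<psi> \<xi>) = 0" by (simp add: inv_fourier_fourier[OF \<psi>])
    qed
    then have "AE \<xi> in lborel. b \<xi> = 0" by eventually_elim (simp add: heat_symbol_def)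
    then show False using nz by simp
  qed
  ultimately show ?thesis unfolding eq[OF \<phi>(1)]
    by (auto simp: less_complex_def complex_nonneg_iff complex_eq_iff)
qed

theorem solution_pos:
  assumes "gauss_nonneg a" "gauss_nonneg b" "\<not> (AE \<xi> in lborel. b \<xi> = 0)"
    and "\<And>s. s \<ge> 0 \<Longrightarrow> wbound N (f s)" "weakly_continuous f" "is_sol f"
    and "t > 0" "\<phi> \<in> schwartz" "\<And>x. 0 < \<phi> x"
  shows "0 < (LBINT \<xi>. f t \<xi> * inv_fourier \<phi> \<xi>)"
  using solution_minus_free_nonneg[OF assms(1,2,4-6) less_imp_le[OF assms(7)] assms(8)] less_imp_le[OF assms(9)]
    free_solution_pos[OF assms(2,3,7-9)]
  by (auto simp: less_complex_def complex_nonneg_iff)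

section \<open>Symmetries of the iterates\<close>

text \<open>Counting powers of r: the convolution collects n - 2 from \<open>a\<close>, k from the
  iterate and -n from the Jacobian, hence k - 2, and the time substitution by r^2 restores
  k.\<close>

lemma P_scaling:
  assumes r: "r > 0"
    and a: "AE \<xi> in lborel. a \<xi> = complex_of_real (r powr (real CARD('n) - 2)) * a (r *\<^sub>R \<xi>)"
    and b: "AE \<xi> in lborel. b \<xi> = complex_of_real (r powr k) * b (r *\<^sub>R \<xi>)"
    and t: "t \<ge> 0"
  shows "AE \<xi> in lborel. P m (r\<^sup>2 * t) \<xi> = complex_of_real (r powr k) * P m t (r *\<^sub>R \<xi>)"
  using t
proof (induction m arbitrary: t)
  case (Suc m)
  have hs: "heat_symbol (r\<^sup>2 * s) \<xi> = heat_symbol s (r *\<^sub>R \<xi>)" for s and \<xi> :: "real^'n"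
    by (simp add: heat_symbol_def power_mult_distrib mult_ac)
  \<comment> \<open>An equality at every \<xi>, although the hypotheses hold only almost everywhere:
    null sets disappear under the integral in \<eta>. This avoids exceptional sets depending on
    \<open>s\<close>.\<close>
  have cv: "convolution a (P m (r\<^sup>2 * s)) \<xi> = complex_of_real (r powr (k - 2)) * convolution a (P m s) (r *\<^sub>R \<xi>)"
    if s: "s \<ge> 0" for s \<xi>
  proof -
    note [measurable] = wbound_meas[OF P_wbound[OF s, of m]]
    have [measurable]: "P m (r\<^sup>2 * s) \<in> borel_measurable borel" using s by (intro wbound_meas[OF P_wbound]) auto
    have "convolution a (P m (r\<^sup>2 * s)) \<xi> = (LBINT \<eta>. complex_of_real (r powr (real CARD('n) - 2) * r powr k) * (a (r *\<^sub>R \<xi> - r *\<^sub>R \<eta>) * P m s (r *\<^sub>R \<eta>)))"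
      unfolding convolution_def
    proof (intro integral_cong_AE)
      show "AE \<eta> in lborel. a (\<xi> - \<eta>) * P m (r\<^sup>2 * s) \<eta> = complex_of_real (r powr (real CARD('n) - 2) * r powr k) * (a (r *\<^sub>R \<xi> - r *\<^sub>R \<eta>) * P m s (r *\<^sub>R \<eta>))"
        using AE_reflect[OF a, of \<xi>] Suc.IH[OF s]
      proof eventually_elim
        case (elim \<eta>)
        show ?case unfolding elim by (simp add: scaleR_diff_right)
      qed
    qed measurable
    also have "\<dots> = complex_of_real (r powr (real CARD('n) - 2) * r powr k) * (LBINT \<eta>. a (r *\<^sub>R \<xi> - (0 + r *\<^sub>R \<eta>)) * P m s (0 + r *\<^sub>R \<eta>))"
      by simp
    also have "(LBINT \<eta>. a (r *\<^sub>R \<xi> - (0 + r *\<^sub>R \<eta>)) * P m s (0 + r *\<^sub>R \<eta>)) = complex_of_real (1 / r ^ CARD('n)) * convolution a (P m s) (r *\<^sub>R \<xi>)"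
      unfolding convolution_def using r by (subst integral_affine[where f = "\<lambda>\<eta>. a (r *\<^sub>R \<xi> - \<eta>) * P m s \<eta>"]) (auto simp: scaleR_conv_of_real)
    also have "complex_of_real (r powr (real CARD('n) - 2) * r powr k) * (complex_of_real (1 / r ^ CARD('n)) * convolution a (P m s) (r *\<^sub>R \<xi>))
      = complex_of_real (r powr (real CARD('n) - 2) * r powr k * (1 / r ^ CARD('n))) * convolution a (P m s) (r *\<^sub>R \<xi>)"
      by (simp only: of_real_mult mult.assoc)
    also have "r powr (real CARD('n) - 2) * r powr k * (1 / r ^ CARD('n)) = r powr (k - 2)"
    proof -
      have "1 / r ^ CARD('n) = r powr (- real CARD('n))" using r by (simp add: powr_minus powr_realpow field_simps)
      then show ?thesis by (simp add: powr_add[symmetric])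
    qed
    finally show ?thesis .
  qed
  have int: "(LBINT s:{0..r\<^sup>2 * t}. heat_symbol (r\<^sup>2 * t - s) \<xi> * convolution a (P m s) \<xi>)
    = complex_of_real (r powr k) * (LBINT s:{0..t}. heat_symbol (t - s) (r *\<^sub>R \<xi>) * convolution a (P m s) (r *\<^sub>R \<xi>))" for \<xi>
  proof -
    have "(LBINT s:{0..r\<^sup>2 * t}. heat_symbol (r\<^sup>2 * t - s) \<xi> * convolution a (P m s) \<xi>)
      = \<bar>r\<^sup>2\<bar> *\<^sub>R (LBINT s. indicator {0..r\<^sup>2 * t} (0 + r\<^sup>2 * s) *\<^sub>R (heat_symbol (r\<^sup>2 * t - (0 + r\<^sup>2 * s)) \<xi> * convolution a (P m (0 + r\<^sup>2 * s)) \<xi>))"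
      unfolding set_lebesgue_integral_def using r by (intro lborel_integral_real_affine) auto
    also have "(LBINT s. indicator {0..r\<^sup>2 * t} (0 + r\<^sup>2 * s) *\<^sub>R (heat_symbol (r\<^sup>2 * t - (0 + r\<^sup>2 * s)) \<xi> * convolution a (P m (0 + r\<^sup>2 * s)) \<xi>))
       = (LBINT s. complex_of_real (r powr (k - 2)) * (indicator {0..t} s *\<^sub>R (heat_symbol (t - s) (r *\<^sub>R \<xi>) * convolution a (P m s) (r *\<^sub>R \<xi>))))"
    proof (intro Bochner_Integration.integral_cong refl)
      fix s :: real
      have "indicator {0..r\<^sup>2 * t} (0 + r\<^sup>2 * s) = (indicator {0..t} s :: real)"
        using r by (auto simp: indicator_def zero_le_mult_iff)
      moreover have "heat_symbol (r\<^sup>2 * t - (0 + r\<^sup>2 * s)) \<xi> = heat_symbol (t - s) (r *\<^sub>R \<xi>)"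
        using hs[of "t - s" \<xi>] by (simp add: right_diff_distrib)
      ultimately show "indicator {0..r\<^sup>2 * t} (0 + r\<^sup>2 * s) *\<^sub>R (heat_symbol (r\<^sup>2 * t - (0 + r\<^sup>2 * s)) \<xi> * convolution a (P m (0 + r\<^sup>2 * s)) \<xi>)
        = complex_of_real (r powr (k - 2)) * (indicator {0..t} s *\<^sub>R (heat_symbol (t - s) (r *\<^sub>R \<xi>) * convolution a (P m s) (r *\<^sub>R \<xi>)))"
        using cv[of s \<xi>] by (cases "s \<in> {0..t}") (auto simp: mult_ac)
    qed
    also have "\<dots> = complex_of_real (r powr (k - 2)) * (LBINT s:{0..t}. heat_symbol (t - s) (r *\<^sub>R \<xi>) * convolution a (P m s) (r *\<^sub>R \<xi>))"
      unfolding set_lebesgue_integral_def by (rule integral_mult_right_zero)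
    also have "\<bar>r\<^sup>2\<bar> *\<^sub>R (complex_of_real (r powr (k - 2)) * (LBINT s:{0..t}. heat_symbol (t - s) (r *\<^sub>R \<xi>) * convolution a (P m s) (r *\<^sub>R \<xi>)))
      = complex_of_real (r\<^sup>2 * r powr (k - 2)) * (LBINT s:{0..t}. heat_symbol (t - s) (r *\<^sub>R \<xi>) * convolution a (P m s) (r *\<^sub>R \<xi>))"
      by (simp add: scaleR_conv_of_real)
    also have "r\<^sup>2 * r powr (k - 2) = r powr k"
      using r by (simp add: powr_realpow[symmetric] powr_add[symmetric] del: powr_numeral)
    finally show ?thesis .
  qed
  show ?case using b
  proof eventually_elim
    case (elim \<xi>)
    have "heat_symbol (r\<^sup>2 * t) \<xi> * b \<xi> = complex_of_real (r powr k) * (heat_symbol t (r *\<^sub>R \<xi>) * b (r *\<^sub>R \<xi>))"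
      unfolding hs using elim by (simp add: mult_ac)
    then show ?case unfolding P.simps int by (simp add: distrib_left)
  qed
qed simp

lemma solution_scaling:
  assumes r: "r > 0"
    and a: "AE \<xi> in lborel. a \<xi> = complex_of_real (r powr (real CARD('n) - 2)) * a (r *\<^sub>R \<xi>)"
    and b: "AE \<xi> in lborel. b \<xi> = complex_of_real (r powr k) * b (r *\<^sub>R \<xi>)"
    and f: "\<And>s. s \<ge> 0 \<Longrightarrow> wbound N (f s)" "weakly_continuous f" "is_sol f"
    and t: "t \<ge> 0" and \<psi>: "\<psi> \<in> schwartz"
  shows "(LBINT \<xi>. f (r\<^sup>2 * t) \<xi> * \<psi> (r *\<^sub>R \<xi>)) = complex_of_real (r powr (k - real CARD('n))) * (LBINT \<xi>. f t \<xi> * \<psi> \<xi>)"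
proof -
  note [measurable] = schwartz_measurable[OF \<psi>]
  have rt: "r\<^sup>2 * t \<ge> 0" using t by simp
  have \<psi>r: "(\<lambda>\<xi>. \<psi> (r *\<^sub>R \<xi>)) \<in> schwartz"
    using schwartz_affine[of "\<lambda>x. r *\<^sub>R x" \<psi> 0] r \<psi> by (auto simp: linear_iff inj_def scaleR_add_right)
  have P: "(LBINT \<xi>. P m (r\<^sup>2 * t) \<xi> * \<psi> (r *\<^sub>R \<xi>)) = complex_of_real (r powr (k - real CARD('n))) * (LBINT \<xi>. P m t \<xi> * \<psi> \<xi>)" for m
  proof -
    note [measurable] = wbound_meas[OF P_wbound[OF t, of m]] wbound_meas[OF P_wbound[OF rt, of m]]
    have "(LBINT \<xi>. P m (r\<^sup>2 * t) \<xi> * \<psi> (r *\<^sub>R \<xi>)) = (LBINT \<xi>. complex_of_real (r powr k) * (P m t (0 + r *\<^sub>R \<xi>) * \<psi> (0 + r *\<^sub>R \<xi>)))"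
      using P_scaling[OF r a b t, of m] by (intro integral_cong_AE) (auto elim!: eventually_mono)
    also have "\<dots> = complex_of_real (r powr k) * (LBINT \<xi>. P m t (0 + r *\<^sub>R \<xi>) * \<psi> (0 + r *\<^sub>R \<xi>))" by simp
    also have "(LBINT \<xi>. P m t (0 + r *\<^sub>R \<xi>) * \<psi> (0 + r *\<^sub>R \<xi>)) = complex_of_real (1 / r ^ CARD('n)) * (LBINT \<xi>. P m t \<xi> * \<psi> \<xi>)"
      using r by (subst integral_affine[where f = "\<lambda>\<eta>. P m t \<eta> * \<psi> \<eta>"]) (auto simp: scaleR_conv_of_real)
    also have "complex_of_real (r powr k) * (complex_of_real (1 / r ^ CARD('n)) * (LBINT \<xi>. P m t \<xi> * \<psi> \<xi>))
      = complex_of_real (r powr k * (1 / r ^ CARD('n))) * (LBINT \<xi>. P m t \<xi> * \<psi> \<xi>)" by (simp only: of_real_mult mult.assoc)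
    also have "r powr k * (1 / r ^ CARD('n)) = r powr (k - real CARD('n))"
      using r by (simp add: powr_diff powr_realpow)
    finally show ?thesis .
  qed
  have "(\<lambda>m. LBINT \<xi>. P m (r\<^sup>2 * t) \<xi> * \<psi> (r *\<^sub>R \<xi>)) \<longlonglongrightarrow> (LBINT \<xi>. f (r\<^sup>2 * t) \<xi> * \<psi> (r *\<^sub>R \<xi>))"
    by (rule picard_limit[OF f rt \<psi>r])
  moreover have "(\<lambda>m. LBINT \<xi>. P m (r\<^sup>2 * t) \<xi> * \<psi> (r *\<^sub>R \<xi>)) \<longlonglongrightarrow> complex_of_real (r powr (k - real CARD('n))) * (LBINT \<xi>. f t \<xi> * \<psi> \<xi>)"
    unfolding P by (intro tendsto_mult tendsto_const picard_limit[OF f t \<psi>])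
  ultimately show ?thesis using LIMSEQ_unique by blast
qed

lemma P_orthogonal:
  assumes R: "orthogonal_transformation R"
    and a: "AE \<xi> in lborel. a (R \<xi>) = a \<xi>" and b: "AE \<xi> in lborel. b (R \<xi>) = b \<xi>" and t: "t \<ge> 0"
  shows "AE \<xi> in lborel. P m t (R \<xi>) = P m t \<xi>"
  using t
proof (induction m arbitrary: t)
  case (Suc m)
  note [measurable] = orthogonal_transformation_measurable[OF R]
  have nR: "norm (R \<xi>) = norm \<xi>" for \<xi> using R by (simp add: orthogonal_transformation)
  have dR: "R x - R y = R (x - y)" for x y using R by (simp add: orthogonal_transformation_linear linear_diff)
  have hs: "heat_symbol s (R \<xi>) = heat_symbol s \<xi>" for s \<xi> by (simp add: heat_symbol_def nR)
  \<comment> \<open>As for scaling, integration in \<eta> turns the almost everywhere hypotheses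
    into an equality at every \<xi>, valid for all times at once.\<close>
  have cv: "convolution a (P m s) (R \<xi>) = convolution a (P m s) \<xi>" if s: "s \<ge> 0" for s \<xi>
  proof -
    note [measurable] = wbound_meas[OF P_wbound[OF s, of m]]
    have "convolution a (P m s) (R \<xi>) = (LBINT \<eta>. a (R \<xi> - R \<eta>) * P m s (R \<eta>))"
      unfolding convolution_def by (rule integral_orthogonal[OF R, symmetric]) measurable
    also have "\<dots> = convolution a (P m s) \<xi>"
      unfolding convolution_def
    proof (intro integral_cong_AE)
      show "AE \<eta> in lborel. a (R \<xi> - R \<eta>) * P m s (R \<eta>) = a (\<xi> - \<eta>) * P m s \<eta>"
        using AE_reflect[OF a, of \<xi>] Suc.IH[OF s] by eventually_elim (simp add: dR)
    qed measurable
    finally show ?thesis .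
  qed
  have int: "(LBINT s:{0..t}. heat_symbol (t - s) (R \<xi>) * convolution a (P m s) (R \<xi>))
     = (LBINT s:{0..t}. heat_symbol (t - s) \<xi> * convolution a (P m s) \<xi>)" for \<xi>
    by (rule set_lebesgue_integral_cong) (auto simp: hs cv)
  show ?case using b by eventually_elim (unfold P.simps int, simp add: hs)
qed simp

lemma solution_orthogonal:
  assumes R: "orthogonal_transformation R"
    and a: "AE \<xi> in lborel. a (R \<xi>) = a \<xi>" and b: "AE \<xi> in lborel. b (R \<xi>) = b \<xi>"
    and f: "\<And>s. s \<ge> 0 \<Longrightarrow> wbound N (f s)" "weakly_continuous f" "is_sol f"
    and t: "t \<ge> 0" and \<psi>: "\<psi> \<in> schwartz" "\<psi> \<circ> R \<in> schwartz"
  shows "(LBINT \<xi>. f t \<xi> * \<psi> (R \<xi>)) = (LBINT \<xi>. f t \<xi> * \<psi> \<xi>)"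
proof -
  note [measurable] = schwartz_measurable[OF \<psi>(1)] orthogonal_transformation_measurable[OF R]
  have P: "(LBINT \<xi>. P m t \<xi> * (\<psi> \<circ> R) \<xi>) = (LBINT \<xi>. P m t \<xi> * \<psi> \<xi>)" for m
  proof -
    note [measurable] = wbound_meas[OF P_wbound[OF t, of m]]
    have "(LBINT \<xi>. P m t \<xi> * (\<psi> \<circ> R) \<xi>) = (LBINT \<xi>. P m t (R \<xi>) * \<psi> (R \<xi>))"
      using P_orthogonal[OF R a b t, of m] by (intro integral_cong_AE) (auto elim!: eventually_mono)
    also have "\<dots> = (LBINT \<xi>. P m t \<xi> * \<psi> \<xi>)"
      by (rule integral_orthogonal[OF R, of "\<lambda>\<xi>. P m t \<xi> * \<psi> \<xi>"]) measurable
    finally show ?thesis .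
  qed
  have "(\<lambda>m. LBINT \<xi>. P m t \<xi> * \<psi> \<xi>) \<longlonglongrightarrow> (LBINT \<xi>. f t \<xi> * (\<psi> \<circ> R) \<xi>)"
    using picard_limit[OF f t \<psi>(2)] unfolding P .
  then show ?thesis using LIMSEQ_unique[OF _ picard_limit[OF f t \<psi>(1)]] by auto
qed

end

section \<open>Fourier transforms of distributions in \<open>PM\<^sup>k\<close>\<close>

text \<open>Local integrability gives measurability of the restrictions to balls, of which f is the
  pointwise limit.\<close>

lemma represented_measurable:
  fixes f :: "real^'n::finite \<Rightarrow> complex"
  assumes "represented_by T f"
  shows "f \<in> borel_measurable borel"
proof (rule borel_measurable_LIMSEQ_metric)
  show "(\<lambda>x. indicator (cball 0 (real j)) x *\<^sub>R f x) \<in> borel_measurable borel" for j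
    using assms by (auto simp: represented_by_def locally_integrable_def set_integrable_def dest!: borel_measurable_integrable spec[of _ "cball 0 (real j)"])
  show "(\<lambda>j. indicator (cball 0 (real j)) x *\<^sub>R f x) \<longlonglongrightarrow> f x" for x
  proof (rule tendsto_eventually)
    obtain J :: nat where "norm x \<le> real J" using real_arch_simple by blast
    then have "indicator (cball 0 (real j)) x *\<^sub>R f x = f x" if "j \<ge> J" for j
      using that by (simp add: indicator_def)
    then show "\<forall>\<^sub>F j in sequentially. indicator (cball 0 (real j)) x *\<^sub>R f x = f x"
      by (auto simp: eventually_sequentially)
  qed
qed

text \<open>A version of the Fourier transform for which the bound of the \<open>PM\<^sup>\<kappa>\<close> norm by \<open>v\<close> holds everywhere.\<close>

definition fourier_version :: "real \<Rightarrow> real \<Rightarrow> 'n::finite tdist \<Rightarrow> real^'n \<Rightarrow> complex" where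
  "fourier_version v \<kappa> T \<xi> = (if norm (fourier_fun T \<xi>) \<le> v * norm \<xi> powr (- \<kappa>) then fourier_fun T \<xi> else 0)"

locale PM_dist =
  fixes T :: "'n::finite tdist" and \<kappa> v :: real
  assumes PM: "T \<in> PM \<kappa>" and norm_le: "PM_norm \<kappa> T \<le> ennreal v" and v: "v \<ge> 0"
begin

abbreviation "F \<equiv> fourier_version v \<kappa> T"

lemma represented: "represented_by (fourier_dist T) (fourier_fun T)"
proof -
  have "\<exists>f. represented_by (fourier_dist T) f" using PM by (simp add: PM_def)
  then show ?thesis unfolding fourier_fun_def by (rule someI_ex)
qed

lemma F_measurable[measurable]: "F \<in> borel_measurable borel"
proof -
  note [measurable] = represented_measurable[OF represented]
  show ?thesis unfolding fourier_version_def by measurable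
qed

lemma F_le: "norm (F \<xi>) \<le> v * norm \<xi> powr (- \<kappa>)"
  using v by (simp add: fourier_version_def)

lemma F_AE: "AE \<xi> in lborel. F \<xi> = fourier_fun T \<xi>"
proof -
  have "AE \<xi> in lborel. ennreal (norm \<xi> powr \<kappa> * norm (fourier_fun T \<xi>)) \<le> PM_norm \<kappa> T"
    unfolding PM_norm_def by (rule esssup_AE)
  then show ?thesis using AE_lborel_singleton[of 0]
  proof eventually_elim
    case (elim \<xi>)
    then have "ennreal (norm \<xi> powr \<kappa> * norm (fourier_fun T \<xi>)) \<le> ennreal v" using norm_le by (blast intro: order_trans)
    then have "norm \<xi> powr \<kappa> * norm (fourier_fun T \<xi>) \<le> v" using v by (simp add: ennreal_le_iff)
    then have "norm (fourier_fun T \<xi>) \<le> v * norm \<xi> powr (- \<kappa>)"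
      using elim(2) by (simp add: powr_minus field_simps)
    then show ?case by (simp add: fourier_version_def)
  qed
qed

lemma
  assumes \<psi>: "\<psi> \<in> schwartz"
  shows F_integrable: "integrable lborel (\<lambda>\<xi>. F \<xi> * \<psi> \<xi>)"
    and pairing: "T (fourier \<psi>) = (LBINT \<xi>. F \<xi> * \<psi> \<xi>)"
proof -
  note [measurable] = schwartz_measurable[OF \<psi>] represented_measurable[OF represented]
  have ae: "AE \<xi> in lborel. fourier_fun T \<xi> * \<psi> \<xi> = F \<xi> * \<psi> \<xi>" using F_AE by eventually_elim simp
  have r: "integrable lborel (\<lambda>\<xi>. fourier_fun T \<xi> * \<psi> \<xi>)" "T (fourier \<psi>) = (LBINT \<xi>. fourier_fun T \<xi> * \<psi> \<xi>)"
    using represented \<psi> by (auto simp: represented_by_def fourier_dist_def)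
  show "integrable lborel (\<lambda>\<xi>. F \<xi> * \<psi> \<xi>)"
    using r(1) integrable_cong_AE[OF _ _ ae] by simp
  show "T (fourier \<psi>) = (LBINT \<xi>. F \<xi> * \<psi> \<xi>)"
    unfolding r(2) by (rule integral_cong_AE[OF _ _ ae]) measurable
qed

lemma pairing_inv:
  assumes "\<phi> \<in> schwartz"
  shows "T \<phi> = (LBINT \<xi>. F \<xi> * inv_fourier \<phi> \<xi>)"
  using pairing[OF schwartz_inv_fourier[OF assms]] by (simp add: fourier_inv_fourier[OF assms])

lemma schwartz_scale: "r > 0 \<Longrightarrow> \<psi> \<in> schwartz \<Longrightarrow> (\<lambda>\<xi>::real^'n. \<psi> (r *\<^sub>R \<xi>)) \<in> schwartz"
  using schwartz_affine[of "\<lambda>x. r *\<^sub>R x" \<psi> 0] by (auto simp: linear_iff inj_def scaleR_add_right)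

lemma schwartz_orthogonal: "orthogonal_transformation R \<Longrightarrow> \<psi> \<in> schwartz \<Longrightarrow> \<psi> \<circ> (R :: real^'n \<Rightarrow> real^'n) \<in> schwartz"
  using schwartz_affine[of R \<psi> 0]
  by (simp add: orthogonal_transformation_linear orthogonal_transformation_inj comp_def)

lemma dilate_fourier:
  assumes r: "r > 0" and \<psi>: "\<psi> \<in> schwartz"
  shows "dilate r T (fourier \<psi>) = (LBINT \<xi>. F \<xi> * \<psi> (r *\<^sub>R \<xi>))"
proof -
  note [measurable] = schwartz_measurable[OF \<psi>]
  \<comment> \<open>The Jacobian: it cancels the factor in the transform of a dilated function and
    afterwards the normalization in \<open>dilate\<close>.\<close>
  define c where "c = complex_of_real (r ^ CARD('n))"
  have c: "c \<noteq> 0" using r by (simp add: c_def)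
  have S: "(\<lambda>\<xi>. c * \<psi> (r *\<^sub>R \<xi>)) \<in> schwartz" by (intro schwartz_cmult schwartz_scale r \<psi>)
  have "fourier (\<lambda>\<xi>. c * \<psi> (r *\<^sub>R \<xi>)) x = fourier \<psi> (x /\<^sub>R r)" for x
  proof -
    have "fourier (\<lambda>\<xi>. c * \<psi> (r *\<^sub>R \<xi>)) x = c * fourier (\<lambda>\<xi>. \<psi> (r *\<^sub>R \<xi>)) x"
      unfolding fourier_cis by (simp add: mult.assoc)
    then show ?thesis using c by (simp add: fourier_comp_scale[OF r] c_def)
  qed
  then have "fourier (\<lambda>\<xi>. c * \<psi> (r *\<^sub>R \<xi>)) = (\<lambda>x. fourier \<psi> (x /\<^sub>R r))" by (rule ext)
  then have "T (\<lambda>x. fourier \<psi> (x /\<^sub>R r)) = (LBINT \<xi>. F \<xi> * (c * \<psi> (r *\<^sub>R \<xi>)))"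
    using pairing[OF S] by simp
  also have "\<dots> = c * (LBINT \<xi>. F \<xi> * \<psi> (r *\<^sub>R \<xi>))"
    by (subst integral_mult_right_zero[symmetric]) (simp add: mult_ac)
  finally have "dilate r T (fourier \<psi>) = (complex_of_real (r powr (- real CARD('n))) * c) * (LBINT \<xi>. F \<xi> * \<psi> (r *\<^sub>R \<xi>))"
    by (simp add: dilate_def mult.assoc)
  also have "complex_of_real (r powr (- real CARD('n))) * c = 1"
    using r by (simp add: c_def powr_minus powr_realpow flip: of_real_power of_real_mult)
  finally show ?thesis by simp
qed

text \<open>Both sides are tested with Schwartz functions, which separate. The exponent n + d
  combines the Jacobian with the degree \<open>d\<close>.\<close>

lemma F_homogeneous:
  assumes T: "homogeneous d T" and r: "r > 0"
  shows "AE \<xi> in lborel. F \<xi> = complex_of_real (r powr (real CARD('n) + d)) * F (r *\<^sub>R \<xi>)"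
proof -
  define c where "c = complex_of_real (r powr (real CARD('n) + d))"
  have *: "integrable lborel (\<lambda>\<xi>. F (r *\<^sub>R \<xi>) * \<psi> \<xi>) \<and> c * (LBINT \<xi>. F (r *\<^sub>R \<xi>) * \<psi> \<xi>) = (LBINT \<xi>. F \<xi> * \<psi> \<xi>)"
    if \<psi>: "\<psi> \<in> schwartz" for \<psi>
  proof -
    note [measurable] = schwartz_measurable[OF \<psi>]
    \<comment> \<open>Substituting in the integral moves the dilation to the test function with the
      inverse factor, so homogeneity is used for 1 / r.\<close>
    have r': "1 / r > 0" using r by simp
    have S: "(\<lambda>\<xi>. \<psi> ((1 / r) *\<^sub>R \<xi>)) \<in> schwartz" by (rule schwartz_scale[OF r' \<psi>])
    have eq: "(\<lambda>\<xi>. F (r *\<^sub>R \<xi>) * \<psi> \<xi>) = (\<lambda>\<xi>. F (0 + r *\<^sub>R \<xi>) * \<psi> ((1 / r) *\<^sub>R (0 + r *\<^sub>R \<xi>)))"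
      using r by simp
    have "integrable lborel (\<lambda>\<xi>. F (0 + r *\<^sub>R \<xi>) * \<psi> ((1 / r) *\<^sub>R (0 + r *\<^sub>R \<xi>)))"
      using r F_integrable[OF S] by (subst integrable_affine_iff[where f = "\<lambda>\<xi>. F \<xi> * \<psi> ((1 / r) *\<^sub>R \<xi>)"]) auto
    moreover have "(LBINT \<xi>. F (0 + r *\<^sub>R \<xi>) * \<psi> ((1 / r) *\<^sub>R (0 + r *\<^sub>R \<xi>))) = complex_of_real (1 / r ^ CARD('n)) * (LBINT \<xi>. F \<xi> * \<psi> ((1 / r) *\<^sub>R \<xi>))"
      using r by (subst integral_affine[where f = "\<lambda>\<xi>. F \<xi> * \<psi> ((1 / r) *\<^sub>R \<xi>)"]) (auto simp: scaleR_conv_of_real[where 'a = complex])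
    moreover have "(LBINT \<xi>. F \<xi> * \<psi> ((1 / r) *\<^sub>R \<xi>)) = complex_of_real ((1 / r) powr d) * (LBINT \<xi>. F \<xi> * \<psi> \<xi>)"
      using T r' schwartz_fourier[OF \<psi>] unfolding homogeneous_def dilate_fourier[OF r' \<psi>, symmetric] pairing[OF \<psi>, symmetric] by blast
    moreover have "c * (complex_of_real (1 / r ^ CARD('n)) * (complex_of_real ((1 / r) powr d) * z)) = z" for z
    proof -
      have "r powr (real CARD('n) + d) * (1 / r ^ CARD('n)) * (1 / r) powr d = 1"
        using r by (simp add: powr_add powr_realpow powr_divide)
      then show ?thesis unfolding c_def by (simp only: mult.assoc[symmetric] of_real_mult[symmetric]) simp
    qed
    ultimately show ?thesis unfolding eq by simp
  qed
  have "AE \<xi> in lborel. F \<xi> - c * F (r *\<^sub>R \<xi>) = 0"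
  proof (rule schwartz_separates)
    fix \<psi> :: "real^'n \<Rightarrow> complex" assume \<psi>: "\<psi> \<in> schwartz"
    have i: "integrable lborel (\<lambda>\<xi>. c * (F (r *\<^sub>R \<xi>) * \<psi> \<xi>))" using *[OF \<psi>] by simp
    have eq: "(F \<xi> - c * F (r *\<^sub>R \<xi>)) * \<psi> \<xi> = F \<xi> * \<psi> \<xi> - c * (F (r *\<^sub>R \<xi>) * \<psi> \<xi>)" for \<xi>
      by (simp add: left_diff_distrib mult.assoc)
    show "integrable lborel (\<lambda>\<xi>. (F \<xi> - c * F (r *\<^sub>R \<xi>)) * \<psi> \<xi>)"
      unfolding eq by (intro Bochner_Integration.integrable_diff F_integrable[OF \<psi>] i)
    show "(LBINT \<xi>. (F \<xi> - c * F (r *\<^sub>R \<xi>)) * \<psi> \<xi>) = 0"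
      unfolding eq Bochner_Integration.integral_diff[OF F_integrable[OF \<psi>] i] using *[OF \<psi>] by simp
  qed
  then show ?thesis unfolding c_def by simp
qed

text \<open>Lebesgue measure and the Fourier transform commute with orthogonal maps, so symmetry of
  \<open>T\<close> gives equal pairings for \<open>F\<close> and its rotation, and Schwartz
  functions separate.\<close>

lemma F_radial:
  assumes T: "radially_symmetric T" and R: "orthogonal_transformation R"
  shows "AE \<xi> in lborel. F (R \<xi>) = F \<xi>"
proof -
  note [measurable] = orthogonal_transformation_measurable[OF R]
  have inv: "orthogonal_transformation (inv R)" and RS: "inv R (R x) = x" for x
    using R by (auto simp: orthogonal_transformation_inv inv_f_f orthogonal_transformation_inj)
  have *: "integrable lborel (\<lambda>\<xi>. F (R \<xi>) * \<psi> \<xi>) \<and> (LBINT \<xi>. F (R \<xi>) * \<psi> \<xi>) = (LBINT \<xi>. F \<xi> * \<psi> \<xi>)"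
    if \<psi>: "\<psi> \<in> schwartz" for \<psi>
  proof -
    define \<theta> where "\<theta> = \<psi> \<circ> inv R"
    have \<theta>: "\<theta> \<in> schwartz" unfolding \<theta>_def by (rule schwartz_orthogonal[OF inv \<psi>])
    note [measurable] = schwartz_measurable[OF \<theta>] schwartz_measurable[OF \<psi>]
    have \<psi>R: "\<psi> = \<theta> \<circ> R" by (simp add: \<theta>_def fun_eq_iff RS)
    have "(LBINT \<xi>. F (R \<xi>) * \<psi> \<xi>) = (LBINT \<xi>. F \<xi> * \<theta> \<xi>)"
      unfolding \<psi>R comp_def by (rule integral_orthogonal[OF R, of "\<lambda>\<xi>. F \<xi> * \<theta> \<xi>"]) measurable
    also have "\<dots> = T (fourier \<theta>)" by (rule pairing[OF \<theta>, symmetric])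
    also have "\<dots> = T (fourier \<theta> \<circ> R)" using T R schwartz_fourier[OF \<theta>] by (simp add: radially_symmetric_def)
    also have "fourier \<theta> \<circ> R = fourier \<psi>"
      unfolding \<psi>R by (rule ext) (simp add: fourier_comp_orthogonal[OF R])
    also have "T (fourier \<psi>) = (LBINT \<xi>. F \<xi> * \<psi> \<xi>)" by (rule pairing[OF \<psi>])
    finally have "(LBINT \<xi>. F (R \<xi>) * \<psi> \<xi>) = (LBINT \<xi>. F \<xi> * \<psi> \<xi>)" .
    moreover have "integrable lborel (\<lambda>\<xi>. F (R \<xi>) * \<psi> \<xi>)"
      unfolding \<psi>R comp_def
      using integrable_orthogonal_iff[OF R, of "\<lambda>\<xi>. F \<xi> * \<theta> \<xi>"] F_integrable[OF \<theta>] by simp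
    ultimately show ?thesis by simp
  qed
  have "AE \<xi> in lborel. F (R \<xi>) - F \<xi> = 0"
    by (rule schwartz_separates) (use * F_integrable in \<open>auto simp: left_diff_distrib\<close>)
  then show ?thesis by simp
qed

lemma F_gauss_nonneg: "dist_nonneg T \<Longrightarrow> gauss_nonneg F"
  unfolding gauss_nonneg_def dist_nonneg_def
  by (simp add: pairing[symmetric] gtest_schwartz schwartz_fourier fourier_gtest_nonneg)

lemma F_gauss_nonpos: "dist_nonpos T \<Longrightarrow> gauss_nonneg (\<lambda>\<xi>. - F \<xi>)"
  unfolding gauss_nonneg_def dist_nonpos_def
  by (simp add: pairing[symmetric] gtest_schwartz schwartz_fourier fourier_gtest_nonneg)

lemma F_nonzero:
  assumes "\<phi> \<in> schwartz" "T \<phi> \<noteq> 0"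
  shows "\<not> (AE \<xi> in lborel. F \<xi> = 0)"
proof
  assume "AE \<xi> in lborel. F \<xi> = 0"
  then have "AE \<xi> in lborel. F \<xi> * inv_fourier \<phi> \<xi> = 0" by eventually_elim simp
  then have "T \<phi> = 0" unfolding pairing_inv[OF assms(1)] by (rule integral_eq_zero_AE)
  then show False using assms(2) by simp
qed

end

section \<open>The operators on the Fourier side and the assembly of the three claims\<close>

lemma heat_op_fourier:
  assumes T: "PM_dist T \<kappa> v" and t: "t \<ge> 0" and \<psi>: "\<psi> \<in> schwartz"
  shows "heat_op t T (fourier \<psi>) = (LBINT \<xi>. heat_symbol t \<xi> * fourier_version v \<kappa> T \<xi> * \<psi> \<xi>)"
  unfolding heat_op_def inv_fourier_dist_def fourier_dist_def inv_fourier_fourier[OF \<psi>]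
    PM_dist.pairing[OF T schwartz_heat_mult[OF \<psi> t]]
  by (simp add: mult_ac)

text \<open>Changing both factors on null sets leaves the integrand unchanged for almost all \<eta>,
  whatever \<xi> is, so the convolutions agree everywhere.\<close>

lemma convolution_fourier_version:
  assumes S: "PM_dist S \<kappa> v" and T: "PM_dist T \<kappa>' w"
  shows "convolution (fourier_fun S) (fourier_fun T) \<xi> = convolution (fourier_version v \<kappa> S) (fourier_version w \<kappa>' T) \<xi>"
  unfolding convolution_def
proof (rule integral_cong_AE)
  note [measurable] = represented_measurable[OF PM_dist.represented[OF S]] represented_measurable[OF PM_dist.represented[OF T]]
    PM_dist.F_measurable[OF S] PM_dist.F_measurable[OF T]
  show "(\<lambda>\<eta>. fourier_fun S (\<xi> - \<eta>) * fourier_fun T \<eta>) \<in> borel_measurable lborel"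
    "(\<lambda>\<eta>. fourier_version v \<kappa> S (\<xi> - \<eta>) * fourier_version w \<kappa>' T \<eta>) \<in> borel_measurable lborel"
    by measurable
  show "AE \<eta> in lborel. fourier_fun S (\<xi> - \<eta>) * fourier_fun T \<eta> = fourier_version v \<kappa> S (\<xi> - \<eta>) * fourier_version w \<kappa>' T \<eta>"
    using AE_reflect[OF PM_dist.F_AE[OF S], of \<xi>] PM_dist.F_AE[OF T] by eventually_elim simp
qed

theorem theorem1p3:
  fixes k :: real
    and u\<^sub>0 V :: "'n::finite tdist"
    and u :: "real \<Rightarrow> 'n tdist"
  assumes "CARD('n) \<ge> 3"
    and "2 < k" and "k < real CARD('n)"
    and "u\<^sub>0 \<in> PM k"
    and "V \<in> PM (real CARD('n) - 2)"
    and "PM_norm (real CARD('n) - 2) V < ennreal (1 / C_const (real CARD('n)) k)"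
    and "u \<in> X_space k"
    and "is_solution V u\<^sub>0 u"
  shows "(homogeneous (- (real CARD('n) - k)) u\<^sub>0 \<and> homogeneous (-2) V \<longrightarrow>
            (\<forall>r>0. \<forall>t>0. \<forall>\<phi>\<in>schwartz.
               u t \<phi> = complex_of_real (r powr (real CARD('n) - k)) * dilate r (u (r\<^sup>2 * t)) \<phi>))
       \<and> (dist_nonneg V \<and> dist_nonneg u\<^sub>0 \<and> (\<exists>\<phi>\<in>schwartz. u\<^sub>0 \<phi> \<noteq> 0) \<longrightarrow>
            (\<forall>t>0. dist_pos (u t)))
       \<and> (dist_nonneg V \<and> dist_nonpos u\<^sub>0 \<and> (\<exists>\<phi>\<in>schwartz. u\<^sub>0 \<phi> \<noteq> 0) \<longrightarrow>
            (\<forall>t>0. dist_neg (u t)))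
       \<and> (radially_symmetric V \<longrightarrow>
            ((\<forall>t>0. radially_symmetric (u t)) \<longleftrightarrow> radially_symmetric u\<^sub>0))"
proof -
  let ?n = "real CARD('n)"
  \<comment> \<open>\<open>enn2real\<close> sends infinity to 0, so each of these constants
    represents its norm only by way of finiteness.\<close>
  define v where "v = enn2real (PM_norm (?n - 2) V)"
  define M where "M = enn2real (PM_norm k u\<^sub>0)"
  define N where "N = enn2real (SUP t\<in>{0..}. PM_norm k (u t))"
  have nonneg: "v \<ge> 0" "M \<ge> 0" "N \<ge> 0" by (simp_all add: v_def M_def N_def)
  have C: "C_const ?n k > 0"
    unfolding C_const_def using assms(1-3) by (intro divide_pos_pos K_const_pos) auto
  have X: "u t \<in> PM k" "PM_norm k (u t) \<le> ennreal N" if "t \<ge> 0" for t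
  proof -
    show "u t \<in> PM k" using assms(7) that by (auto simp: X_space_def)
    have "(SUP t\<in>{0..}. PM_norm k (u t)) < top" using assms(7) by (simp add: X_space_def)
    then have "ennreal N = (SUP t\<in>{0..}. PM_norm k (u t))" by (simp add: N_def)
    then show "PM_norm k (u t) \<le> ennreal N" using that by (auto intro: SUP_upper)
  qed
  have wc: "continuous_on {0..} (\<lambda>t. u t \<phi>)" if "\<phi> \<in> schwartz" for \<phi>
    using assms(7) that by (auto simp: X_space_def)
  interpret V: PM_dist V "?n - 2" v
    using assms(5) by unfold_locales (auto simp: v_def PM_def)
  interpret U0: PM_dist u\<^sub>0 k M
    using assms(4) by unfold_locales (auto simp: M_def PM_def)
  have U: "PM_dist (u t) k N" if "t \<ge> 0" for t
    using X[OF that] nonneg by unfold_locales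
  define a where "a = fourier_version v (?n - 2) V"
  define b where "b = fourier_version M k u\<^sub>0"
  \<comment> \<open>The same \<open>N\<close>, coming from the supremum over all times, serves every
    \<open>t\<close>; the Picard error bound needs a constant uniform in time.\<close>
  define f where "f t = fourier_version N k (u t)" for t
  note Umeas = PM_dist.F_measurable[OF U, folded f_def]
  note Upair = PM_dist.pairing[OF U, folded f_def]
  note Upair_inv = PM_dist.pairing_inv[OF U, folded f_def]
  have small: "v * C_const ?n k < 1"
  proof -
    have "ennreal v = PM_norm (?n - 2) V" using assms(5) by (simp add: v_def PM_def)
    then have "ennreal v < ennreal (1 / C_const ?n k)" using assms(6) by simp
    then have "v < 1 / C_const ?n k" using nonneg(1) by (simp add: ennreal_less_iff)
    then show ?thesis using C by (simp add: field_simps)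
  qed
  interpret H: perturbed_heat a b k v M
    using assms(1-3) nonneg small V.F_le U0.F_le V.F_measurable U0.F_measurable
    by unfold_locales (auto simp: a_def b_def)
  \<comment> \<open>The equation is linear in the solution and the initial value, so the negative
    case is the positive case for -b and -f with the same potential.\<close>
  interpret H': perturbed_heat a "\<lambda>\<xi>. - b \<xi>" k v M
    using assms(1-3) nonneg small V.F_le U0.F_le V.F_measurable U0.F_measurable
    by unfold_locales (auto simp: a_def b_def)
  have fb: "H.wbound N (f t)" if "t \<ge> 0" for t
    using Umeas[OF that] PM_dist.F_le[OF U[OF that]] by (simp add: H.wbound_def f_def)
  have fc: "H.weakly_continuous f"
    unfolding H.weakly_continuous_def
  proof
    fix \<psi> :: "real^'n \<Rightarrow> complex" assume \<psi>: "\<psi> \<in> schwartz"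
    have "continuous_on {0..} (\<lambda>t. u t (fourier \<psi>))" by (intro wc schwartz_fourier \<psi>)
    then show "continuous_on {0..} (\<lambda>s. LBINT \<eta>. f s \<eta> * \<psi> \<eta>)"
      by (rule continuous_on_eq) (simp add: Upair[OF _ \<psi>])
  qed
  have fs: "H.is_sol f"
    unfolding H.is_sol_def
  proof (intro allI impI ballI)
    fix t :: real and \<psi> :: "real^'n \<Rightarrow> complex" assume t: "t \<ge> 0" and \<psi>: "\<psi> \<in> schwartz"
    have "(LBINT \<xi>. f t \<xi> * \<psi> \<xi>) = heat_op t u\<^sub>0 (fourier \<psi>) + L_op V u t (fourier \<psi>)"
      using assms(8) t schwartz_fourier[OF \<psi>] by (simp add: is_solution_def Upair[OF t \<psi>, symmetric])
    also have "heat_op t u\<^sub>0 (fourier \<psi>) = (LBINT \<xi>. heat_symbol t \<xi> * b \<xi> * \<psi> \<xi>)"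
      unfolding b_def by (rule heat_op_fourier[OF U0.PM_dist_axioms t \<psi>])
    also have "L_op V u t (fourier \<psi>) = (LBINT s:{0..t}. H.Bform (f s) (\<lambda>\<xi>. heat_symbol (t - s) \<xi> * \<psi> \<xi>))"
      unfolding L_op_def inv_fourier_dist_def inv_fourier_fourier[OF \<psi>] H.Bform_def
    proof (rule set_lebesgue_integral_cong)
      show "\<forall>s. s \<in> {0..t} \<longrightarrow> (LBINT \<xi>. heat_symbol (t - s) \<xi> * convolution (fourier_fun V) (fourier_fun (u s)) \<xi> * \<psi> \<xi>)
         = (LBINT \<xi>. convolution a (f s) \<xi> * (heat_symbol (t - s) \<xi> * \<psi> \<xi>))"
        by (simp add: convolution_fourier_version[OF V.PM_dist_axioms U] a_def f_def mult_ac)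
    qed simp
    finally show "(LBINT \<xi>. f t \<xi> * \<psi> \<xi>) = (LBINT \<xi>. heat_symbol t \<xi> * b \<xi> * \<psi> \<xi>)
       + (LBINT s:{0..t}. H.Bform (f s) (\<lambda>\<xi>. heat_symbol (t - s) \<xi> * \<psi> \<xi>))" .
  qed
  note sol = fb fc fs
  have selfsim: "u t \<phi> = complex_of_real (r powr (?n - k)) * dilate r (u (r\<^sup>2 * t)) \<phi>"
    if hom: "homogeneous (- (?n - k)) u\<^sub>0" "homogeneous (-2) V" and r: "r > 0" and t: "t > 0" and \<phi>: "\<phi> \<in> schwartz" for r t \<phi>
  proof -
    define \<psi> where "\<psi> = inv_fourier \<phi>"
    have \<psi>: "\<psi> \<in> schwartz" "fourier \<psi> = \<phi>" unfolding \<psi>_def by (auto intro: schwartz_inv_fourier fourier_inv_fourier \<phi>)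
    have t0: "t \<ge> 0" "r\<^sup>2 * t \<ge> 0" using t by auto
    have "dilate r (u (r\<^sup>2 * t)) \<phi> = (LBINT \<xi>. f (r\<^sup>2 * t) \<xi> * \<psi> (r *\<^sub>R \<xi>))"
      using PM_dist.dilate_fourier[OF U[OF t0(2)] r \<psi>(1)] by (simp add: \<psi>(2) f_def)
    also have "\<dots> = complex_of_real (r powr (k - ?n)) * (LBINT \<xi>. f t \<xi> * \<psi> \<xi>)"
    proof (rule H.solution_scaling[OF r _ _ sol t0(1) \<psi>(1)])
      show "AE \<xi> in lborel. a \<xi> = complex_of_real (r powr (?n - 2)) * a (r *\<^sub>R \<xi>)"
        using V.F_homogeneous[OF hom(2) r] by (simp add: a_def)
      show "AE \<xi> in lborel. b \<xi> = complex_of_real (r powr k) * b (r *\<^sub>R \<xi>)"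
        using U0.F_homogeneous[OF hom(1) r] by (simp add: b_def)
    qed
    also have "(LBINT \<xi>. f t \<xi> * \<psi> \<xi>) = u t \<phi>" using Upair[OF t0(1) \<psi>(1)] by (simp add: \<psi>(2))
    \<comment> \<open>The exponent k - n from the iterates is the inverse of the prefactor in the
      definition of self-similarity.\<close>
    finally have "complex_of_real (r powr (?n - k)) * dilate r (u (r\<^sup>2 * t)) \<phi> = complex_of_real (r powr (?n - k) * r powr (k - ?n)) * u t \<phi>"
      by (simp only: of_real_mult mult.assoc)
    also have "r powr (?n - k) * r powr (k - ?n) = 1" using r by (simp add: powr_add[symmetric])
    finally show ?thesis by simp
  qed
  have pos: "dist_pos (u t)" if "dist_nonneg V" "dist_nonneg u\<^sub>0" "\<phi>\<^sub>0 \<in> schwartz" "u\<^sub>0 \<phi>\<^sub>0 \<noteq> 0" "t > 0" for t \<phi>\<^sub>0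
    unfolding dist_pos_def
  proof (intro ballI impI)
    fix \<phi> :: "real^'n \<Rightarrow> complex" assume \<phi>: "\<phi> \<in> schwartz" "\<forall>x. 0 < \<phi> x"
    have "0 < (LBINT \<xi>. f t \<xi> * inv_fourier \<phi> \<xi>)"
      by (rule H.solution_pos[OF _ _ _ sol that(5)])
         (use \<phi> V.F_gauss_nonneg[OF that(1)] U0.F_gauss_nonneg[OF that(2)] U0.F_nonzero[OF that(3,4)] in \<open>auto simp: a_def b_def\<close>)
    then show "0 < u t \<phi>" using Upair_inv[of t \<phi>] that(5) \<phi>(1) by simp
  qed
  have neg: "dist_neg (u t)" if "dist_nonneg V" "dist_nonpos u\<^sub>0" "\<phi>\<^sub>0 \<in> schwartz" "u\<^sub>0 \<phi>\<^sub>0 \<noteq> 0" "t > 0" for t \<phi>\<^sub>0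
    unfolding dist_neg_def
  proof (intro ballI impI)
    fix \<phi> :: "real^'n \<Rightarrow> complex" assume \<phi>: "\<phi> \<in> schwartz" "\<forall>x. 0 < \<phi> x"
    have "0 < (LBINT \<xi>. - f t \<xi> * inv_fourier \<phi> \<xi>)"
    proof (rule H'.solution_pos[OF _ _ _ _ _ _ that(5) \<phi>(1)])
      show "gauss_nonneg a" "gauss_nonneg (\<lambda>\<xi>. - b \<xi>)" "\<not> (AE \<xi> in lborel. - b \<xi> = 0)"
        using V.F_gauss_nonneg[OF that(1)] U0.F_gauss_nonpos[OF that(2)] U0.F_nonzero[OF that(3,4)] by (auto simp: a_def b_def)
      show "H'.wbound N (\<lambda>\<xi>. - f s \<xi>)" if "s \<ge> 0" for s using fb[OF that] by (simp add: H.wbound_def)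
      show "H'.weakly_continuous (\<lambda>s \<xi>. - f s \<xi>)"
        using fc by (simp add: H.weakly_continuous_def continuous_on_minus)
      \<comment> \<open>\<open>Bform\<close> depends on \<open>a\<close> only, so both
        interpretations share it.\<close>
      have "H.Bform (\<lambda>\<xi>. - f s \<xi>) \<psi> = - H.Bform (f s) \<psi>" for s \<psi>
        by (simp add: H.Bform_def convolution_def)
      then show "H'.is_sol (\<lambda>s \<xi>. - f s \<xi>)"
        using fs by (simp add: H.is_sol_def H'.is_sol_def set_lebesgue_integral_def)
    qed (use \<phi> in auto)
    then have "0 < - u t \<phi>" using Upair_inv[of t \<phi>] that(5) \<phi>(1) by simp
    then show "u t \<phi> < 0" by (simp add: less_complex_def)
  qed
  \<comment> \<open>At time 0 the integral runs over a single point and the heat symbol is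
    1.\<close>
  have u0: "u 0 \<phi> = u\<^sub>0 \<phi>" if \<phi>: "\<phi> \<in> schwartz" for \<phi>
  proof -
    note \<psi> = schwartz_inv_fourier[OF \<phi>]
    have "u 0 \<phi> = (LBINT \<xi>. heat_symbol 0 \<xi> * b \<xi> * inv_fourier \<phi> \<xi>) + (LBINT s:{0..0}. H.Bform (f s) (\<lambda>\<xi>. heat_symbol (0 - s) \<xi> * inv_fourier \<phi> \<xi>))"
      using fs \<psi> Upair_inv[of 0 \<phi>] \<phi> by (simp add: H.is_sol_def)
    also have "(LBINT s:{0..0}. H.Bform (f s) (\<lambda>\<xi>. heat_symbol (0 - s) \<xi> * inv_fourier \<phi> \<xi>)) = 0"
      unfolding set_lebesgue_integral_def
      by (rule integral_eq_zero_AE, rule eventually_mono[OF AE_lborel_singleton[of 0]]) simp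
    also have "(LBINT \<xi>. heat_symbol 0 \<xi> * b \<xi> * inv_fourier \<phi> \<xi>) = u\<^sub>0 \<phi>"
      unfolding U0.pairing_inv[OF \<phi>] by (simp add: heat_symbol_def b_def)
    finally show ?thesis by simp
  qed
  have radial: "radially_symmetric (u t)" if "radially_symmetric V" "radially_symmetric u\<^sub>0" "t > 0" for t
    unfolding radially_symmetric_def
  proof (intro allI impI ballI)
    fix R :: "real^'n \<Rightarrow> real^'n" and \<phi> :: "real^'n \<Rightarrow> complex"
    assume R: "orthogonal_transformation R" and \<phi>: "\<phi> \<in> schwartz"
    define \<psi> where "\<psi> = inv_fourier \<phi>"
    have \<psi>: "\<psi> \<in> schwartz" "fourier \<psi> = \<phi>" unfolding \<psi>_def by (auto intro: schwartz_inv_fourier fourier_inv_fourier \<phi>)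
    have \<psi>R: "\<psi> \<circ> R \<in> schwartz" by (rule V.schwartz_orthogonal[OF R \<psi>(1)])
    have "fourier (\<psi> \<circ> R) = \<phi> \<circ> R"
      by (rule ext) (simp add: fourier_comp_orthogonal[OF R schwartz_measurable[OF \<psi>(1)]] \<psi>(2))
    then have "u t (\<phi> \<circ> R) = (LBINT \<xi>. f t \<xi> * \<psi> (R \<xi>))"
      using Upair[of t "\<psi> \<circ> R"] \<psi>R that(3) by simp
    also have "\<dots> = (LBINT \<xi>. f t \<xi> * \<psi> \<xi>)"
      by (rule H.solution_orthogonal[OF R _ _ sol _ \<psi>(1) \<psi>R])
         (use V.F_radial[OF that(1) R] U0.F_radial[OF that(2) R] that(3) in \<open>auto simp: a_def b_def\<close>)
    also have "\<dots> = u t \<phi>" using Upair[of t \<psi>] \<psi> that(3) by simp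
    finally show "u t (\<phi> \<circ> R) = u t \<phi>" .
  qed
  \<comment> \<open>Symmetry is assumed only for positive times; it reaches the initial value
    through weak continuity from the right at 0.\<close>
  have radial_initial: "radially_symmetric u\<^sub>0" if rad: "\<forall>t>0. radially_symmetric (u t)"
    unfolding radially_symmetric_def
  proof (intro allI impI ballI)
    fix R :: "real^'n \<Rightarrow> real^'n" and \<phi> :: "real^'n \<Rightarrow> complex"
    assume R: "orthogonal_transformation R" and \<phi>: "\<phi> \<in> schwartz"
    have \<phi>R: "\<phi> \<circ> R \<in> schwartz" by (rule V.schwartz_orthogonal[OF R \<phi>])
    have lim: "((\<lambda>t. u t \<theta>) \<longlongrightarrow> u\<^sub>0 \<theta>) (at_right 0)" if \<theta>: "\<theta> \<in> schwartz" for \<theta>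
    proof -
      have "((\<lambda>t. u t \<theta>) \<longlongrightarrow> u 0 \<theta>) (at 0 within {0..})"
        using wc[OF \<theta>] by (auto simp: continuous_on_def)
      then show ?thesis unfolding u0[OF \<theta>] by (rule tendsto_within_subset) auto
    qed
    have "((\<lambda>t. u t \<phi>) \<longlongrightarrow> u\<^sub>0 (\<phi> \<circ> R)) (at_right 0)"
    proof (rule Lim_transform_eventually[OF lim[OF \<phi>R]])
      show "\<forall>\<^sub>F t in at_right 0. u t (\<phi> \<circ> R) = u t \<phi>"
        using rad R \<phi> by (auto simp: eventually_at_filter radially_symmetric_def)
    qed
    then show "u\<^sub>0 (\<phi> \<circ> R) = u\<^sub>0 \<phi>" using tendsto_unique[OF _ _ lim[OF \<phi>]] by auto
  qed
  show ?thesis using selfsim pos neg radial radial_initial by blast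
qed

end
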